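(* Let $t\ge 1$ and let $(\mathrm{Enc}^t,\mathrm{Dec}^t)$ be an $\varepsilon$-secure quantum non-malleable code against $\mathsf{LO}^t$ with message length $k$ qubits and blocklength $n$ qubits. Fix an integer $0<\lambda<k$ and define a code $(\mathrm{Enc},\mathrm{Dec})$ on $t+1$ shares for $(k-\lambda)$-qubit messages as follows. $\mathrm{Enc}(\sigma_M)=\big((\mathrm{Enc}^t)_{ME}\otimes \mathrm{id}_{\hat E}\big)(\sigma_M\otimes\Phi^{\otimes\lambda}_{E\hat E})$, where $\Phi^{\otimes\lambda}_{E\hat E}$ is $\lambda$ EPR pairs on registers $E,\hat E$ of $\lambda$ qubits each; the first $t$ shares are the $t$ shares of $\mathrm{Enc}^t$ and the $(t+1)$-st share is $\hat E$. $\mathrm{Dec}$: apply $\mathrm{Dec}^t$ to the first $t$ shares, obtaining registers $M'E'$; measure $E'$ together with the $(t+1)$-st share with the two-outcome projective measurement $\{\Phi^{\otimes\lambda},\ \mathbb I-\Phi^{\otimes\lambda}\}$; if the outcome is $\Phi^{\otimes\lambda}$ output $M'$, otherwise output $\bot$. Then $(\mathrm{Enc},\mathrm{Dec})$ is an $(\varepsilon+2^{1-\lambda})$-secure quantum tamper-detection code against $\mathsf{LO}^{t+1}$ with message length $k-\lambda$ and blocklength $n+\lambda$.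
   Context: A quantum code on $t$ shares is a pair of CPTP maps $\mathrm{Enc}:\mathcal L(\mathcal H_M)\to\mathcal L(\mathcal H_{X_1}\otimes\cdots\otimes\mathcal H_{X_t})$ and $\mathrm{Dec}$ in the reverse direction (the decoder may additionally output a special state $\bot$ orthogonal to $\mathcal H_M$), satisfying $(\mathrm{Dec}\circ\mathrm{Enc}\otimes\mathrm{id})(\sigma_{M\hat M})=\sigma_{M\hat M}$ for every state; the blocklength is the total number of qubits of the shares. The class $\mathsf{LO}^t_{(e_1,\dots,e_t)}$ consists of adversaries $\mathcal A=(\Lambda_1,\dots,\Lambda_t,|\psi\rangle_{E_1\cdots E_t})$ with $|E_i|\le e_i$ qubits (an entry $*$ means unbounded), each $\Lambda_i$ a CPTP map on $X_iE_i$ (output $X_iE_i'$); the tampering channel is $\rho\mapsto\mathrm{Tr}_{E'_1\cdots E'_t}[(\Lambda_1\otimes\cdots\otimes\Lambda_t)(\rho\otimes\psi)]$. $\mathsf{LO}^t$ is the case $e_i=0$ for all $i$, i.e. channels $\Lambda_1\otimes\cdots\otimes\Lambda_t$. For a message $\sigma_M$ with canonical purification $\sigma_{M\hat M}$ let $\eta_{M'\hat M}=(\mathrm{Dec}\circ\mathcal A\circ\mathrm{Enc}\otimes\mathrm{id}_{\hat M})(\sigma_{M\hat M})$. The code is an $\varepsilon$-secure quantum non-malleable code against a class if for every adversary $\mathcal A$ in it there are $p_{\mathcal A}\in[0,1]$ and a state $\gamma_{M'}$ depending only on $\mathcal A$ such that for every $\sigma_M$, $\|\eta_{M'\hat M}-(p_{\mathcal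 A}\sigma_{M\hat M}+(1-p_{\mathcal A})\gamma_{M'}\otimes\sigma_{\hat M})\|_1\le\varepsilon$. It is an $\varepsilon$-secure quantum tamper-detection code if the same holds with $\gamma_{M'}=\bot_{M'}$. *)

theory Defs
  imports Complex_Main "Jordan_Normal_Form.Matrix"
begin

text \<open>Conventions. A register of q qubits has dimension 2^q. Composite registers
A B (dimensions a, b) use the Kronecker index convention: basis index of
(i,j) is i * b + j.\<close>

definition mtrace :: "complex mat \<Rightarrow> complex" where
  "mtrace A = (\<Sum>i<dim_row A. A $$ (i,i))"

definition adj :: "complex mat \<Rightarrow> complex mat" where
  "adj A = mat (dim_col A) (dim_row A) (\<lambda>(i,j). cnj (A $$ (j,i)))"

definition kron :: "complex mat \<Rightarrow> complex mat \<Rightarrow> complex mat" where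
  "kron A B = mat (dim_row A * dim_row B) (dim_col A * dim_col B)
     (\<lambda>(i,j). A $$ (i div dim_row B, j div dim_col B) * B $$ (i mod dim_row B, j mod dim_col B))"

definition psd :: "complex mat \<Rightarrow> bool" where
  "psd A \<longleftrightarrow> dim_row A = dim_col A \<and>
     (\<forall>v :: nat \<Rightarrow> complex.
        let q = (\<Sum>i<dim_row A. \<Sum>j<dim_row A. cnj (v i) * A $$ (i,j) * v j)
        in Im q = 0 \<and> 0 \<le> Re q)"

definition density :: "nat \<Rightarrow> complex mat \<Rightarrow> bool" where
  "density d \<rho> \<longleftrightarrow> \<rho> \<in> carrier_mat d d \<and> psd \<rho> \<and> mtrace \<rho> = 1"

definition psd_sqrt :: "complex mat \<Rightarrow> complex mat" where
  "psd_sqrt A = (SOME R. R \<in> carrier_mat (dim_row A) (dim_row A) \<and> psd R \<and> R * R = A)"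

definition trace_norm :: "complex mat \<Rightarrow> real" where
  "trace_norm A = Re (mtrace (psd_sqrt (adj A * A)))"

definition msum :: "nat \<Rightarrow> complex mat list \<Rightarrow> complex mat" where
  "msum d Ls = foldr (\<lambda>A B. A + B) Ls (0\<^sub>m d d)"

definition cptp :: "nat \<Rightarrow> nat \<Rightarrow> (complex mat \<Rightarrow> complex mat) \<Rightarrow> bool" where
  "cptp din dout \<Phi> \<longleftrightarrow>
     (\<exists>Ks :: complex mat list.
        (\<forall>K\<in>set Ks. K \<in> carrier_mat dout din) \<and>
        msum din (map (\<lambda>K. adj K * K) Ks) = 1\<^sub>m din \<and>
        (\<forall>X \<in> carrier_mat din din. \<Phi> X = msum dout (map (\<lambda>K. K * X * adj K) Ks)))"

text \<open>id_pre \<otimes> \<Phi> \<otimes> id_post, where \<Phi> maps din-dim to dout-dim systems;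
input has dimension pre*din*post, output pre*dout*post.\<close>
definition on_sub :: "nat \<Rightarrow> nat \<Rightarrow> nat \<Rightarrow> nat \<Rightarrow> (complex mat \<Rightarrow> complex mat) \<Rightarrow> complex mat \<Rightarrow> complex mat" where
  "on_sub pre din dout post \<Phi> X = mat (pre * dout * post) (pre * dout * post)
     (\<lambda>(i,j). let p = i div (dout * post); s = (i div post) mod dout; q = i mod post;
                  p' = j div (dout * post); s' = (j div post) mod dout; q' = j mod post
              in \<Phi> (mat din din (\<lambda>(a,b). X $$ ((p * din + a) * post + q, (p' * din + b) * post + q')))
                   $$ (s, s'))"

definition ptrace :: "nat \<Rightarrow> nat \<Rightarrow> nat \<Rightarrow> complex mat \<Rightarrow> complex mat" where
  "ptrace pre d post X = mat (pre * post) (pre * post)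
     (\<lambda>(i,j). \<Sum>s<d. X $$ (((i div post) * d + s) * post + i mod post,
                          ((j div post) * d + s) * post + j mod post))"

text \<open>Canonical purification sigma_{M Mhat} of a d-dimensional state sigma_M:
|psi> = (sqrt sigma \<otimes> I) sum_l |l>|l>.\<close>
definition canon_pur :: "complex mat \<Rightarrow> complex mat" where
  "canon_pur \<sigma> = (let d = dim_row \<sigma>; R = psd_sqrt \<sigma> in
     mat (d * d) (d * d) (\<lambda>(a,b). R $$ (a div d, a mod d) * cnj (R $$ (b div d, b mod d))))"

text \<open>Embedding of a state on M R (dim d*r) into (M \<oplus> bot) R (dim (d+1)*r);
the extra basis vector with index d of the message output register is bot.\<close>
definition embed_bot :: "nat \<Rightarrow> nat \<Rightarrow> complex mat \<Rightarrow> complex mat" where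
  "embed_bot d r X = mat ((d + 1) * r) ((d + 1) * r)
     (\<lambda>(a,b). if a < d * r \<and> b < d * r then X $$ (a,b) else 0)"

definition bot_state :: "nat \<Rightarrow> complex mat" where
  "bot_state d = mat (d + 1) (d + 1) (\<lambda>(i,j). if i = d \<and> j = d then 1 else 0)"

text \<open>A quantum code for k-qubit messages with shares of ns!i qubits
(blocklength sum_list ns). Dec outputs on M \<oplus> bot (dimension 2^k + 1).\<close>
definition qcode :: "nat \<Rightarrow> nat list \<Rightarrow> (complex mat \<Rightarrow> complex mat) \<Rightarrow> (complex mat \<Rightarrow> complex mat) \<Rightarrow> bool" where
  "qcode k ns Enc Dec \<longleftrightarrow>
     cptp (2^k) (2^sum_list ns) Enc \<and> cptp (2^sum_list ns) (2^k + 1) Dec \<and>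
     (\<forall>r \<sigma>. density (2^k * r) \<sigma> \<longrightarrow>
        on_sub 1 (2^sum_list ns) (2^k + 1) r Dec (on_sub 1 (2^k) (2^sum_list ns) r Enc \<sigma>)
          = embed_bot (2^k) r \<sigma>)"

definition LO_adv :: "nat list \<Rightarrow> (complex mat \<Rightarrow> complex mat) list \<Rightarrow> bool" where
  "LO_adv ns Ls \<longleftrightarrow> length Ls = length ns \<and>
     (\<forall>i<length ns. cptp (2^(ns!i)) (2^(ns!i)) (Ls!i))"

text \<open>The tampering channel Lambda_1 \<otimes> ... \<otimes> Lambda_t applied to the shares,
with an untouched reference register of dimension r at the end.\<close>
definition tamper :: "nat list \<Rightarrow> (complex mat \<Rightarrow> complex mat) list \<Rightarrow> nat \<Rightarrow> complex mat \<Rightarrow> complex mat" where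
  "tamper ns Ls r X = foldr (\<lambda>i Y. on_sub (2^sum_list (take i ns)) (2^(ns!i)) (2^(ns!i))
                                     (2^sum_list (drop (Suc i) ns) * r) (Ls!i) Y)
                            [0..<length ns] X"

definition tampered_out :: "nat \<Rightarrow> nat list \<Rightarrow> (complex mat \<Rightarrow> complex mat) \<Rightarrow> (complex mat \<Rightarrow> complex mat)
    \<Rightarrow> (complex mat \<Rightarrow> complex mat) list \<Rightarrow> complex mat \<Rightarrow> complex mat" where
  "tampered_out k ns Enc Dec Ls \<sigma> =
     on_sub 1 (2^sum_list ns) (2^k + 1) (2^k) Dec
       (tamper ns Ls (2^k) (on_sub 1 (2^k) (2^sum_list ns) (2^k) Enc (canon_pur \<sigma>)))"

definition security_bound :: "nat \<Rightarrow> nat list \<Rightarrow> (complex mat \<Rightarrow> complex mat) \<Rightarrow> (complex mat \<Rightarrow> complex mat)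
    \<Rightarrow> (complex mat \<Rightarrow> complex mat) list \<Rightarrow> real \<Rightarrow> complex mat \<Rightarrow> real \<Rightarrow> bool" where
  "security_bound k ns Enc Dec Ls p \<gamma> \<epsilon> \<longleftrightarrow>
     (\<forall>\<sigma>. density (2^k) \<sigma> \<longrightarrow>
        trace_norm (tampered_out k ns Enc Dec Ls \<sigma>
          - (complex_of_real p \<cdot>\<^sub>m embed_bot (2^k) (2^k) (canon_pur \<sigma>)
             + complex_of_real (1 - p) \<cdot>\<^sub>m kron \<gamma> (ptrace 1 (2^k) (2^k) (canon_pur \<sigma>))))
        \<le> \<epsilon>)"

definition qnm_code_LO :: "nat \<Rightarrow> nat list \<Rightarrow> (complex mat \<Rightarrow> complex mat) \<Rightarrow> (complex mat \<Rightarrow> complex mat) \<Rightarrow> real \<Rightarrow> bool" where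
  "qnm_code_LO k ns Enc Dec \<epsilon> \<longleftrightarrow> qcode k ns Enc Dec \<and>
     (\<forall>Ls. LO_adv ns Ls \<longrightarrow>
        (\<exists>p \<gamma>. 0 \<le> p \<and> p \<le> 1 \<and> density (2^k + 1) \<gamma> \<and> security_bound k ns Enc Dec Ls p \<gamma> \<epsilon>))"

definition qtd_code_LO :: "nat \<Rightarrow> nat list \<Rightarrow> (complex mat \<Rightarrow> complex mat) \<Rightarrow> (complex mat \<Rightarrow> complex mat) \<Rightarrow> real \<Rightarrow> bool" where
  "qtd_code_LO k ns Enc Dec \<epsilon> \<longleftrightarrow> qcode k ns Enc Dec \<and>
     (\<forall>Ls. LO_adv ns Ls \<longrightarrow>
        (\<exists>p. 0 \<le> p \<and> p \<le> 1 \<and> security_bound k ns Enc Dec Ls p (bot_state (2^k)) \<epsilon>))"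

text \<open>lambda EPR pairs on E Ehat (each lambda qubits, D = 2^lambda): the maximally
entangled state (1/D) sum_{e,f} |e e><f f|.\<close>
definition epr :: "nat \<Rightarrow> complex mat" where
  "epr l = (let D = 2^l in mat (D * D) (D * D)
     (\<lambda>(a,b). if a div D = a mod D \<and> b div D = b mod D then 1 / of_nat D else 0))"

text \<open>Enc(sigma_M) = (Enc^t_{ME} \<otimes> id_{Ehat})(sigma_M \<otimes> Phi_{E Ehat}).
Input of Enc^t is M E (k qubits, M first); output shares X_1..X_t then Ehat.\<close>
definition new_enc :: "nat \<Rightarrow> nat \<Rightarrow> nat \<Rightarrow> (complex mat \<Rightarrow> complex mat) \<Rightarrow> complex mat \<Rightarrow> complex mat" where
  "new_enc k l n EncT \<sigma> = on_sub 1 (2^k) (2^n) (2^l) EncT (kron \<sigma> (epr l))"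

text \<open>Dec: apply Dec^t to the first t shares, giving Z on (M'E' \<oplus> bot) Ehat;
measure {Phi, I - Phi} on E' Ehat (projector P = I_{M'} \<otimes> Phi on the non-bot part);
on outcome Phi output M' (trace out E' Ehat), otherwise (incl. Dec^t = bot) output bot.\<close>
definition new_dec :: "nat \<Rightarrow> nat \<Rightarrow> nat \<Rightarrow> (complex mat \<Rightarrow> complex mat) \<Rightarrow> complex mat \<Rightarrow> complex mat" where
  "new_dec k l n DecT Y =
     (let Dm = 2^(k - l); D = 2^l; K = 2^k;
          Z = on_sub 1 (2^n) (K + 1) D DecT Y;
          Pk = kron (1\<^sub>m Dm) (epr l);
          P = mat ((K + 1) * D) ((K + 1) * D)
                (\<lambda>(a,b). if a < K * D \<and> b < K * D then Pk $$ (a,b) else 0);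
          A = ptrace Dm (D * D) 1 (P * Z * P);
          rej = mtrace ((1\<^sub>m ((K + 1) * D) - P) * Z)
      in mat (Dm + 1) (Dm + 1)
           (\<lambda>(i,j). if i < Dm \<and> j < Dm then A $$ (i,j)
                    else if i = Dm \<and> j = Dm then rej else 0))"

end

theory Submission
  imports Defs "Jordan_Normal_Form.Spectral_Radius"
begin

text \<open>
  Let $\Psi$ be the channel on the messages of the inner code induced by the tampering of the
  first $t$ shares. The maximally mixed state on $E$ has the canonical purification
  $\Phi_{E\hat E}$, so the tampered new code is obtained from $\Psi$, applied to half of the
  canonical purification of $\sigma \otimes I_E / D$ with $D = 2^\lambda$, by a channel that acts
  with the last tampering map $\Lambda$ on $\hat E$ and then performs the EPR test. Channels
  contract the trace norm, so $\Psi$ may be replaced by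
  $p\,\mathrm{id} + (1-p)\,\gamma\,\mathrm{tr}$ at cost $\varepsilon$. On the identity part the test
  passes with probability $q$, the entanglement fidelity of $\Lambda$, and then returns the message
  intact. On the other part $E$ and $\hat E$ are in a product state, which passes with probability
  at most $1/D$, so the output is within $2/D$ of $\bot$ in trace norm. Hence $pq$ serves as
  the probability of the tamper-detection code.
\<close>

section \<open>Positive semidefinite matrices and the trace norm\<close>

text \<open>The inner guarantee speaks only of canonical purifications, while the new code feeds the
  inner encoder half of a purified \<open>\<sigma>\<close> next to half of some EPR pairs. The two
  inputs agree because the positive root of \<open>\<sigma> \<otimes> I/D\<close> is a product, so
  its purifying register splits into Mhat and Ehat, up to their order. The map on Ehat touches only
  this reference and so commutes with \<open>\<Psi>\<close>; together with the EPR test it becomes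
  post-processing of the inner experiment. The numerator of \<open>2 / D\<close> arises because a
  product state accepted with weight c adds an unwanted part of trace c and also lacks weight c on
  the rejecting state. Both \<open>trace_norm\<close> and \<open>canon_pur\<close> go through
  \<open>psd_sqrt\<close>, which is a choice operator, so existence and uniqueness of positive roots
  must precede every estimate and every computation of a purification. For the estimates it is then
  enough to know that, for Hermitian X, \<open>trace_norm X\<close> is the least value of tr A + tr
  B over all psd A, B with X = A - B.\<close>

lemma dim_adj [simp]: "dim_row (adj A) = dim_col A" "dim_col (adj A) = dim_row A"
  by (simp_all add: adj_def)

lemma index_adj [simp]:
  "i < dim_col A \<Longrightarrow> j < dim_row A \<Longrightarrow> adj A $$ (i, j) = cnj (A $$ (j, i))"
  by (simp add: adj_def)

lemma adj_carrier [intro, simp]: "A \<in> carrier_mat m n \<Longrightarrow> adj A \<in> carrier_mat n m"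
  by (intro carrier_matI) auto

lemma adj_adj [simp]: "adj (adj A) = A"
  by (rule eq_matI) auto

lemma index_mult_sum:
  assumes "i < dim_row A" "j < dim_col B" "dim_col A = dim_row B"
  shows "(A * B) $$ (i, j) = (\<Sum>k<dim_row B. A $$ (i, k) * B $$ (k, j))"
  using assms by (simp add: scalar_prod_def atLeast0LessThan)

lemma mult_assoc_dim:
  assumes "dim_col A = dim_row B" "dim_col B = dim_row C"
  shows "(A * B) * C = A * (B * (C :: 'a :: semiring_0 mat))"
  by (rule assoc_mult_mat[of A "dim_row A" "dim_col A" B "dim_col B" C "dim_col C"])
    (rule carrier_matI, simp_all add: assms)+

lemma adj_mult:
  assumes "dim_col A = dim_row B"
  shows "adj (A * B) = adj B * adj A"
  using assms by (intro eq_matI) (simp_all add: index_mult_sum mult.commute del: index_mult_mat(1))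

lemma adj_minus:
  "A \<in> carrier_mat m n \<Longrightarrow> B \<in> carrier_mat m n \<Longrightarrow> adj (A - B) = adj A - adj B"
  by (rule eq_matI) auto

lemma adj_one [simp]: "adj (1\<^sub>m n) = 1\<^sub>m n"
  by (rule eq_matI) auto

lemma index_conj:
  assumes "dim_col A = n" "X \<in> carrier_mat n n" "i < dim_row A" "j < dim_row A"
  shows "(A * X * adj A) $$ (i, j) = (\<Sum>a<n. \<Sum>b<n. A $$ (i, a) * X $$ (a, b) * cnj (A $$ (j, b)))"
proof -
  have "(A * X * adj A) $$ (i, j) = (\<Sum>b<n. (\<Sum>a<n. A $$ (i, a) * X $$ (a, b)) * cnj (A $$ (j, b)))"
    using assms by (simp add: index_mult_sum del: index_mult_mat(1))
  also have "\<dots> = (\<Sum>b<n. \<Sum>a<n. A $$ (i, a) * X $$ (a, b) * cnj (A $$ (j, b)))"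
    by (simp add: sum_distrib_right)
  finally show ?thesis by (subst sum.swap)
qed

lemma mtrace_mult_comm:
  assumes "dim_col A = dim_row B" "dim_col B = dim_row A"
  shows "mtrace (A * B) = mtrace (B * A)"
  unfolding mtrace_def using assms
  by (simp add: index_mult_sum mult.commute del: index_mult_mat(1)) (rule sum.swap)

lemma mtrace_add:
  "A \<in> carrier_mat n n \<Longrightarrow> B \<in> carrier_mat n n \<Longrightarrow> mtrace (A + B) = mtrace A + mtrace B"
  by (simp add: mtrace_def sum.distrib)

lemma mtrace_smult: "A \<in> carrier_mat n n \<Longrightarrow> mtrace (c \<cdot>\<^sub>m A) = c * mtrace A"
  by (simp add: mtrace_def sum_distrib_left)

lemma mtrace_minus:
  "A \<in> carrier_mat n n \<Longrightarrow> B \<in> carrier_mat n n \<Longrightarrow> mtrace (A - B) = mtrace A - mtrace B"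
  by (simp add: mtrace_def sum_subtractf)

definition qform :: "complex mat \<Rightarrow> (nat \<Rightarrow> complex) \<Rightarrow> complex" where
  "qform A v = (\<Sum>i<dim_row A. \<Sum>j<dim_row A. cnj (v i) * A $$ (i, j) * v j)"

text \<open>In the order on complex numbers \<open>0 \<le> z\<close> means that z is real and
  nonnegative, so the two conditions in \<open>psd\<close> merge into one inequality.\<close>

lemma psd_iff_qform:
  "psd A \<longleftrightarrow> dim_row A = dim_col A \<and> (\<forall>v. 0 \<le> qform A v)"
  by (auto simp: psd_def qform_def Let_def less_eq_complex_def)

lemma sum_swap4:
  "(\<Sum>i\<in>I. \<Sum>j\<in>J. \<Sum>a\<in>A. \<Sum>b\<in>B. f i j a b) = (\<Sum>a\<in>A. \<Sum>b\<in>B. \<Sum>i\<in>I. \<Sum>j\<in>J. f i j a b)"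
proof -
  have "(\<Sum>i\<in>I. \<Sum>j\<in>J. \<Sum>a\<in>A. \<Sum>b\<in>B. f i j a b) = (\<Sum>i\<in>I. \<Sum>a\<in>A. \<Sum>b\<in>B. \<Sum>j\<in>J. f i j a b)"
    by (rule sum.cong[OF refl], subst sum.swap, rule sum.cong[OF refl], rule sum.swap)
  also have "\<dots> = (\<Sum>a\<in>A. \<Sum>b\<in>B. \<Sum>i\<in>I. \<Sum>j\<in>J. f i j a b)"
    by (subst sum.swap, rule sum.cong[OF refl], rule sum.swap)
  finally show ?thesis .
qed

lemma psd_conj:
  assumes "psd X" "X \<in> carrier_mat n n" "dim_col A = n"
  shows "psd (A * X * adj A)"
proof -
  have "0 \<le> qform (A * X * adj A) v" for v
  proof -
    \<comment> \<open>\<open>w\<close> is \<open>adj A\<close> applied to \<open>v\<close>: the form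
      of \<open>A * X * adj A\<close> at \<open>v\<close> is the form of \<open>X\<close> at
      \<open>w\<close>.\<close>
    define w where "w b = (\<Sum>j<dim_row A. cnj (A $$ (j, b)) * v j)" for b
    have "qform (A * X * adj A) v
      = (\<Sum>i<dim_row A. \<Sum>j<dim_row A. \<Sum>a<n. \<Sum>b<n.
            cnj (v i) * (A $$ (i, a) * X $$ (a, b) * cnj (A $$ (j, b))) * v j)"
      unfolding qform_def using assms
      by (simp add: index_conj sum_distrib_left sum_distrib_right del: index_mult_mat(1))
    also have "\<dots> = (\<Sum>a<n. \<Sum>b<n. \<Sum>i<dim_row A. \<Sum>j<dim_row A.
            cnj (v i) * (A $$ (i, a) * X $$ (a, b) * cnj (A $$ (j, b))) * v j)"
      by (rule sum_swap4)
    also have "\<dots> = qform X w"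
      unfolding qform_def w_def using assms
      by (simp add: sum_distrib_left sum_distrib_right mult_ac)
    finally show ?thesis using assms(1) by (simp add: psd_iff_qform)
  qed
  thus ?thesis by (simp add: psd_iff_qform)
qed

lemma qform_one: "qform (1\<^sub>m n) v = (\<Sum>i<n. cnj (v i) * v i)"
proof -
  have "qform (1\<^sub>m n) v = (\<Sum>i<n. \<Sum>j<n. if i = j then cnj (v i) * v j else 0)"
    unfolding qform_def by (intro sum.cong refl) (auto simp: one_mat_def)
  thus ?thesis by simp
qed

lemma psd_one: "psd (1\<^sub>m n)"
  unfolding psd_iff_qform qform_one by (auto intro!: sum_nonneg add_nonneg_nonneg simp: less_eq_complex_def)

lemma psd_gram: "psd (adj Q * Q)"
  using psd_conj[OF psd_one[of "dim_row Q"], of "dim_row Q" "adj Q"] by simp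

lemma psd_add:
  assumes "psd A" "psd B" "A \<in> carrier_mat n n" "B \<in> carrier_mat n n"
  shows "psd (A + B)"
proof -
  have "qform (A + B) v = qform A v + qform B v" for v
    unfolding qform_def using assms by (simp add: sum.distrib algebra_simps)
  thus ?thesis using assms by (simp add: psd_iff_qform)
qed

lemma psd_smult:
  assumes "psd A" "0 \<le> c"
  shows "psd (complex_of_real c \<cdot>\<^sub>m A)"
proof -
  have "qform (complex_of_real c \<cdot>\<^sub>m A) v = complex_of_real c * qform A v" for v
    unfolding qform_def using assms(1) by (simp add: psd_iff_qform sum_distrib_left mult_ac)
  moreover have "0 \<le> complex_of_real c" using assms(2) by (simp add: less_eq_complex_def)
  ultimately show ?thesis using assms(1) by (simp add: psd_iff_qform mult_nonneg_nonneg)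
qed

text \<open>Vectors supported on two coordinates see only a 2 by 2 principal submatrix. Hermiticity
  and the minor inequality \<open>psd_minor\<close> are both read off from such vectors.\<close>

lemma qform_two:
  assumes "i < dim_row A" "j < dim_row A" "i \<noteq> j"
  shows "qform A (\<lambda>k. if k = i then x else if k = j then y else 0)
    = cnj x * A $$ (i, i) * x + cnj x * A $$ (i, j) * y + cnj y * A $$ (j, i) * x + cnj y * A $$ (j, j) * y"
    (is "qform A ?v = _")
proof -
  have sub: "(\<Sum>k<dim_row A. f k) = f i + f j" if "\<And>k. k \<noteq> i \<Longrightarrow> k \<noteq> j \<Longrightarrow> f k = 0" for f :: "nat \<Rightarrow> complex"
  proof -
    have "(\<Sum>k<dim_row A. f k) = (\<Sum>k\<in>{i, j}. f k)"
      using assms that by (intro sum.mono_neutral_right) auto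
    thus ?thesis using assms(3) by simp
  qed
  have "qform A ?v = (\<Sum>l<dim_row A. cnj (?v i) * A $$ (i, l) * ?v l) + (\<Sum>l<dim_row A. cnj (?v j) * A $$ (j, l) * ?v l)"
    unfolding qform_def by (rule sub) simp
  also have "(\<Sum>l<dim_row A. cnj (?v i) * A $$ (i, l) * ?v l)
      = cnj (?v i) * A $$ (i, i) * ?v i + cnj (?v i) * A $$ (i, j) * ?v j"
    by (rule sub) simp
  also have "(\<Sum>l<dim_row A. cnj (?v j) * A $$ (j, l) * ?v l)
      = cnj (?v j) * A $$ (j, i) * ?v i + cnj (?v j) * A $$ (j, j) * ?v j"
    by (rule sub) simp
  finally show ?thesis using assms(3) by simp
qed

lemma psd_diag:
  assumes "psd A" "i < dim_row A"
  shows "0 \<le> A $$ (i, i)"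
proof -
  have "qform A (\<lambda>k. if k = i then 1 else 0)
      = (\<Sum>k<dim_row A. \<Sum>l<dim_row A. if k = i then (if l = i then A $$ (k, l) else 0) else 0)"
    unfolding qform_def by (intro sum.cong) auto
  also have "\<dots> = (\<Sum>k<dim_row A. if k = i then (\<Sum>l<dim_row A. if l = i then A $$ (k, l) else 0) else 0)"
    by (intro sum.cong) auto
  also have "\<dots> = A $$ (i, i)"
    using assms(2) by simp
  finally show ?thesis using assms(1) by (metis psd_iff_qform)
qed

text \<open>\<open>psd\<close> does not ask for hermiticity; it follows from the form being real.
  The vector with entries 1, 1 at positions i, j relates the imaginary parts of the two mirrored
  entries, the vector with entries 1, \<open>\<i>\<close> their real parts.\<close>

lemma psd_hermitian:
  assumes "psd A"
  shows "adj A = A"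
proof (rule eq_matI)
  fix i j assume "i < dim_row A" "j < dim_col A"
  moreover have A: "dim_row A = dim_col A" using assms by (simp add: psd_def)
  ultimately have ij: "i < dim_row A" "j < dim_row A" by auto
  have "cnj (A $$ (j, i)) = A $$ (i, j)"
  proof (cases "i = j")
    case True
    with psd_diag[OF assms ij(1)] show ?thesis by (simp add: complex_eq_iff less_eq_complex_def)
  next
    case False
    have "0 \<le> qform A (\<lambda>k. if k = i then 1 else if k = j then y else 0)" for y
      using assms by (simp add: psd_iff_qform)
    from this[of 1] this[of "\<i>"] psd_diag[OF assms ij(1)] psd_diag[OF assms ij(2)]
    show ?thesis
      unfolding qform_two[OF ij False] by (simp add: complex_eq_iff less_eq_complex_def)
  qed
  thus "adj A $$ (i, j) = A $$ (i, j)" using ij A by simp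
qed (use assms in \<open>auto simp: psd_def\<close>)

lemma mtrace_psd:
  assumes "psd A"
  shows "0 \<le> mtrace A"
  unfolding mtrace_def using psd_diag[OF assms] by (intro sum_nonneg) auto

lemma adj_mat_diag [simp]: "adj (mat_diag n d) = mat_diag n (\<lambda>i. cnj (d i))"
  by (rule eq_matI) (auto simp: mat_diag_def)

lemma dim_mat_diag [simp]: "dim_row (mat_diag n d) = n" "dim_col (mat_diag n d) = n"
  by (simp_all add: mat_diag_def)

section \<open>Spectral theorem for Hermitian matrices\<close>

text \<open>Deflation step: an eigenvector is completed to a basis and orthogonalised by
  Gram-Schmidt, which leaves the first vector alone. In the resulting orthonormal basis the first
  column of the matrix is a multiple of the first unit vector.\<close>

lemma exists_unitary_first_column:
  fixes A :: "complex mat"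
  assumes A: "A \<in> carrier_mat n n" and n: "0 < n"
  shows "\<exists>W e. W \<in> carrier_mat n n \<and> adj W * W = 1\<^sub>m n \<and>
    (\<forall>i<n. (adj W * (A * W)) $$ (i, 0) = (if i = 0 then e else 0))"
proof -
  from spectrum_non_empty[OF A n] obtain e where "eigenvalue A e"
    by (auto simp: spectrum_def)
  then obtain v where "eigenvector A v e" by (auto simp: eigenvalue_def)
  hence v: "v \<in> carrier_vec n" and v0: "v \<noteq> 0\<^sub>v n" and Av: "A *\<^sub>v v = e \<cdot>\<^sub>v v"
    using A by (auto simp: eigenvector_def)
  interpret cof_vec_space n "TYPE(complex)" .
  define b where "b = basis_completion v"
  define ws where "ws = gram_schmidt n b"
  from basis_completion[OF v v0, folded b_def]
  have dist_b: "distinct b" and indep: "\<not> lin_dep (set b)" and b: "set b \<subseteq> carrier_vec n"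
    and hdb: "hd b = v" and len_b: "length b = n" by auto
  from hdb len_b n obtain vs where bv: "b = v # vs" by (cases b, auto)
  from gram_schmidt_result[OF b dist_b indep refl, folded ws_def]
  have ws: "set ws \<subseteq> carrier_vec n" "corthogonal ws" "length ws = n" by (auto simp: len_b)
  from gram_schmidt_hd[OF v, of vs, folded bv] have "hd ws = v" unfolding ws_def .
  with ws(3) n have ws0: "ws ! 0 = v" by (cases ws) auto
  have wsi: "ws ! i \<in> carrier_vec n" if "i < n" for i using ws that by auto
  \<comment> \<open>Gram-Schmidt delivers orthogonal vectors without normalising them;
    \<open>s i\<close> is the norm of the i-th one.\<close>
  define s where "s i = complex_of_real (sqrt (\<Sum>k<n. (cmod (ws ! i $ k))\<^sup>2))" for i
  have ip: "ws ! i \<bullet>c ws ! j = (\<Sum>k<n. ws ! i $ k * cnj (ws ! j $ k))" if "i < n" "j < n" for i j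
    using wsi[OF that(1)] wsi[OF that(2)] by (simp add: scalar_prod_def atLeast0LessThan)
  have s2: "s i * s i = (\<Sum>k<n. ws ! i $ k * cnj (ws ! i $ k))" for i
  proof -
    have "s i * s i = complex_of_real ((sqrt (\<Sum>k<n. (cmod (ws ! i $ k))\<^sup>2))\<^sup>2)"
      unfolding s_def of_real_power by (rule power2_eq_square[symmetric])
    also have "\<dots> = (\<Sum>k<n. complex_of_real ((cmod (ws ! i $ k))\<^sup>2))"
      by (subst real_sqrt_pow2) (auto intro: sum_nonneg)
    finally show ?thesis by (simp only: complex_norm_square)
  qed
  have s0: "s i \<noteq> 0" if "i < n" for i
  proof
    assume "s i = 0"
    with s2[of i] ip[OF that that] have "ws ! i \<bullet>c ws ! i = 0" by simp
    with corthogonalD[OF ws(2), of i i] that ws(3) show False by simp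
  qed
  have cs: "cnj (s i) = s i" for i by (simp add: s_def)
  define W where "W = mat n n (\<lambda>(i, j). ws ! j $ i / s j)"
  have W: "W \<in> carrier_mat n n" by (simp add: W_def)
  have orth: "adj W * W = 1\<^sub>m n"
  proof (rule eq_matI)
    fix i j assume "i < dim_row (1\<^sub>m n :: complex mat)" "j < dim_col (1\<^sub>m n :: complex mat)"
    hence ij: "i < n" "j < n" by auto
    have "(adj W * W) $$ (i, j) = (\<Sum>k<n. ws ! j $ k * cnj (ws ! i $ k)) / (s i * s j)"
      using ij W by (simp add: index_mult_sum sum_divide_distrib W_def cs mult_ac del: index_mult_mat(1))
    also have "\<dots> = (if i = j then 1 else 0)"
    proof (cases "i = j")
      case True
      thus ?thesis using s2[of i, symmetric] s0[OF ij(1)] by simp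
    next
      case False
      with corthogonalD[OF ws(2), of j i] ij ws(3) have "ws ! j \<bullet>c ws ! i = 0" by simp
      thus ?thesis using ip[OF ij(2,1)] False by simp
    qed
    finally show "(adj W * W) $$ (i, j) = 1\<^sub>m n $$ (i, j)" using ij by simp
  qed (use W in auto)
  have AW: "(A * W) $$ (k, 0) = e * W $$ (k, 0)" if "k < n" for k
  proof -
    have "(A * W) $$ (k, 0) = (\<Sum>l<n. A $$ (k, l) * v $ l) / s 0"
      using that n A W by (simp add: index_mult_sum sum_divide_distrib W_def ws0 del: index_mult_mat(1))
    also have "(\<Sum>l<n. A $$ (k, l) * v $ l) = (A *\<^sub>v v) $ k"
      using that A v by (simp add: scalar_prod_def atLeast0LessThan)
    finally show ?thesis using that v n by (simp add: Av W_def ws0)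
  qed
  have "(adj W * (A * W)) $$ (i, 0) = (if i = 0 then e else 0)" if "i < n" for i
  proof -
    have "(adj W * (A * W)) $$ (i, 0) = (\<Sum>k<n. adj W $$ (i, k) * (A * W) $$ (k, 0))"
      using that n A W by (subst index_mult_sum) auto
    also have "\<dots> = e * (\<Sum>k<n. adj W $$ (i, k) * W $$ (k, 0))"
      by (simp add: AW sum_distrib_left mult_ac)
    also have "(\<Sum>k<n. adj W $$ (i, k) * W $$ (k, 0)) = (adj W * W) $$ (i, 0)"
      using that n W by (subst index_mult_sum) auto
    finally show ?thesis using that n by (simp add: orth)
  qed
  with W orth show ?thesis by blast
qed

lemma unitary_right:
  assumes "U \<in> carrier_mat n n" "adj U * U = 1\<^sub>m n"
  shows "U * adj U = 1\<^sub>m n"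
  using mat_mult_left_right_inverse[of "adj U" n U] assms by auto

lemma adj_four_block:
  assumes "A \<in> carrier_mat a c" "B \<in> carrier_mat a d" "C \<in> carrier_mat b c" "D \<in> carrier_mat b d"
  shows "adj (four_block_mat A B C D) = four_block_mat (adj A) (adj C) (adj B) (adj D)"
  using assms by (intro eq_matI) auto

text \<open>Induction on the dimension: after deflation hermiticity clears the first row along with
  the first column, and the remaining block is again Hermitian.\<close>

lemma hermitian_diagonalizable:
  assumes "A \<in> carrier_mat n n" "adj A = A"
  shows "\<exists>U d. U \<in> carrier_mat n n \<and> adj U * U = 1\<^sub>m n \<and> A = U * mat_diag n d * adj U"
  using assms
proof (induction n arbitrary: A)
  case 0
  thus ?case by (intro exI[of _ "1\<^sub>m 0"] exI[of _ "\<lambda>_. 0"]) (auto intro!: eq_matI)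
next
  case (Suc n)
  from exists_unitary_first_column[OF Suc.prems(1)]
  obtain W e where W: "W \<in> carrier_mat (Suc n) (Suc n)" and WW: "adj W * W = 1\<^sub>m (Suc n)"
    and col0: "\<And>i. i < Suc n \<Longrightarrow> (adj W * (A * W)) $$ (i, 0) = (if i = 0 then e else 0)"
    by (metis zero_less_Suc)
  note WW' = unitary_right[OF W WW]
  note A = Suc.prems(1)
  define B where "B = adj W * (A * W)"
  have B: "B \<in> carrier_mat (Suc n) (Suc n)" using A W by (auto simp: B_def)
  have "adj B = B"
    using A W Suc.prems(2) by (simp add: B_def adj_mult mult_assoc_dim)
  hence herm: "cnj (B $$ (j, i)) = B $$ (i, j)" if "i < Suc n" "j < Suc n" for i j
    using index_adj[of i B j] that B by simp
  define C where "C = mat n n (\<lambda>(i, j). B $$ (Suc i, Suc j))"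
  have C: "C \<in> carrier_mat n n" by (simp add: C_def)
  have "adj C = C" by (rule eq_matI) (auto simp: C_def herm)
  from Suc.IH[OF C this] obtain V d where V: "V \<in> carrier_mat n n" and VV: "adj V * V = 1\<^sub>m n"
    and CV: "C = V * mat_diag n d * adj V" by blast
  \<comment> \<open>The unitary that diagonalises the smaller block, extended by 1 on the
    eigenvector already split off.\<close>
  define V' where "V' = four_block_mat (1\<^sub>m 1) (0\<^sub>m 1 n) (0\<^sub>m n 1) V"
  have V': "V' \<in> carrier_mat (Suc n) (Suc n)" using V by (auto simp: V'_def)
  have aV': "adj V' = four_block_mat (1\<^sub>m 1) (0\<^sub>m 1 n) (0\<^sub>m n 1) (adj V)"
    unfolding V'_def using V
    by (subst adj_four_block) (auto intro!: arg_cong2[of _ _ _ _ "\<lambda>X Y. four_block_mat _ X Y _"] eq_matI)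
  have V'V': "adj V' * V' = 1\<^sub>m (Suc n)"
    unfolding aV' unfolding V'_def using V VV
    by (subst mult_four_block_mat[of _ 1 1 _ n _ n _ _ 1 _ n]) (auto intro!: eq_matI)
  define d' where "d' i = (case i of 0 \<Rightarrow> e | Suc j \<Rightarrow> d j)" for i
  have D': "mat_diag (Suc n) d' = four_block_mat (mat 1 1 (\<lambda>_. e)) (0\<^sub>m 1 n) (0\<^sub>m n 1) (mat_diag n d)"
    by (rule eq_matI) (auto simp: mat_diag_def d'_def split: nat.splits)
  have "V' * mat_diag (Suc n) d' * adj V' = four_block_mat (mat 1 1 (\<lambda>_. e)) (0\<^sub>m 1 n) (0\<^sub>m n 1) C"
    unfolding aV' D' CV unfolding V'_def using V
    apply (subst mult_four_block_mat[of _ 1 1 _ n _ n _ _ 1 _ n])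
            apply auto
    apply (subst mult_four_block_mat[of _ 1 1 _ n _ n _ _ 1 _ n])
            apply auto
    done
  also have "\<dots> = B"
  proof (rule eq_matI)
    fix i j assume "i < dim_row B" "j < dim_col B"
    hence ij: "i < Suc n" "j < Suc n" using B by auto
    have c: "B $$ (k, 0) = (if k = 0 then e else 0)" if "k < Suc n" for k
      using col0[OF that] by (simp add: B_def)
    \<comment> \<open>The first row is the conjugate of the first column; at \<open>k = 0\<close>
      hermiticity also makes \<open>e\<close> its own conjugate.\<close>
    have r: "B $$ (0, k) = (if k = 0 then e else 0)" if "k < Suc n" for k
      using c[OF that] herm[of 0 k] c[of 0] herm[of 0 0] that by (cases "k = 0") auto
    show "four_block_mat (mat 1 1 (\<lambda>_. e)) (0\<^sub>m 1 n) (0\<^sub>m n 1) C $$ (i, j) = B $$ (i, j)"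
      using ij by (cases i; cases j) (auto simp: c r C_def)
  qed (use B C in auto)
  finally have VB: "V' * mat_diag (Suc n) d' * adj V' = B" .
  have "A = W * B * adj W"
  proof -
    have "W * B * adj W = (W * adj W) * A * (W * adj W)"
      using W A by (simp add: B_def mult_assoc_dim del: WW')
    thus ?thesis using A by (simp add: WW')
  qed
  hence "A = (W * V') * mat_diag (Suc n) d' * adj (W * V')"
    using W V' VB[symmetric] by (simp add: adj_mult mult_assoc_dim)
  moreover have "adj (W * V') * (W * V') = 1\<^sub>m (Suc n)"
  proof -
    have "adj (W * V') * (W * V') = adj V' * ((adj W * W) * V')"
      using W V' by (simp add: adj_mult mult_assoc_dim)
    thus ?thesis using V' V'V' by (simp add: WW)
  qed
  ultimately show ?case using W V' by (intro exI[of _ "W * V'"] exI[of _ d']) auto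
qed

lemma unitary_diag_entry:
  assumes U: "U \<in> carrier_mat n n" "adj U * U = 1\<^sub>m n" and A: "A = U * mat_diag n d * adj U"
  shows "adj U * A * U = mat_diag n d"
proof -
  have "adj U * A * U = (adj U * U) * mat_diag n d * (adj U * U)"
    using U(1) A by (simp add: mult_assoc_dim)
  thus ?thesis unfolding U(2) by simp
qed

text \<open>The diagonal matrix is a unitary conjugate of \<open>A\<close>, hence Hermitian, so each
  diagonal entry equals its conjugate.\<close>

lemma hermitian_real_diagonalizable:
  assumes "A \<in> carrier_mat n n" "adj A = A"
  shows "\<exists>U d. U \<in> carrier_mat n n \<and> adj U * U = 1\<^sub>m n \<and>
    A = U * mat_diag n (\<lambda>i. complex_of_real (d i)) * adj U"
proof -
  from hermitian_diagonalizable[OF assms] obtain U d where U: "U \<in> carrier_mat n n"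
    and UU: "adj U * U = 1\<^sub>m n" and AU: "A = U * mat_diag n d * adj U" by blast
  note D = unitary_diag_entry[OF U UU AU]
  have "adj (adj U * A * U) = adj U * A * U"
    using U assms by (simp add: adj_mult mult_assoc_dim)
  hence eq: "mat_diag n (\<lambda>i. cnj (d i)) = mat_diag n d" unfolding D by simp
  have "d i = complex_of_real (Re (d i))" if "i < n" for i
    using arg_cong[OF eq, of "\<lambda>X. X $$ (i, i)"] that by (simp add: mat_diag_def complex_eq_iff)
  hence "mat_diag n d = mat_diag n (\<lambda>i. complex_of_real (Re (d i)))"
    by (intro eq_matI) (auto simp: mat_diag_def)
  with U UU AU show ?thesis by metis
qed

lemma psd_diagonalizable:
  assumes "A \<in> carrier_mat n n" "psd A"
  shows "\<exists>U d. U \<in> carrier_mat n n \<and> adj U * U = 1\<^sub>m n \<and> (\<forall>i<n. 0 \<le> d i) \<and>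
    A = U * mat_diag n (\<lambda>i. complex_of_real (d i)) * adj U"
proof -
  from hermitian_real_diagonalizable[OF assms(1) psd_hermitian[OF assms(2)]]
  obtain U d where U: "U \<in> carrier_mat n n" and UU: "adj U * U = 1\<^sub>m n"
    and AU: "A = U * mat_diag n (\<lambda>i. complex_of_real (d i)) * adj U" by blast
  have "psd (adj U * A * adj (adj U))"
    using assms U by (intro psd_conj) auto
  hence "psd (mat_diag n (\<lambda>i. complex_of_real (d i)))"
    by (simp add: unitary_diag_entry[OF U UU AU])
  from psd_diag[OF this] have "0 \<le> d i" if "i < n" for i
    using that by (simp add: mat_diag_def less_eq_complex_def)
  with U UU AU show ?thesis by blast
qed

lemma unitary_diag_mult:
  assumes U: "U \<in> carrier_mat n n" "adj U * U = 1\<^sub>m n"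
  shows "(U * mat_diag n c * adj U) * (U * mat_diag n d * adj U) = U * mat_diag n (\<lambda>i. c i * d i) * adj U"
proof -
  have "(U * mat_diag n c * adj U) * (U * mat_diag n d * adj U)
      = U * mat_diag n c * (adj U * U) * mat_diag n d * adj U"
    using U(1) by (simp add: mult_assoc_dim)
  also have "\<dots> = U * (mat_diag n c * mat_diag n d) * adj U"
    unfolding U(2) using U(1) by (simp add: mult_assoc_dim)
  finally show ?thesis by (simp add: mat_diag_diag)
qed

lemma psd_mat_diag:
  assumes "\<And>i. i < n \<Longrightarrow> 0 \<le> d i"
  shows "psd (mat_diag n (\<lambda>i. complex_of_real (d i)))"
proof -
  have "mat_diag n (\<lambda>i. complex_of_real (d i))
      = adj (mat_diag n (\<lambda>i. complex_of_real (sqrt (d i)))) * mat_diag n (\<lambda>i. complex_of_real (sqrt (d i)))"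
    using assms by (intro eq_matI) (auto, auto simp: mat_diag_def simp flip: of_real_mult)
  thus ?thesis by (metis psd_gram)
qed

lemma psd_unitary_diag:
  assumes "U \<in> carrier_mat n n" "\<And>i. i < n \<Longrightarrow> 0 \<le> d i"
  shows "psd (U * mat_diag n (\<lambda>i. complex_of_real (d i)) * adj U)"
  using assms by (intro psd_conj psd_mat_diag) auto

section \<open>Positive square roots\<close>

lemma psd_sqrt_exists:
  assumes "A \<in> carrier_mat n n" "psd A"
  shows "\<exists>R. R \<in> carrier_mat n n \<and> psd R \<and> R * R = A"
proof -
  from psd_diagonalizable[OF assms] obtain U d where U: "U \<in> carrier_mat n n"
    and UU: "adj U * U = 1\<^sub>m n" and d: "\<forall>i<n. 0 \<le> d i"
    and AU: "A = U * mat_diag n (\<lambda>i. complex_of_real (d i)) * adj U" by blast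
  let ?R = "U * mat_diag n (\<lambda>i. complex_of_real (sqrt (d i))) * adj U"
  have "mat_diag n (\<lambda>i. complex_of_real (sqrt (d i)) * complex_of_real (sqrt (d i)))
      = mat_diag n (\<lambda>i. complex_of_real (d i))"
    using d by (intro eq_matI) (auto simp: mat_diag_def simp flip: of_real_mult)
  hence "?R * ?R = A" unfolding unitary_diag_mult[OF U UU] AU by simp
  moreover have "psd ?R" using d U by (intro psd_unitary_diag) auto
  ultimately show ?thesis using U by (intro exI[of _ ?R]) auto
qed

text \<open>With $R = U E U^*$ and $S = V F V^*$ the unitary $W = V^* U$ satisfies $W E^2 = F^2 W$, so
  $W_{ij} \neq 0$ forces $e_j^2 = f_i^2$, hence $e_j = f_i$, and $W E = F W$.\<close>

lemma psd_sqrt_unique: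
  assumes R: "R \<in> carrier_mat n n" "psd R" and S: "S \<in> carrier_mat n n" "psd S"
    and eq: "R * R = S * S"
  shows "R = S"
proof -
  from psd_diagonalizable[OF R] obtain U e where U: "U \<in> carrier_mat n n"
    and UU: "adj U * U = 1\<^sub>m n" and e: "\<forall>i<n. 0 \<le> e i"
    and RU: "R = U * mat_diag n (\<lambda>i. complex_of_real (e i)) * adj U" by blast
  from psd_diagonalizable[OF S] obtain V f where V: "V \<in> carrier_mat n n"
    and VV: "adj V * V = 1\<^sub>m n" and f: "\<forall>i<n. 0 \<le> f i"
    and SV: "S = V * mat_diag n (\<lambda>i. complex_of_real (f i)) * adj V" by blast
  note UU' = unitary_right[OF U UU] and VV' = unitary_right[OF V VV]
  define W where "W = adj V * U"
  have W: "W \<in> carrier_mat n n" using U V by (auto simp: W_def)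
  have right: "(W * mat_diag n c) $$ (i, j) = W $$ (i, j) * c j" if "i < n" "j < n" for i j c
    using that W by (subst mat_diag_mult_right[of _ n n]) auto
  have left: "(mat_diag n c * W) $$ (i, j) = c i * W $$ (i, j)" if "i < n" "j < n" for i j c
    using that W by (subst mat_diag_mult_left[of _ n n]) auto
  let ?E = "\<lambda>i. complex_of_real (e i)" and ?F = "\<lambda>i. complex_of_real (f i)"
  have "W * mat_diag n (\<lambda>i. ?E i * ?E i) = adj V * (R * R) * U"
    unfolding RU unitary_diag_mult[OF U UU] W_def
    using U V UU by (simp add: mult_assoc_dim)
  also have "\<dots> = (adj V * V) * mat_diag n (\<lambda>i. ?F i * ?F i) * (adj V * U)"
    unfolding eq SV unitary_diag_mult[OF V VV] using U V by (simp add: mult_assoc_dim)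
  also have "\<dots> = mat_diag n (\<lambda>i. ?F i * ?F i) * W"
    unfolding VV W_def by simp
  finally have sq: "W * mat_diag n (\<lambda>i. ?E i * ?E i) = mat_diag n (\<lambda>i. ?F i * ?F i) * W" .
  have WE: "W * mat_diag n ?E = mat_diag n ?F * W"
  proof (rule eq_matI)
    fix i j assume "i < dim_row (mat_diag n ?F * W)" "j < dim_col (mat_diag n ?F * W)"
    hence ij: "i < n" "j < n" using W by auto
    have "W $$ (i, j) * (?E j * ?E j) = (?F i * ?F i) * W $$ (i, j)"
      using arg_cong[OF sq, of "\<lambda>X. X $$ (i, j)"] by (simp only: right[OF ij] left[OF ij])
    hence "W $$ (i, j) = 0 \<or> e j * e j = f i * f i"
      by (auto simp flip: of_real_mult)
    hence "W $$ (i, j) = 0 \<or> e j = f i"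
      using e f ij by (metis abs_of_nonneg real_sqrt_abs2)
    thus "(W * mat_diag n ?E) $$ (i, j) = (mat_diag n ?F * W) $$ (i, j)"
      by (auto simp only: right[OF ij] left[OF ij] mult.commute mult_zero_left)
  qed (use W in auto)
  have "R = (V * adj V) * R" using R V by (simp add: VV')
  also have "\<dots> = V * (W * mat_diag n ?E) * adj U"
    unfolding RU W_def using U V by (simp add: mult_assoc_dim)
  also have "\<dots> = V * mat_diag n ?F * adj V * (U * adj U)"
    unfolding WE unfolding W_def using U V by (simp add: mult_assoc_dim del: UU')
  finally show ?thesis using V by (simp add: UU' SV)
qed

text \<open>The only way to evaluate the choice in \<open>psd_sqrt\<close>: exhibit a psd root and
  appeal to uniqueness. It serves for the absolute value of a Hermitian matrix and for the root of a
  Kronecker product.\<close>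

lemma psd_sqrt_eqI:
  assumes "R \<in> carrier_mat n n" "psd R" "R * R = A"
  shows "psd_sqrt A = R"
proof -
  have n: "dim_row A = n" using assms by auto
  have "psd_sqrt A \<in> carrier_mat n n \<and> psd (psd_sqrt A) \<and> psd_sqrt A * psd_sqrt A = A"
    unfolding psd_sqrt_def n by (rule someI[of _ R]) (use assms in auto)
  thus ?thesis using psd_sqrt_unique assms by metis
qed

lemma psd_sqrt:
  assumes "A \<in> carrier_mat n n" "psd A"
  shows "psd_sqrt A \<in> carrier_mat n n" "psd (psd_sqrt A)" "psd_sqrt A * psd_sqrt A = A"
  using psd_sqrt_exists[OF assms] psd_sqrt_eqI by metis+

lemma psd_gram_exists:
  assumes "A \<in> carrier_mat n n" "psd A"
  shows "\<exists>Q \<in> carrier_mat n n. A = adj Q * Q"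
  using psd_sqrt[OF assms] psd_hermitian by metis

section \<open>The trace norm of Hermitian matrices\<close>

text \<open>Replacing each eigenvalue by its absolute value gives a psd root of
  \<open>adj X * X\<close>, and cyclicity of the trace removes \<open>U\<close>.\<close>

lemma trace_norm_unitary_diag:
  assumes U: "U \<in> carrier_mat n n" "adj U * U = 1\<^sub>m n"
  shows "trace_norm (U * mat_diag n (\<lambda>i. complex_of_real (d i)) * adj U) = (\<Sum>i<n. \<bar>d i\<bar>)"
proof -
  let ?X = "U * mat_diag n (\<lambda>i. complex_of_real (d i)) * adj U"
  let ?R = "U * mat_diag n (\<lambda>i. complex_of_real \<bar>d i\<bar>) * adj U"
  have "adj ?X = ?X" using U(1) by (simp add: adj_mult mult_assoc_dim)
  hence "psd_sqrt (adj ?X * ?X) = ?R"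
    using U by (intro psd_sqrt_eqI[of _ n] psd_unitary_diag)
      (auto simp: unitary_diag_mult simp flip: of_real_mult)
  hence "trace_norm ?X = Re (mtrace (U * (mat_diag n (\<lambda>i. complex_of_real \<bar>d i\<bar>) * adj U)))"
    using U(1) by (simp add: trace_norm_def mult_assoc_dim)
  also have "\<dots> = Re (mtrace (mat_diag n (\<lambda>i. complex_of_real \<bar>d i\<bar>) * (adj U * U)))"
    using U(1) by (subst mtrace_mult_comm) (simp_all add: mult_assoc_dim)
  also have "\<dots> = (\<Sum>i<n. \<bar>d i\<bar>)"
    unfolding U(2) by (simp add: mtrace_def mat_diag_def)
  finally show ?thesis .
qed

text \<open>In an eigenbasis of \<open>A - B\<close> each eigenvalue is the difference of a diagonal
  entry of \<open>A\<close> and one of \<open>B\<close>. Both are nonnegative, so its absolute value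
  is at most their sum, and a change of basis preserves traces.\<close>

lemma trace_norm_diff_psd_le:
  assumes A: "A \<in> carrier_mat n n" "psd A" and B: "B \<in> carrier_mat n n" "psd B"
  shows "trace_norm (A - B) \<le> Re (mtrace A) + Re (mtrace B)"
proof -
  have herm: "adj (A - B) = A - B"
    using A B by (simp add: adj_minus psd_hermitian)
  have "A - B \<in> carrier_mat n n" using A B by auto
  from hermitian_real_diagonalizable[OF this herm]
  obtain U d where U: "U \<in> carrier_mat n n" "adj U * U = 1\<^sub>m n"
    and X: "A - B = U * mat_diag n (\<lambda>i. complex_of_real (d i)) * adj U" by auto
  have tr: "mtrace (adj U * C * U) = mtrace C" if "C \<in> carrier_mat n n" for C
  proof -
    have "mtrace (adj U * C * U) = mtrace (adj U * (C * U))"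
      using U(1) that by (simp add: mult_assoc_dim)
    also have "\<dots> = mtrace (C * (U * adj U))"
      using U(1) that by (subst mtrace_mult_comm) (simp_all add: mult_assoc_dim)
    finally show ?thesis using that by (simp add: unitary_right[OF U])
  qed
  have pos: "0 \<le> (adj U * C * U) $$ (i, i)" if "C \<in> carrier_mat n n" "psd C" "i < n" for C i
    using psd_diag[OF psd_conj[OF that(2,1), of "adj U"], of i] U(1) that by simp
  have "adj U * (A - B) * U = adj U * A * U - adj U * B * U"
    using U A B minus_mult_distrib_mat[of "adj U * A" n n "adj U * B" U n]
    by (simp add: mult_minus_distrib_mat[of _ n n] mult_carrier_mat[of _ n n])
  hence diag: "mat_diag n (\<lambda>i. complex_of_real (d i)) = adj U * A * U - adj U * B * U"
    by (simp add: unitary_diag_entry[OF U X])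
  have "\<bar>d i\<bar> \<le> Re ((adj U * A * U) $$ (i, i)) + Re ((adj U * B * U) $$ (i, i))" if "i < n" for i
  proof -
    have "complex_of_real (d i) = (adj U * A * U) $$ (i, i) - (adj U * B * U) $$ (i, i)"
      using arg_cong[OF diag, of "\<lambda>X. X $$ (i, i)"] that U A B
      by (simp add: mat_diag_def del: index_mult_mat(1))
    hence "d i = Re ((adj U * A * U) $$ (i, i)) - Re ((adj U * B * U) $$ (i, i))"
      by (metis Re_complex_of_real minus_complex.sel(1))
    thus ?thesis using pos[OF A that] pos[OF B that] by (auto simp: abs_le_iff less_eq_complex_def)
  qed
  hence "(\<Sum>i<n. \<bar>d i\<bar>)
      \<le> (\<Sum>i<n. Re ((adj U * A * U) $$ (i, i)) + Re ((adj U * B * U) $$ (i, i)))"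
    by (intro sum_mono) auto
  also have "\<dots> = Re (mtrace (adj U * A * U)) + Re (mtrace (adj U * B * U))"
    using U by (simp add: mtrace_def sum.distrib del: index_mult_mat(1))
  finally have "(\<Sum>i<n. \<bar>d i\<bar>) \<le> Re (mtrace (adj U * A * U)) + Re (mtrace (adj U * B * U))" .
  thus ?thesis unfolding X trace_norm_unitary_diag[OF U] tr[OF A(1)] tr[OF B(1)] .
qed

text \<open>The Jordan decomposition into positive and negative part attains the bound above.\<close>

lemma trace_norm_decomp:
  assumes "X \<in> carrier_mat n n" "adj X = X"
  obtains A B where "A \<in> carrier_mat n n" "psd A" "B \<in> carrier_mat n n" "psd B"
    "X = A - B" "trace_norm X = Re (mtrace A) + Re (mtrace B)"
proof -
  from hermitian_real_diagonalizable[OF assms]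
  obtain U d where U: "U \<in> carrier_mat n n" "adj U * U = 1\<^sub>m n"
    and X: "X = U * mat_diag n (\<lambda>i. complex_of_real (d i)) * adj U" by auto
  have tr: "mtrace (U * mat_diag n c * adj U) = (\<Sum>i<n. c i)" for c
  proof -
    have "mtrace (U * mat_diag n c * adj U) = mtrace (mat_diag n c * (adj U * U))"
      using mtrace_mult_comm[of U "mat_diag n c * adj U"] U(1) by (simp add: mult_assoc_dim)
    thus ?thesis unfolding U(2) by (simp add: mtrace_def mat_diag_def)
  qed
  let ?A = "U * mat_diag n (\<lambda>i. complex_of_real (max 0 (d i))) * adj U"
  let ?B = "U * mat_diag n (\<lambda>i. complex_of_real (max 0 (- d i))) * adj U"
  have "mat_diag n (\<lambda>i. complex_of_real (d i))
      = mat_diag n (\<lambda>i. complex_of_real (max 0 (d i))) - mat_diag n (\<lambda>i. complex_of_real (max 0 (- d i)))"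
    by (intro eq_matI) (auto simp: mat_diag_def max_def)
  hence "X = ?A - ?B" unfolding X
    using U(1) by (simp add: mult_minus_distrib_mat[of _ n n _ n] minus_mult_distrib_mat[of _ n n _ _ n])
  moreover have "(\<Sum>i<n. \<bar>d i\<bar>) = (\<Sum>i<n. max 0 (d i)) + (\<Sum>i<n. max 0 (- d i))"
    unfolding sum.distrib[symmetric] by (intro sum.cong) auto
  hence "trace_norm X = Re (mtrace ?A) + Re (mtrace ?B)"
    unfolding X trace_norm_unitary_diag[OF U] tr by simp
  moreover have "psd ?A" "psd ?B" using U by (auto intro!: psd_unitary_diag)
  ultimately show ?thesis using U by (intro that[of ?A ?B]) auto
qed

text \<open>Optimal decompositions of the summands add up to some decomposition of the sum, and
  every decomposition gives an upper bound.\<close>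

lemma trace_norm_triangle:
  assumes "X \<in> carrier_mat n n" "adj X = X" "Y \<in> carrier_mat n n" "adj Y = Y"
  shows "trace_norm (X + Y) \<le> trace_norm X + trace_norm Y"
proof -
  from trace_norm_decomp[OF assms(1,2)] obtain A B
    where AB: "A \<in> carrier_mat n n" "psd A" "B \<in> carrier_mat n n" "psd B"
    "X = A - B" "trace_norm X = Re (mtrace A) + Re (mtrace B)" .
  from trace_norm_decomp[OF assms(3,4)] obtain C D
    where CD: "C \<in> carrier_mat n n" "psd C" "D \<in> carrier_mat n n" "psd D"
    "Y = C - D" "trace_norm Y = Re (mtrace C) + Re (mtrace D)" .
  have "X + Y = (A + C) - (B + D)"
    unfolding AB(5) CD(5) using AB CD by (intro eq_matI) auto
  thus ?thesis
    using trace_norm_diff_psd_le[of "A + C" n "B + D"] AB CD by (simp add: psd_add mtrace_add)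
qed

section \<open>Kronecker products and channels\<close>

lemma mult_index_cases:
  assumes "i < b * (c :: nat)"
  obtains s q where "i = s * c + q" "s < b" "q < c"
proof (rule that[of "i div c" "i mod c"])
  have "0 < c" using assms by (cases c) auto
  thus "i mod c < c" by simp
  show "i div c < b" using assms by (simp add: less_mult_imp_div_less)
qed simp

lemma mult_index_less [simp, intro]: "s < b \<Longrightarrow> q < c \<Longrightarrow> s * c + q < b * (c :: nat)"
proof -
  assume "s < b" "q < c"
  have "s * c + q < Suc s * c" using \<open>q < c\<close> by simp
  also have "\<dots> \<le> b * c" using \<open>s < b\<close> by (intro mult_le_mono1) simp
  finally show ?thesis .
qed

lemma mult_index_div [simp]: "q < c \<Longrightarrow> (s * c + q) div c = (s :: nat)"
  by simp

lemma mult_index_mod [simp]: "q < c \<Longrightarrow> (s * c + q) mod c = (q :: nat)"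
  by simp

lemma mult_index_eq_iff [simp]:
  "q < c \<Longrightarrow> r < c \<Longrightarrow> s * c + q = t * c + r \<longleftrightarrow> s = t \<and> q = (r :: nat)"
  by (metis mult_index_div mult_index_mod)

lemma sum_mult_index: "(\<Sum>k<b * c. f k) = (\<Sum>s<b. \<Sum>q<c. f (s * c + q :: nat))"
proof -
  have "(\<Sum>k<b * c. f k) = (\<Sum>s<b. sum f {s * c..<s * c + c})"
    by (rule sum.nat_group[symmetric])
  also have "\<dots> = (\<Sum>s<b. \<Sum>q<c. f (s * c + q))"
  proof (rule sum.cong[OF refl])
    fix s
    show "sum f {s * c..<s * c + c} = (\<Sum>q<c. f (s * c + q))"
      using sum.shift_bounds_nat_ivl[of f 0 "s * c" c] by (simp add: atLeast0LessThan add.commute)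
  qed
  finally show ?thesis .
qed

lemma eq_mat_mult_index:
  assumes "A \<in> carrier_mat (a * b) (c * d)" "B \<in> carrier_mat (a * b) (c * d)"
    and "\<And>s q t r. s < a \<Longrightarrow> q < b \<Longrightarrow> t < c \<Longrightarrow> r < d \<Longrightarrow>
      A $$ (s * b + q, t * d + r) = B $$ (s * b + q, t * d + r)"
  shows "A = B"
proof (rule eq_matI)
  fix i j assume "i < dim_row B" "j < dim_col B"
  hence "i < a * b" "j < c * d" using assms(2) by auto
  then obtain s q t r where "i = s * b + q" "s < a" "q < b" "j = t * d + r" "t < c" "r < d"
    by (metis mult_index_cases)
  thus "A $$ (i, j) = B $$ (i, j)" using assms(3) by simp
qed (use assms in auto)

section \<open>Kronecker products of matrices\<close>

lemma dim_kron [simp]: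
  "dim_row (kron A B) = dim_row A * dim_row B" "dim_col (kron A B) = dim_col A * dim_col B"
  by (simp_all add: kron_def)

lemma kron_carrier [simp, intro]:
  "A \<in> carrier_mat a b \<Longrightarrow> B \<in> carrier_mat c d \<Longrightarrow> kron A B \<in> carrier_mat (a * c) (b * d)"
  by (intro carrier_matI) auto

lemma index_kron:
  assumes "A \<in> carrier_mat a c" "B \<in> carrier_mat b d" "s < a" "q < b" "t < c" "r < d"
  shows "kron A B $$ (s * b + q, t * d + r) = A $$ (s, t) * B $$ (q, r)"
  using assms by (auto simp: kron_def)

lemma adj_kron:
  assumes "A \<in> carrier_mat a b" "B \<in> carrier_mat c d"
  shows "adj (kron A B) = kron (adj A) (adj B)"
proof (rule eq_mat_mult_index[of _ b d a c])
  fix s q t r assume "s < b" "q < d" "t < a" "r < c"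
  thus "adj (kron A B) $$ (s * d + q, t * c + r) = kron (adj A) (adj B) $$ (s * d + q, t * c + r)"
    using assms by (simp add: index_kron[of A a b B c d] index_kron[of "adj A" b a "adj B" d c])
qed (use assms in auto)

lemma kron_mult:
  assumes "A \<in> carrier_mat a b" "B \<in> carrier_mat a' b'" "C \<in> carrier_mat b c" "D \<in> carrier_mat b' c'"
  shows "kron A B * kron C D = kron (A * C) (B * D)"
proof (rule eq_mat_mult_index[of _ a a' c c'])
  fix s q t r assume st: "s < a" "q < a'" "t < c" "r < c'"
  have "(kron A B * kron C D) $$ (s * a' + q, t * c' + r)
      = (\<Sum>k<b * b'. kron A B $$ (s * a' + q, k) * kron C D $$ (k, t * c' + r))"
    using st assms by (subst index_mult_sum) auto
  also have "\<dots> = (\<Sum>x<b. \<Sum>y<b'. (A $$ (s, x) * B $$ (q, y)) * (C $$ (x, t) * D $$ (y, r)))"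
    unfolding sum_mult_index using st assms by (intro sum.cong refl) (simp add: index_kron[of _ a b _ a' b'] index_kron[of _ b c _ b' c'])
  also have "\<dots> = (\<Sum>x<b. A $$ (s, x) * C $$ (x, t)) * (\<Sum>y<b'. B $$ (q, y) * D $$ (y, r))"
    by (simp add: sum_product mult_ac)
  also have "\<dots> = (A * C) $$ (s, t) * (B * D) $$ (q, r)"
    using st assms by (simp add: index_mult_sum del: index_mult_mat(1))
  also have "\<dots> = kron (A * C) (B * D) $$ (s * a' + q, t * c' + r)"
    using st assms by (subst index_kron[of _ a c _ a' c']) auto
  finally show "(kron A B * kron C D) $$ (s * a' + q, t * c' + r) = kron (A * C) (B * D) $$ (s * a' + q, t * c' + r)" .
qed (use assms in auto)

lemma kron_one: "kron (1\<^sub>m a) (1\<^sub>m b) = 1\<^sub>m (a * b)"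
  by (rule eq_mat_mult_index[of _ a b a b]) (auto simp: index_kron[of _ a a _ b b])

lemma kron_add_left:
  assumes "A \<in> carrier_mat a a" "B \<in> carrier_mat a a" "C \<in> carrier_mat c c"
  shows "kron (A + B) C = kron A C + kron B C"
  by (rule eq_mat_mult_index[of _ a c a c])
    (use assms in \<open>auto simp: index_kron[of _ a a C c c] distrib_right add_carrier_mat\<close>)

lemma kron_smult_left:
  assumes "A \<in> carrier_mat a a" "C \<in> carrier_mat c c"
  shows "kron (x \<cdot>\<^sub>m A) C = x \<cdot>\<^sub>m kron A C"
  by (rule eq_mat_mult_index[of _ a c a c])
    (use assms in \<open>auto simp: index_kron[of _ a a C c c]\<close>)

lemma kron_one_1: "X \<in> carrier_mat a a \<Longrightarrow> kron X (1\<^sub>m 1) = X"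
  by (intro eq_matI) (auto simp: kron_def)

lemma mtrace_kron:
  assumes "A \<in> carrier_mat a a" "B \<in> carrier_mat b b"
  shows "mtrace (kron A B) = mtrace A * mtrace B"
  using assms by (simp add: mtrace_def sum_mult_index index_kron[of _ a a _ b b] sum_product)

text \<open>If the factors are Gram matrices of \<open>P\<close> and \<open>Q\<close>, their
  Kronecker product is the Gram matrix of \<open>kron P Q\<close>.\<close>

lemma psd_kron:
  assumes "A \<in> carrier_mat a a" "psd A" "B \<in> carrier_mat b b" "psd B"
  shows "psd (kron A B)"
proof -
  from psd_gram_exists[OF assms(1,2)] obtain P where P: "P \<in> carrier_mat a a" "A = adj P * P" by auto
  from psd_gram_exists[OF assms(3,4)] obtain Q where Q: "Q \<in> carrier_mat b b" "B = adj Q * Q" by auto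
  have "kron A B = adj (kron P Q) * kron P Q"
    unfolding P(2) Q(2) adj_kron[OF P(1) Q(1)] using P Q by (subst kron_mult[of _ a a _ b b]) auto
  thus ?thesis by (simp add: psd_gram)
qed

lemma density_kron:
  assumes "density a A" "density b B"
  shows "density (a * b) (kron A B)"
  using assms by (auto simp: density_def psd_kron mtrace_kron)

section \<open>Channels in Kraus form\<close>

lemma msum_carrier [simp]: "msum d Ls \<in> carrier_mat d d"
  by (induction Ls) (auto simp: msum_def)

lemma dim_msum [simp]: "dim_row (msum d Ls) = d" "dim_col (msum d Ls) = d"
  using msum_carrier[of d Ls] by (auto simp del: msum_carrier)

lemma index_msum: "i < d \<Longrightarrow> j < d \<Longrightarrow> msum d Ls $$ (i, j) = (\<Sum>L\<leftarrow>Ls. L $$ (i, j))"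
proof (induction Ls)
  case (Cons L Ls)
  have "msum d (L # Ls) = L + msum d Ls" by (simp add: msum_def)
  thus ?case using Cons msum_carrier[of d Ls] by (simp del: msum_carrier)
qed (simp add: msum_def)

text \<open>A reformulation of \<open>cptp\<close> with Kraus operators indexed by a finite set and
  all sums taken entrywise. A composition can then be indexed by a product set, and reordering sums
  is ordinary finite-sum algebra instead of list manipulation.\<close>

definition kraus :: "'s set \<Rightarrow> ('s \<Rightarrow> complex mat) \<Rightarrow> nat \<Rightarrow> nat \<Rightarrow> (complex mat \<Rightarrow> complex mat) \<Rightarrow> bool" where
  "kraus S K a b \<Phi> \<longleftrightarrow> finite S \<and> (\<forall>s\<in>S. K s \<in> carrier_mat b a) \<and>
    (\<forall>i<a. \<forall>j<a. (\<Sum>s\<in>S. (adj (K s) * K s) $$ (i, j)) = (if i = j then 1 else 0)) \<and>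
    (\<forall>X\<in>carrier_mat a a. \<Phi> X \<in> carrier_mat b b \<and>
      (\<forall>i<b. \<forall>j<b. \<Phi> X $$ (i, j) = (\<Sum>s\<in>S. (K s * X * adj (K s)) $$ (i, j))))"

lemma kraus_imp_cptp:
  assumes "kraus S K a b \<Phi>"
  shows "cptp a b \<Phi>"
proof -
  from assms obtain xs where xs: "set xs = S" "distinct xs"
    unfolding kraus_def by (metis finite_distinct_list)
  have *: "(\<Sum>L\<leftarrow>map f (map K xs). L $$ (i, j)) = (\<Sum>s\<in>S. f (K s) $$ (i, j))" for f :: "complex mat \<Rightarrow> complex mat" and i j
    using xs by (simp add: sum_list_distinct_conv_sum_set)
  have "msum a (map (\<lambda>K. adj K * K) (map K xs)) = 1\<^sub>m a"
    by (rule eq_matI) (use assms msum_carrier in \<open>auto simp: index_msum * kraus_def simp del: map_map\<close>)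
  moreover have "\<Phi> X = msum b (map (\<lambda>K. K * X * adj K) (map K xs))" if "X \<in> carrier_mat a a" for X
    by (rule eq_matI) (use assms that msum_carrier in \<open>auto simp: index_msum * kraus_def simp del: map_map\<close>)
  ultimately show ?thesis
    unfolding cptp_def using assms xs by (intro exI[of _ "map K xs"]) (auto simp: kraus_def)
qed

lemma cptp_imp_kraus:
  assumes "cptp a b \<Phi>"
  obtains m :: nat and K where "kraus {..<m} K a b \<Phi>"
proof -
  from assms obtain Ks where Ks: "\<forall>K\<in>set Ks. K \<in> carrier_mat b a"
    "msum a (map (\<lambda>K. adj K * K) Ks) = 1\<^sub>m a"
    "\<forall>X \<in> carrier_mat a a. \<Phi> X = msum b (map (\<lambda>K. K * X * adj K) Ks)"
    unfolding cptp_def by blast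
  have *: "(\<Sum>L\<leftarrow>map f Ks. L $$ (i, j)) = (\<Sum>s<length Ks. f (Ks ! s) $$ (i, j))" for f :: "complex mat \<Rightarrow> complex mat" and i j
    by (simp add: sum_list_sum_nth atLeast0LessThan)
  have "kraus {..<length Ks} (\<lambda>s. Ks ! s) a b \<Phi>"
    unfolding kraus_def
  proof (intro conjI allI ballI impI)
    fix i j assume "i < a" "j < a"
    thus "(\<Sum>s<length Ks. (adj (Ks ! s) * Ks ! s) $$ (i, j)) = (if i = j then 1 else 0)"
      using arg_cong[OF Ks(2), of "\<lambda>X. X $$ (i, j)"] by (simp only: index_msum *) simp
  next
    fix X :: "complex mat" and i j assume "X \<in> carrier_mat a a" "i < b" "j < b"
    thus "\<Phi> X $$ (i, j) = (\<Sum>s<length Ks. (Ks ! s * X * adj (Ks ! s)) $$ (i, j))"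
      using Ks(3) by (simp only: index_msum *)
  qed (use Ks in auto)
  thus ?thesis by (rule that)
qed

lemma cptp_carrier: "cptp a b \<Phi> \<Longrightarrow> X \<in> carrier_mat a a \<Longrightarrow> \<Phi> X \<in> carrier_mat b b"
  by (auto simp: cptp_def)

text \<open>The products of Kraus operators work: in the completeness relation the sum over
  \<open>T\<close> collapses to the identity between \<open>adj (K s)\<close> and
  \<open>K s\<close>, and what remains is the relation for \<open>K\<close>.\<close>

lemma kraus_comp:
  assumes K: "kraus S K a b \<Phi>" and L: "kraus T L b c \<Psi>"
  shows "kraus (T \<times> S) (\<lambda>(t, s). L t * K s) a c (\<lambda>X. \<Psi> (\<Phi> X))"
  unfolding kraus_def
proof (intro conjI allI ballI impI)
  have fin: "finite S" "finite T" using K L by (auto simp: kraus_def)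
  have cK: "K s \<in> carrier_mat b a" if "s \<in> S" for s using K that by (auto simp: kraus_def)
  have cL: "L t \<in> carrier_mat c b" if "t \<in> T" for t using L that by (auto simp: kraus_def)
  show "finite (T \<times> S)" using fin by simp
  show "(case ts of (t, s) \<Rightarrow> L t * K s) \<in> carrier_mat c a" if "ts \<in> T \<times> S" for ts
    using that mult_carrier_mat[OF cL cK] by (auto split: prod.splits)
  {
    fix i j assume ij: "i < a" "j < a"
    have one: "(adj (L t * K s) * (L t * K s)) $$ (i, j)
        = (\<Sum>x<b. \<Sum>y<b. cnj (K s $$ (x, i)) * (adj (L t) * L t) $$ (x, y) * K s $$ (y, j))"
      if "s \<in> S" "t \<in> T" for s t
    proof -
      have "adj (L t * K s) * (L t * K s) = adj (K s) * (adj (L t) * L t) * adj (adj (K s))"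
        using cK[OF that(1)] cL[OF that(2)] by (simp add: adj_mult mult_assoc_dim)
      moreover have "adj (L t) * L t \<in> carrier_mat b b" using cL[OF that(2)] by auto
      ultimately show ?thesis using cK[OF that(1)] ij
        by (simp only:, subst index_conj[of _ b]) auto
    qed
    have "(\<Sum>ts\<in>T \<times> S. (adj (case ts of (t, s) \<Rightarrow> L t * K s) * (case ts of (t, s) \<Rightarrow> L t * K s)) $$ (i, j))
        = (\<Sum>t\<in>T. \<Sum>s\<in>S. (adj (L t * K s) * (L t * K s)) $$ (i, j))"
      by (simp add: sum.cartesian_product case_prod_unfold del: index_mult_mat(1))
    also have "\<dots> = (\<Sum>t\<in>T. \<Sum>s\<in>S. \<Sum>x<b. \<Sum>y<b. cnj (K s $$ (x, i)) * (adj (L t) * L t) $$ (x, y) * K s $$ (y, j))"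
      using one by (intro sum.cong refl) auto
    \<comment> \<open>The sum over \<open>T\<close> moves innermost, where completeness of
      \<open>L\<close> turns it into a Kronecker delta.\<close>
    also have "\<dots> = (\<Sum>s\<in>S. \<Sum>x<b. \<Sum>y<b. \<Sum>t\<in>T. cnj (K s $$ (x, i)) * (adj (L t) * L t) $$ (x, y) * K s $$ (y, j))"
      by (subst sum.swap, rule sum.cong[OF refl], subst sum.swap, rule sum.cong[OF refl], rule sum.swap)
    also have "\<dots> = (\<Sum>s\<in>S. \<Sum>x<b. \<Sum>y<b. cnj (K s $$ (x, i)) * (if x = y then 1 else 0) * K s $$ (y, j))"
      using L by (intro sum.cong refl) (simp add: kraus_def sum_distrib_left[symmetric] sum_distrib_right[symmetric] del: index_mult_mat(1))
    also have "\<dots> = (\<Sum>s\<in>S. \<Sum>x<b. cnj (K s $$ (x, i)) * K s $$ (x, j))"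
      by (intro sum.cong refl) (simp add: if_distrib if_distribR cong: if_cong)
    also have "\<dots> = (\<Sum>s\<in>S. (adj (K s) * K s) $$ (i, j))"
    proof (rule sum.cong[OF refl])
      fix s assume "s \<in> S"
      from cK[OF this] ij show "(\<Sum>x<b. cnj (K s $$ (x, i)) * K s $$ (x, j)) = (adj (K s) * K s) $$ (i, j)"
        by (subst index_mult_sum) auto
    qed
    also have "\<dots> = (if i = j then 1 else 0)" using K ij by (auto simp: kraus_def)
    finally show "(\<Sum>ts\<in>T \<times> S. (adj (case ts of (t, s) \<Rightarrow> L t * K s) * (case ts of (t, s) \<Rightarrow> L t * K s)) $$ (i, j))
      = (if i = j then 1 else 0)" .
  }
  fix X :: "complex mat" assume X: "X \<in> carrier_mat a a"
  have \<Phi>X: "\<Phi> X \<in> carrier_mat b b" using K X by (auto simp: kraus_def)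
  thus "\<Psi> (\<Phi> X) \<in> carrier_mat c c" using L by (auto simp: kraus_def)
  fix i j assume ij: "i < c" "j < c"
  have "\<Psi> (\<Phi> X) $$ (i, j) = (\<Sum>t\<in>T. (L t * \<Phi> X * adj (L t)) $$ (i, j))"
    using L \<Phi>X ij by (auto simp: kraus_def)
  also have "\<dots> = (\<Sum>t\<in>T. \<Sum>x<b. \<Sum>y<b. L t $$ (i, x) * \<Phi> X $$ (x, y) * cnj (L t $$ (j, y)))"
    using cL \<Phi>X ij by (intro sum.cong refl index_conj) auto
  also have "\<dots> = (\<Sum>t\<in>T. \<Sum>x<b. \<Sum>y<b. \<Sum>s\<in>S. L t $$ (i, x) * (K s * X * adj (K s)) $$ (x, y) * cnj (L t $$ (j, y)))"
    using K X by (intro sum.cong refl) (auto simp: kraus_def sum_distrib_left sum_distrib_right simp del: index_mult_mat(1))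
  also have "\<dots> = (\<Sum>t\<in>T. \<Sum>s\<in>S. \<Sum>x<b. \<Sum>y<b. L t $$ (i, x) * (K s * X * adj (K s)) $$ (x, y) * cnj (L t $$ (j, y)))"
    by (rule sum.cong[OF refl], rule trans[OF sum.cong[OF refl sum.swap] sum.swap])
  also have "\<dots> = (\<Sum>t\<in>T. \<Sum>s\<in>S. (L t * K s * X * adj (L t * K s)) $$ (i, j))"
  proof (intro sum.cong refl)
    fix t s assume ts: "t \<in> T" "s \<in> S"
    have "L t * K s * X * adj (L t * K s) = L t * (K s * X * adj (K s)) * adj (L t)"
      using cL[OF ts(1)] cK[OF ts(2)] X by (simp add: adj_mult mult_assoc_dim)
    moreover have "K s * X * adj (K s) \<in> carrier_mat b b" using cK[OF ts(2)] X by auto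
    ultimately show "(\<Sum>x<b. \<Sum>y<b. L t $$ (i, x) * (K s * X * adj (K s)) $$ (x, y) * cnj (L t $$ (j, y)))
      = (L t * K s * X * adj (L t * K s)) $$ (i, j)"
      using cL[OF ts(1)] ij by (simp add: index_conj[of _ b] del: index_mult_mat(1))
  qed
  finally show "\<Psi> (\<Phi> X) $$ (i, j)
      = (\<Sum>ts\<in>T \<times> S. ((case ts of (t, s) \<Rightarrow> L t * K s) * X * adj (case ts of (t, s) \<Rightarrow> L t * K s)) $$ (i, j))"
    by (simp add: sum.cartesian_product case_prod_unfold del: index_mult_mat(1))
qed

lemma cptp_comp:
  assumes "cptp a b \<Phi>" "cptp b c \<Psi>"
  shows "cptp a c (\<lambda>X. \<Psi> (\<Phi> X))"
  using assms by (metis cptp_imp_kraus kraus_comp kraus_imp_cptp)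

lemma cptp_cong:
  assumes "cptp a b \<Phi>" "\<And>X. X \<in> carrier_mat a a \<Longrightarrow> \<Psi> X = \<Phi> X"
  shows "cptp a b \<Psi>"
  using assms by (auto simp: cptp_def)

lemma cptp_isometry:
  assumes "V \<in> carrier_mat b a" "adj V * V = 1\<^sub>m a"
  shows "cptp a b (\<lambda>X. V * X * adj V)"
  by (rule kraus_imp_cptp[of "{()}" "\<lambda>_. V"]) (use assms in \<open>auto simp: kraus_def simp del: index_mult_mat(1)\<close>)

lemma cptp_id: "cptp a a (\<lambda>X. X)"
  by (rule cptp_cong[OF cptp_isometry[of "1\<^sub>m a" a a]]) auto

text \<open>The coefficients of the channel as a superoperator, chosen once for all arguments. They
  yield linearity, and they reduce the commutation of channels on different registers to an exchange
  of finite sums.\<close>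

lemma cptp_coeffs:
  assumes "cptp a b \<Phi>"
  shows "\<exists>T. \<forall>X \<in> carrier_mat a a. \<forall>i<b. \<forall>j<b.
    \<Phi> X $$ (i, j) = (\<Sum>x<a. \<Sum>y<a. T i j x y * X $$ (x, y))"
proof -
  from cptp_imp_kraus[OF assms] obtain m :: nat and K where K: "kraus {..<m} K a b \<Phi>" .
  show ?thesis
  proof (intro exI[of _ "\<lambda>i j x y. \<Sum>s<m. K s $$ (i, x) * cnj (K s $$ (j, y))"] ballI allI impI)
    fix X :: "complex mat" and i j assume X: "X \<in> carrier_mat a a" "i < b" "j < b"
    have "\<Phi> X $$ (i, j) = (\<Sum>s<m. (K s * X * adj (K s)) $$ (i, j))"
      using K X by (simp add: kraus_def del: index_mult_mat(1))
    also have "\<dots> = (\<Sum>s<m. \<Sum>x<a. \<Sum>y<a. K s $$ (i, x) * X $$ (x, y) * cnj (K s $$ (j, y)))"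
      using K X by (intro sum.cong refl index_conj) (auto simp: kraus_def)
    also have "\<dots> = (\<Sum>x<a. \<Sum>y<a. \<Sum>s<m. K s $$ (i, x) * X $$ (x, y) * cnj (K s $$ (j, y)))"
      by (subst sum.swap, rule sum.cong[OF refl], rule sum.swap)
    finally show "\<Phi> X $$ (i, j) = (\<Sum>x<a. \<Sum>y<a. (\<Sum>s<m. K s $$ (i, x) * cnj (K s $$ (j, y))) * X $$ (x, y))"
      by (simp add: sum_distrib_left sum_distrib_right mult_ac)
  qed
qed

lemma cptp_add:
  assumes "cptp a b \<Phi>" "X \<in> carrier_mat a a" "Y \<in> carrier_mat a a"
  shows "\<Phi> (X + Y) = \<Phi> X + \<Phi> Y"
proof -
  obtain T where T: "\<forall>X \<in> carrier_mat a a. \<forall>i<b. \<forall>j<b.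
    \<Phi> X $$ (i, j) = (\<Sum>x<a. \<Sum>y<a. T i j x y * X $$ (x, y))"
    using cptp_coeffs[OF assms(1)] by blast
  have "X + Y \<in> carrier_mat a a" using assms by auto
  note c = cptp_carrier[OF assms(1) this] cptp_carrier[OF assms(1,2)] cptp_carrier[OF assms(1,3)]
  show ?thesis
    by (rule eq_matI) (use c assms in \<open>auto simp: T distrib_left sum.distrib\<close>)
qed

lemma cptp_smult:
  assumes "cptp a b \<Phi>" "X \<in> carrier_mat a a"
  shows "\<Phi> (c \<cdot>\<^sub>m X) = c \<cdot>\<^sub>m \<Phi> X"
proof -
  obtain T where T: "\<forall>X \<in> carrier_mat a a. \<forall>i<b. \<forall>j<b.
    \<Phi> X $$ (i, j) = (\<Sum>x<a. \<Sum>y<a. T i j x y * X $$ (x, y))"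
    using cptp_coeffs[OF assms(1)] by blast
  have "c \<cdot>\<^sub>m X \<in> carrier_mat a a" using assms by auto
  note c = cptp_carrier[OF assms(1) this] cptp_carrier[OF assms(1,2)]
  show ?thesis
    by (rule eq_matI) (use c assms in \<open>auto simp: T sum_distrib_left mult_ac intro!: sum.cong\<close>)
qed

lemma cptp_minus:
  assumes "cptp a b \<Phi>" "X \<in> carrier_mat a a" "Y \<in> carrier_mat a a"
  shows "\<Phi> (X - Y) = \<Phi> X - \<Phi> Y"
proof -
  have "X - Y = X + (- 1) \<cdot>\<^sub>m Y" using assms by (intro eq_matI) auto
  hence "\<Phi> (X - Y) = \<Phi> X + (- 1) \<cdot>\<^sub>m \<Phi> Y"
    using assms by (simp add: cptp_add[OF assms(1)] cptp_smult[OF assms(1)])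
  also have "\<dots> = \<Phi> X - \<Phi> Y"
    using cptp_carrier[OF assms(1,2)] cptp_carrier[OF assms(1,3)] by (intro eq_matI) auto
  finally show ?thesis .
qed

text \<open>Cyclicity brings \<open>adj (K s) * K s\<close> together, and completeness sums these to
  the identity.\<close>

lemma cptp_mtrace:
  assumes "cptp a b \<Phi>" "X \<in> carrier_mat a a"
  shows "mtrace (\<Phi> X) = mtrace X"
proof -
  from cptp_imp_kraus[OF assms(1)] obtain m :: nat and K where K: "kraus {..<m} K a b \<Phi>" .
  have c: "K s \<in> carrier_mat b a" if "s < m" for s using K that by (auto simp: kraus_def)
  have "mtrace (\<Phi> X) = (\<Sum>s<m. \<Sum>i<b. (K s * X * adj (K s)) $$ (i, i))"
    using K assms cptp_carrier[OF assms] unfolding mtrace_def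
    by (subst sum.swap) (auto simp: kraus_def intro!: sum.cong simp del: index_mult_mat(1))
  also have "\<dots> = (\<Sum>s<m. mtrace (K s * (X * adj (K s))))"
    using c assms by (intro sum.cong refl) (auto simp: mtrace_def mult_assoc_dim carrier_matD[OF c] simp del: index_mult_mat(1))
  also have "\<dots> = (\<Sum>s<m. mtrace (X * (adj (K s) * K s)))"
    using assms by (intro sum.cong refl, subst mtrace_mult_comm) (auto simp: mult_assoc_dim carrier_matD[OF c])
  also have "\<dots> = (\<Sum>s<m. \<Sum>x<a. \<Sum>y<a. X $$ (x, y) * (adj (K s) * K s) $$ (y, x))"
    unfolding mtrace_def using c assms by (intro sum.cong refl) (auto simp: index_mult_sum carrier_matD[OF c] simp del: index_mult_mat(1))
  also have "\<dots> = (\<Sum>x<a. \<Sum>y<a. X $$ (x, y) * (\<Sum>s<m. (adj (K s) * K s) $$ (y, x)))"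
    unfolding sum_distrib_left by (subst sum.swap, rule sum.cong[OF refl], rule sum.swap)
  also have "\<dots> = (\<Sum>x<a. \<Sum>y<a. X $$ (x, y) * (if y = x then 1 else 0))"
    using K by (intro sum.cong refl) (auto simp: kraus_def simp del: index_mult_mat(1))
  also have "\<dots> = mtrace X" using assms by (simp add: mtrace_def if_distrib cong: if_cong)
  finally show ?thesis .
qed

lemma cptp_psd:
  assumes "cptp a b \<Phi>" "X \<in> carrier_mat a a" "psd X"
  shows "psd (\<Phi> X)"
proof -
  from cptp_imp_kraus[OF assms(1)] obtain m :: nat and K where K: "kraus {..<m} K a b \<Phi>" .
  have c: "K s \<in> carrier_mat b a" if "s < m" for s using K that by (auto simp: kraus_def)
  have dim: "dim_row (\<Phi> X) = b" "dim_col (\<Phi> X) = b" using cptp_carrier[OF assms(1,2)] by auto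
  have "0 \<le> qform (\<Phi> X) v" for v
  proof -
    have "qform (\<Phi> X) v = (\<Sum>i<b. \<Sum>j<b. \<Sum>s<m. cnj (v i) * (K s * X * adj (K s)) $$ (i, j) * v j)"
      unfolding qform_def dim using K assms
      by (intro sum.cong refl) (auto simp: kraus_def sum_distrib_left sum_distrib_right simp del: index_mult_mat(1))
    also have "\<dots> = (\<Sum>s<m. \<Sum>i<b. \<Sum>j<b. cnj (v i) * (K s * X * adj (K s)) $$ (i, j) * v j)"
      by (rule trans[OF _ sum.swap], rule sum.cong[OF refl], rule sum.swap)
    also have "\<dots> = (\<Sum>s<m. qform (K s * X * adj (K s)) v)"
      using c by (intro sum.cong refl) (auto simp: qform_def simp del: index_mult_mat(1))
    also have "0 \<le> \<dots>"
      using psd_conj[OF assms(3,2)] c by (intro sum_nonneg) (auto simp: psd_iff_qform)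
    finally show ?thesis .
  qed
  thus ?thesis by (simp add: psd_iff_qform dim)
qed

lemma cptp_density:
  assumes "cptp a b \<Phi>" "density a X"
  shows "density b (\<Phi> X)"
  using assms cptp_carrier cptp_psd cptp_mtrace by (auto simp: density_def)

text \<open>The images of the positive and negative parts are psd with unchanged traces, so they
  form a decomposition of \<open>\<Phi> X\<close> whose total trace is
  \<open>trace_norm X\<close>.\<close>

lemma cptp_trace_norm:
  assumes "cptp a b \<Phi>" "X \<in> carrier_mat a a" "adj X = X"
  shows "adj (\<Phi> X) = \<Phi> X" "trace_norm (\<Phi> X) \<le> trace_norm X"
proof -
  from trace_norm_decomp[OF assms(2,3)] obtain A B
    where AB: "A \<in> carrier_mat a a" "psd A" "B \<in> carrier_mat a a" "psd B"
    "X = A - B" "trace_norm X = Re (mtrace A) + Re (mtrace B)" .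
  note c = cptp_carrier[OF assms(1) AB(1)] cptp_carrier[OF assms(1) AB(3)]
  note p = cptp_psd[OF assms(1) AB(1,2)] cptp_psd[OF assms(1) AB(3,4)]
  have eq: "\<Phi> X = \<Phi> A - \<Phi> B" using cptp_minus[OF assms(1)] AB by simp
  show "adj (\<Phi> X) = \<Phi> X" unfolding eq using c p by (simp add: adj_minus psd_hermitian)
  show "trace_norm (\<Phi> X) \<le> trace_norm X"
    using trace_norm_diff_psd_le[OF c(1) p(1) c(2) p(2)]
      cptp_mtrace[OF assms(1) AB(1)] cptp_mtrace[OF assms(1) AB(3)] unfolding eq AB(6) by simp
qed

section \<open>Channels on subsystems\<close>

text \<open>Otherwise the simplifier turns the index \<open>1\<close> of \<^const>\<open>on_sub\<close> into \<open>Suc 0\<close>, and the rules below no longer match.\<close>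

declare One_nat_def [simp del]

lemma sum_if_const: "(\<Sum>x\<in>A. if P then f x else 0) = (if P then \<Sum>x\<in>A. f x else (0 :: 'a :: comm_monoid_add))"
  by simp

lemma on_sub_carrier [simp]: "on_sub pre a b post \<Phi> X \<in> carrier_mat (pre * b * post) (pre * b * post)"
  by (simp add: on_sub_def)

lemma dim_on_sub [simp]:
  "dim_row (on_sub pre a b post \<Phi> X) = pre * b * post"
  "dim_col (on_sub pre a b post \<Phi> X) = pre * b * post"
  by (simp_all add: on_sub_def)

lemma index_on_sub:
  assumes "p < pre" "s < b" "q < post" "p' < pre" "s' < b" "q' < post"
  shows "on_sub pre a b post \<Phi> X $$ ((p * b + s) * post + q, (p' * b + s') * post + q')
    = \<Phi> (mat a a (\<lambda>(x, y). X $$ ((p * a + x) * post + q, (p' * a + y) * post + q'))) $$ (s, s')"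
  using assms by (simp add: on_sub_def Let_def mult.commute[of b post] div_mult2_eq)

lemma index_on_sub_fst:
  assumes "s < b" "q < c" "s' < b" "q' < c"
  shows "on_sub 1 a b c \<Phi> X $$ (s * c + q, s' * c + q')
    = \<Phi> (mat a a (\<lambda>(x, y). X $$ (x * c + q, y * c + q'))) $$ (s, s')"
  using index_on_sub[of 0 1 s b q c 0 s' q' a \<Phi> X] assms by simp

lemma index_on_sub_snd:
  assumes "p < c" "s < b" "p' < c" "s' < b"
  shows "on_sub c a b 1 \<Phi> X $$ (p * b + s, p' * b + s')
    = \<Phi> (mat a a (\<lambda>(x, y). X $$ (p * a + x, p' * a + y))) $$ (s, s')"
  using index_on_sub[of p c s b 0 1 p' s' 0 a \<Phi> X] assms by simp

lemma eq_mat_mult_index3: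
  assumes "A \<in> carrier_mat (a * b * c) (a * b * c)" "B \<in> carrier_mat (a * b * c) (a * b * c)"
    and "\<And>p s q p' s' q'. p < a \<Longrightarrow> s < b \<Longrightarrow> q < c \<Longrightarrow> p' < a \<Longrightarrow> s' < b \<Longrightarrow> q' < c \<Longrightarrow>
      A $$ ((p * b + s) * c + q, (p' * b + s') * c + q') = B $$ ((p * b + s) * c + q, (p' * b + s') * c + q')"
  shows "A = B"
proof (rule eq_mat_mult_index[OF assms(1,2)])
  fix i q j r assume i: "i < a * b" and q: "q < c" and j: "j < a * b" and r: "r < c"
  from i obtain p s where "i = p * b + s" "p < a" "s < b" by (rule mult_index_cases)
  moreover from j obtain p' s' where "j = p' * b + s'" "p' < a" "s' < b" by (rule mult_index_cases)
  ultimately show "A $$ (i * c + q, j * c + r) = B $$ (i * c + q, j * c + r)" using assms(3) q r by simp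
qed

lemma kron_assoc:
  assumes "A \<in> carrier_mat a a" "B \<in> carrier_mat b b" "C \<in> carrier_mat c c"
  shows "kron A (kron B C) = kron (kron A B) C"
proof (rule eq_mat_mult_index3[of _ a b c])
  fix p s q p' s' q' assume lt: "p < a" "s < b" "q < c" "p' < a" "s' < b" "q' < c"
  have "(p * b + s) * c + q = p * (b * c) + (s * c + q)" for p s q :: nat by (simp add: algebra_simps)
  hence "kron A (kron B C) $$ ((p * b + s) * c + q, (p' * b + s') * c + q')
      = A $$ (p, p') * kron B C $$ (s * c + q, s' * c + q')"
    using assms lt by (simp only:) (rule index_kron[of _ a a _ "b * c" "b * c"], auto)
  also have "\<dots> = A $$ (p, p') * B $$ (s, s') * C $$ (q, q')"
    using assms lt by (simp add: index_kron[of B b b C c c])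
  also have "\<dots> = kron (kron A B) C $$ ((p * b + s) * c + q, (p' * b + s') * c + q')"
    using assms lt by (simp add: index_kron[of "kron A B" "a * b" "a * b" C c c] index_kron[of A a a B b b])
  finally show "kron A (kron B C) $$ ((p * b + s) * c + q, (p' * b + s') * c + q')
      = kron (kron A B) C $$ ((p * b + s) * c + q, (p' * b + s') * c + q')" .
qed (use assms in \<open>auto simp: mult.assoc intro!: carrier_matI\<close>)

lemma on_sub_id:
  "X \<in> carrier_mat (pre * a * post) (pre * a * post) \<Longrightarrow> on_sub pre a a post (\<lambda>X. X) X = X"
  by (rule eq_mat_mult_index3[of _ pre a post]) (auto simp: index_on_sub)

text \<open>Once the indices of the outer registers are fixed, \<open>on_sub\<close> acts on one
  block at a time. The hypothesis on dimensions ensures that reading the intermediate block back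
  entry by entry returns exactly \<open>\<Phi> Y\<close>.\<close>

lemma on_sub_comp:
  assumes "\<And>Y. Y \<in> carrier_mat a a \<Longrightarrow> \<Phi> Y \<in> carrier_mat b b"
  shows "on_sub pre b c post \<Psi> (on_sub pre a b post \<Phi> X) = on_sub pre a c post (\<lambda>Y. \<Psi> (\<Phi> Y)) X"
proof (rule eq_mat_mult_index3[of _ pre c post])
  fix p s q p' s' q'
  assume pq: "p < pre" "s < c" "q < post" "p' < pre" "s' < c" "q' < post"
  define Y where "Y = mat a a (\<lambda>(x, y). X $$ ((p * a + x) * post + q, (p' * a + y) * post + q'))"
  have "\<Phi> Y \<in> carrier_mat b b" using assms by (simp add: Y_def)
  hence "mat b b (\<lambda>(x, y). on_sub pre a b post \<Phi> X $$ ((p * b + x) * post + q, (p' * b + y) * post + q')) = \<Phi> Y"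
    using pq by (intro eq_matI) (auto simp: index_on_sub Y_def)
  thus "on_sub pre b c post \<Psi> (on_sub pre a b post \<Phi> X) $$ ((p * c + s) * post + q, (p' * c + s') * post + q')
    = on_sub pre a c post (\<lambda>Y. \<Psi> (\<Phi> Y)) X $$ ((p * c + s) * post + q, (p' * c + s') * post + q')"
    using pq by (simp add: index_on_sub Y_def)
qed simp_all

text \<open>Acting on a subsystem of a subsystem: the inner neighbours of dimensions
  \<open>e1\<close> and \<open>e2\<close> are absorbed into the outer ones. The three special cases
  below are the regroupings of registers used later.\<close>

lemma on_sub_nest:
  "on_sub pre (e1 * d * e2) (e1 * d' * e2) post (on_sub e1 d d' e2 \<Phi>) X
    = on_sub (pre * e1) d d' (e2 * post) \<Phi> X"
proof (rule eq_mat_mult_index3[of _ pre "e1 * d' * e2" post])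
  fix p i q p' j q'
  assume pq: "p < pre" "i < e1 * d' * e2" "q < post" "p' < pre" "j < e1 * d' * e2" "q' < post"
  from pq(2) obtain k q1 where i: "i = k * e2 + q1" and k: "k < e1 * d'" and q1: "q1 < e2" by (rule mult_index_cases)
  from k obtain p1 s where k': "k = p1 * d' + s" and s: "p1 < e1" "s < d'" by (rule mult_index_cases)
  from pq(5) obtain k2 q1' where j: "j = k2 * e2 + q1'" and k2: "k2 < e1 * d'" and q1': "q1' < e2" by (rule mult_index_cases)
  from k2 obtain p1' s' where k2': "k2 = p1' * d' + s'" and s': "p1' < e1" "s' < d'" by (rule mult_index_cases)
  have idx: "(p * (e1 * d * e2) + ((p1 * d + x) * e2 + q1)) * post + q
      = ((p * e1 + p1) * d + x) * (e2 * post) + (q1 * post + q)" for p p1 d x q1 q :: nat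
    by (simp add: algebra_simps)
  have lt: "(p1 * d + x) * e2 + q1 < e1 * d * e2" if "p1 < e1" "x < d" "q1 < e2" for p1 x d q1
    using that by simp
  show "on_sub pre (e1 * d * e2) (e1 * d' * e2) post (on_sub e1 d d' e2 \<Phi>) X
      $$ ((p * (e1 * d' * e2) + i) * post + q, (p' * (e1 * d' * e2) + j) * post + q')
    = on_sub (pre * e1) d d' (e2 * post) \<Phi> X
      $$ ((p * (e1 * d' * e2) + i) * post + q, (p' * (e1 * d' * e2) + j) * post + q')"
  proof -
    have "on_sub (pre * e1) d d' (e2 * post) \<Phi> X
        $$ ((p * (e1 * d' * e2) + i) * post + q, (p' * (e1 * d' * e2) + j) * post + q')
      = \<Phi> (mat d d (\<lambda>(x, y). X $$ (((p * e1 + p1) * d + x) * (e2 * post) + (q1 * post + q),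
             ((p' * e1 + p1') * d + y) * (e2 * post) + (q1' * post + q')))) $$ (s, s')"
      unfolding i j k' k2' idx using pq s s' q1 q1' by (subst index_on_sub) auto
    moreover have "on_sub pre (e1 * d * e2) (e1 * d' * e2) post (on_sub e1 d d' e2 \<Phi>) X
        $$ ((p * (e1 * d' * e2) + i) * post + q, (p' * (e1 * d' * e2) + j) * post + q')
      = on_sub e1 d d' e2 \<Phi> (mat (e1 * d * e2) (e1 * d * e2)
          (\<lambda>(x, y). X $$ ((p * (e1 * d * e2) + x) * post + q, (p' * (e1 * d * e2) + y) * post + q'))) $$ (i, j)"
      using pq by (subst index_on_sub) auto
    moreover have "on_sub e1 d d' e2 \<Phi> (mat (e1 * d * e2) (e1 * d * e2)
          (\<lambda>(x, y). X $$ ((p * (e1 * d * e2) + x) * post + q, (p' * (e1 * d * e2) + y) * post + q'))) $$ (i, j)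
      = \<Phi> (mat d d (\<lambda>(x, y). X $$ ((p * (e1 * d * e2) + ((p1 * d + x) * e2 + q1)) * post + q,
             (p' * (e1 * d * e2) + ((p1' * d + y) * e2 + q1')) * post + q'))) $$ (s, s')"
      unfolding i j k' k2' using s s' q1 q1'
      by (subst index_on_sub) (auto intro!: arg_cong[of _ _ "\<lambda>M. \<Phi> M $$ (s, s')"] eq_matI simp: lt)
    ultimately show ?thesis by (simp only: idx)
  qed
qed (simp_all add: mult_ac on_sub_def)

lemma on_sub_fst_nest:
  "on_sub 1 (a * c) (b * c) r (on_sub 1 a b c \<Phi>) X = on_sub 1 a b (c * r) \<Phi> X"
  using on_sub_nest[of 1 1 a c b r \<Phi> X] by simp

lemma on_sub_snd_nest:
  "on_sub p (a * r) (b * r) 1 (on_sub 1 a b r \<Phi>) X = on_sub p a b r \<Phi> X"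
  using on_sub_nest[of p 1 a r b 1 \<Phi> X] by simp

lemma on_sub_mid_nest:
  "on_sub 1 (p * a) (p * b) r (on_sub p a b 1 \<Phi>) X = on_sub p a b r \<Phi> X"
  using on_sub_nest[of 1 p a 1 b r \<Phi> X] by simp

text \<open>Each side is a fourfold sum over the coefficients of both channels, in different order.
  This is what moves an action on the reference past encoding, tampering and decoding of the other
  register.\<close>

lemma on_sub_commute:
  assumes \<Phi>: "cptp a b \<Phi>" and \<Theta>: "cptp c d \<Theta>"
  shows "on_sub b c d 1 \<Theta> (on_sub 1 a b c \<Phi> X) = on_sub 1 a b d \<Phi> (on_sub a c d 1 \<Theta> X)"
proof (rule eq_mat_mult_index[of _ b d b d])
  obtain T where T: "\<forall>X \<in> carrier_mat a a. \<forall>i<b. \<forall>j<b.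
    \<Phi> X $$ (i, j) = (\<Sum>x<a. \<Sum>y<a. T i j x y * X $$ (x, y))"
    using cptp_coeffs[OF \<Phi>] by blast
  obtain U where U: "\<forall>X \<in> carrier_mat c c. \<forall>i<d. \<forall>j<d.
    \<Theta> X $$ (i, j) = (\<Sum>x<c. \<Sum>y<c. U i j x y * X $$ (x, y))"
    using cptp_coeffs[OF \<Theta>] by blast
  fix s q s' q' assume sq: "s < b" "q < d" "s' < b" "q' < d"
  have "on_sub b c d 1 \<Theta> (on_sub 1 a b c \<Phi> X) $$ (s * d + q, s' * d + q')
      = (\<Sum>u<c. \<Sum>v<c. U q q' u v * (\<Sum>x<a. \<Sum>y<a. T s s' x y * X $$ (x * c + u, y * c + v)))"
    using sq by (simp add: index_on_sub_snd index_on_sub_fst U T)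
  also have "\<dots> = (\<Sum>x<a. \<Sum>y<a. T s s' x y * (\<Sum>u<c. \<Sum>v<c. U q q' u v * X $$ (x * c + u, y * c + v)))"
    by (simp only: sum_distrib_left, subst sum_swap4) (simp only: mult_ac)
  also have "\<dots> = on_sub 1 a b d \<Phi> (on_sub a c d 1 \<Theta> X) $$ (s * d + q, s' * d + q')"
    using sq by (simp add: index_on_sub_snd index_on_sub_fst U T)
  finally show "on_sub b c d 1 \<Theta> (on_sub 1 a b c \<Phi> X) $$ (s * d + q, s' * d + q')
    = on_sub 1 a b d \<Phi> (on_sub a c d 1 \<Theta> X) $$ (s * d + q, s' * d + q')" .
qed (simp_all add: on_sub_def)

text \<open>Every block of a product operator is a scalar multiple of \<open>A\<close>, so
  homogeneity of \<open>\<Phi>\<close> decides the matter.\<close>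

lemma on_sub_fst_kron:
  assumes "cptp a b \<Phi>" "A \<in> carrier_mat a a" "B \<in> carrier_mat c c"
  shows "on_sub 1 a b c \<Phi> (kron A B) = kron (\<Phi> A) B"
proof (rule eq_mat_mult_index[of _ b c b c])
  note \<Phi>A = cptp_carrier[OF assms(1,2)]
  thus "kron (\<Phi> A) B \<in> carrier_mat (b * c) (b * c)" using assms by simp
  fix s q s' q' assume sq: "s < b" "q < c" "s' < b" "q' < c"
  have "mat a a (\<lambda>(x, y). kron A B $$ (x * c + q, y * c + q')) = B $$ (q, q') \<cdot>\<^sub>m A"
    using assms sq by (intro eq_matI) (auto simp: index_kron[of A a a B c c])
  thus "on_sub 1 a b c \<Phi> (kron A B) $$ (s * c + q, s' * c + q') = kron (\<Phi> A) B $$ (s * c + q, s' * c + q')"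
    using assms \<Phi>A sq by (simp add: index_on_sub_fst cptp_smult[OF assms(1)] index_kron[of _ b b B c c])
qed (simp_all add: on_sub_def)

lemma on_sub_snd_kron:
  assumes "cptp c d \<Theta>" "A \<in> carrier_mat a a" "B \<in> carrier_mat c c"
  shows "on_sub a c d 1 \<Theta> (kron A B) = kron A (\<Theta> B)"
proof (rule eq_mat_mult_index[of _ a d a d])
  note \<Theta>B = cptp_carrier[OF assms(1,3)]
  thus "kron A (\<Theta> B) \<in> carrier_mat (a * d) (a * d)" using assms by simp
  fix s q s' q' assume sq: "s < a" "q < d" "s' < a" "q' < d"
  have "mat c c (\<lambda>(x, y). kron A B $$ (s * c + x, s' * c + y)) = A $$ (s, s') \<cdot>\<^sub>m B"
    using assms sq by (intro eq_matI) (auto simp: index_kron[of A a a B c c])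
  thus "on_sub a c d 1 \<Theta> (kron A B) $$ (s * d + q, s' * d + q') = kron A (\<Theta> B) $$ (s * d + q, s' * d + q')"
    using assms \<Theta>B sq by (simp add: index_on_sub_snd cptp_smult[OF assms(1)] index_kron[of A a a _ d d])
qed (simp_all add: on_sub_def)

text \<open>The Kraus operators are \<open>K s\<close> tensored with the identity of the spectator
  register. In the conjugation the identity pins the spectator indices to those of the requested
  entry, which leaves one block of \<open>X\<close>.\<close>

lemma kraus_on_sub_fst:
  assumes K: "kraus S K a b \<Phi>"
  shows "kraus S (\<lambda>s. kron (K s) (1\<^sub>m c)) (a * c) (b * c) (on_sub 1 a b c \<Phi>)"
  unfolding kraus_def
proof (intro conjI ballI allI impI)
  have cK: "K s \<in> carrier_mat b a" if "s \<in> S" for s using K that by (auto simp: kraus_def)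
  show "finite S" using K by (simp add: kraus_def)
  show "kron (K s) (1\<^sub>m c) \<in> carrier_mat (b * c) (a * c)" if "s \<in> S" for s using cK[OF that] by simp
  {
    fix i j assume "i < a * c" "j < a * c"
    then obtain x q y r where i: "i = x * c + q" "x < a" "q < c" and j: "j = y * c + r" "y < a" "r < c"
      by (metis mult_index_cases)
    have "(adj (kron (K s) (1\<^sub>m c)) * kron (K s) (1\<^sub>m c)) $$ (i, j)
        = (adj (K s) * K s) $$ (x, y) * (if q = r then 1 else 0)" if "s \<in> S" for s
    proof -
      have "adj (kron (K s) (1\<^sub>m c)) * kron (K s) (1\<^sub>m c) = kron (adj (K s) * K s) (1\<^sub>m c)"
        unfolding adj_kron[OF cK[OF that] one_carrier_mat]
        using cK[OF that] by (subst kron_mult[of _ a b _ c c _ a _ c]) auto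
      moreover have "adj (K s) * K s \<in> carrier_mat a a" using cK[OF that] by auto
      ultimately show ?thesis unfolding i j using i j by (simp add: index_kron[of _ a a _ c c] del: index_mult_mat(1))
    qed
    hence "(\<Sum>s\<in>S. (adj (kron (K s) (1\<^sub>m c)) * kron (K s) (1\<^sub>m c)) $$ (i, j))
        = (\<Sum>s\<in>S. (adj (K s) * K s) $$ (x, y)) * (if q = r then 1 else 0)"
      by (simp add: sum_distrib_right del: index_mult_mat(1))
    also have "\<dots> = (if i = j then 1 else 0)" using K i j by (simp add: kraus_def del: index_mult_mat(1))
    finally show "(\<Sum>s\<in>S. (adj (kron (K s) (1\<^sub>m c)) * kron (K s) (1\<^sub>m c)) $$ (i, j)) = (if i = j then 1 else 0)" .
  }
  show "on_sub 1 a b c \<Phi> X \<in> carrier_mat (b * c) (b * c)" for X by (simp add: on_sub_def)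
  fix X :: "complex mat" and i j
  assume X: "X \<in> carrier_mat (a * c) (a * c)" and "i < b * c" "j < b * c"
  then obtain x q y r where i: "i = x * c + q" "x < b" "q < c" and j: "j = y * c + r" "y < b" "r < c"
    by (metis mult_index_cases)
  \<comment> \<open>The block of \<open>X\<close> between the spectator indices \<open>q\<close> and
    \<open>r\<close> of the entry under consideration.\<close>
  define Y where "Y = mat a a (\<lambda>(x, y). X $$ (x * c + q, y * c + r))"
  have Y: "Y \<in> carrier_mat a a" by (simp add: Y_def)
  have "(kron (K s) (1\<^sub>m c) * X * adj (kron (K s) (1\<^sub>m c))) $$ (i, j) = (K s * Y * adj (K s)) $$ (x, y)" if "s \<in> S" for s
  proof -
    note cs = cK[OF that]
    have "(kron (K s) (1\<^sub>m c) * X * adj (kron (K s) (1\<^sub>m c))) $$ (i, j)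
        = (\<Sum>k<a * c. \<Sum>l<a * c. kron (K s) (1\<^sub>m c) $$ (i, k) * X $$ (k, l) * cnj (kron (K s) (1\<^sub>m c) $$ (j, l)))"
      using cs X i j by (intro index_conj) auto
    also have "\<dots> = (\<Sum>u<a. \<Sum>f<c. \<Sum>v<a. \<Sum>g<c. (K s $$ (x, u) * (if q = f then 1 else 0)) * X $$ (u * c + f, v * c + g)
          * (cnj (K s $$ (y, v)) * (if r = g then 1 else 0)))"
      unfolding sum_mult_index i(1) j(1) using cs i j
      by (intro sum.cong refl) (simp add: index_kron[of _ b a _ c c])
    also have "\<dots> = (\<Sum>u<a. \<Sum>f<c. \<Sum>v<a. \<Sum>g<c. if g = r then (if f = q then
          K s $$ (x, u) * X $$ (u * c + f, v * c + g) * cnj (K s $$ (y, v)) else 0) else 0)"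
      by (intro sum.cong refl) auto
    also have "\<dots> = (\<Sum>u<a. \<Sum>v<a. K s $$ (x, u) * Y $$ (u, v) * cnj (K s $$ (y, v)))"
      using i j by (simp add: Y_def sum_if_const)
    also have "\<dots> = (K s * Y * adj (K s)) $$ (x, y)"
      using cs Y i j by (subst index_conj[of _ a]) auto
    finally show ?thesis .
  qed
  moreover have "on_sub 1 a b c \<Phi> X $$ (i, j) = \<Phi> Y $$ (x, y)"
    unfolding i(1) j(1) using i j by (simp add: index_on_sub_fst Y_def)
  moreover have "\<Phi> Y $$ (x, y) = (\<Sum>s\<in>S. (K s * Y * adj (K s)) $$ (x, y))"
    using K Y i j by (auto simp: kraus_def)
  ultimately show "on_sub 1 a b c \<Phi> X $$ (i, j)
      = (\<Sum>s\<in>S. (kron (K s) (1\<^sub>m c) * X * adj (kron (K s) (1\<^sub>m c))) $$ (i, j))"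
    by (simp del: index_mult_mat(1))
qed

lemma kraus_on_sub_snd:
  assumes K: "kraus S K a b \<Phi>"
  shows "kraus S (\<lambda>s. kron (1\<^sub>m c) (K s)) (c * a) (c * b) (on_sub c a b 1 \<Phi>)"
  unfolding kraus_def
proof (intro conjI ballI allI impI)
  have cK: "K s \<in> carrier_mat b a" if "s \<in> S" for s using K that by (auto simp: kraus_def)
  show "finite S" using K by (simp add: kraus_def)
  show "kron (1\<^sub>m c) (K s) \<in> carrier_mat (c * b) (c * a)" if "s \<in> S" for s using cK[OF that] by simp
  {
    fix i j assume "i < c * a" "j < c * a"
    then obtain q x r y where i: "i = q * a + x" "q < c" "x < a" and j: "j = r * a + y" "r < c" "y < a"
      by (metis mult_index_cases)
    have "(adj (kron (1\<^sub>m c) (K s)) * kron (1\<^sub>m c) (K s)) $$ (i, j)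
        = (adj (K s) * K s) $$ (x, y) * (if q = r then 1 else 0)" if "s \<in> S" for s
    proof -
      have "adj (kron (1\<^sub>m c) (K s)) * kron (1\<^sub>m c) (K s) = kron (1\<^sub>m c) (adj (K s) * K s)"
        unfolding adj_kron[OF one_carrier_mat cK[OF that]]
        using cK[OF that] by (subst kron_mult[of _ c c _ a b _ c _ a]) auto
      moreover have "adj (K s) * K s \<in> carrier_mat a a" using cK[OF that] by auto
      ultimately show ?thesis unfolding i j using i j by (simp add: index_kron[of _ c c _ a a] del: index_mult_mat(1))
    qed
    hence "(\<Sum>s\<in>S. (adj (kron (1\<^sub>m c) (K s)) * kron (1\<^sub>m c) (K s)) $$ (i, j))
        = (\<Sum>s\<in>S. (adj (K s) * K s) $$ (x, y)) * (if q = r then 1 else 0)"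
      by (simp add: sum_distrib_right del: index_mult_mat(1))
    also have "\<dots> = (if i = j then 1 else 0)" using K i j by (simp add: kraus_def del: index_mult_mat(1))
    finally show "(\<Sum>s\<in>S. (adj (kron (1\<^sub>m c) (K s)) * kron (1\<^sub>m c) (K s)) $$ (i, j)) = (if i = j then 1 else 0)" .
  }
  show "on_sub c a b 1 \<Phi> X \<in> carrier_mat (c * b) (c * b)" for X by (simp add: on_sub_def)
  fix X :: "complex mat" and i j
  assume X: "X \<in> carrier_mat (c * a) (c * a)" and "i < c * b" "j < c * b"
  then obtain q x r y where i: "i = q * b + x" "q < c" "x < b" and j: "j = r * b + y" "r < c" "y < b"
    by (metis mult_index_cases)
  define Y where "Y = mat a a (\<lambda>(x, y). X $$ (q * a + x, r * a + y))"
  have Y: "Y \<in> carrier_mat a a" by (simp add: Y_def)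
  have "(kron (1\<^sub>m c) (K s) * X * adj (kron (1\<^sub>m c) (K s))) $$ (i, j) = (K s * Y * adj (K s)) $$ (x, y)" if "s \<in> S" for s
  proof -
    note cs = cK[OF that]
    have "(kron (1\<^sub>m c) (K s) * X * adj (kron (1\<^sub>m c) (K s))) $$ (i, j)
        = (\<Sum>k<c * a. \<Sum>l<c * a. kron (1\<^sub>m c) (K s) $$ (i, k) * X $$ (k, l) * cnj (kron (1\<^sub>m c) (K s) $$ (j, l)))"
      using cs X i j by (intro index_conj) auto
    also have "\<dots> = (\<Sum>f<c. \<Sum>u<a. \<Sum>g<c. \<Sum>v<a. (K s $$ (x, u) * (if q = f then 1 else 0)) * X $$ (f * a + u, g * a + v)
          * (cnj (K s $$ (y, v)) * (if r = g then 1 else 0)))"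
      unfolding sum_mult_index i(1) j(1) using cs i j
      by (intro sum.cong refl) (simp add: index_kron[of _ c c _ b a])
    also have "\<dots> = (\<Sum>f<c. \<Sum>u<a. \<Sum>g<c. \<Sum>v<a. if g = r then (if f = q then
          K s $$ (x, u) * X $$ (f * a + u, g * a + v) * cnj (K s $$ (y, v)) else 0) else 0)"
      by (intro sum.cong refl) auto
    also have "\<dots> = (\<Sum>u<a. \<Sum>v<a. K s $$ (x, u) * Y $$ (u, v) * cnj (K s $$ (y, v)))"
      using i j by (simp add: Y_def sum_if_const)
    also have "\<dots> = (K s * Y * adj (K s)) $$ (x, y)"
      using cs Y i j by (subst index_conj[of _ a]) auto
    finally show ?thesis .
  qed
  moreover have "on_sub c a b 1 \<Phi> X $$ (i, j) = \<Phi> Y $$ (x, y)"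
    unfolding i(1) j(1) using i j by (simp add: index_on_sub_snd Y_def)
  moreover have "\<Phi> Y $$ (x, y) = (\<Sum>s\<in>S. (K s * Y * adj (K s)) $$ (x, y))"
    using K Y i j by (auto simp: kraus_def)
  ultimately show "on_sub c a b 1 \<Phi> X $$ (i, j)
      = (\<Sum>s\<in>S. (kron (1\<^sub>m c) (K s) * X * adj (kron (1\<^sub>m c) (K s))) $$ (i, j))"
    by (simp del: index_mult_mat(1))
qed

text \<open>The trailing register is attached first and the leading one second;
  \<open>on_sub_nest\<close> merges the two steps.\<close>

lemma cptp_on_sub:
  assumes "cptp a b \<Phi>"
  shows "cptp (pre * a * post) (pre * b * post) (on_sub pre a b post \<Phi>)"
proof -
  from cptp_imp_kraus[OF assms] obtain m :: nat and K where "kraus {..<m} K a b \<Phi>" .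
  note kraus_imp_cptp[OF kraus_on_sub_snd[OF kraus_on_sub_fst[OF this, of post], of pre]]
  moreover have "on_sub pre (1 * a * post) (1 * b * post) 1 (on_sub 1 a b post \<Phi>) = on_sub (pre * 1) a b (post * 1) \<Phi>"
    by (rule ext) (rule on_sub_nest)
  ultimately show ?thesis by (simp add: mult.assoc)
qed

text \<open>The argument lives on registers of dimensions \<open>a\<close>, \<open>b\<close> in this order, the result on \<open>b\<close>, \<open>a\<close>.\<close>

definition swap_regs :: "nat \<Rightarrow> nat \<Rightarrow> complex mat \<Rightarrow> complex mat" where
  "swap_regs a b X = mat (b * a) (b * a)
     (\<lambda>(i, j). X $$ ((i mod a) * b + i div a, (j mod a) * b + j div a))"

lemma index_swap_regs:
  assumes "s < b" "q < a" "s' < b" "q' < a"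
  shows "swap_regs a b X $$ (s * a + q, s' * a + q') = X $$ (q * b + s, q' * b + s')"
  using assms by (simp add: swap_regs_def)

text \<open>Conjugation by the permutation matrix \<open>V\<close> of the index map
  \<open>\<pi>\<close>, whose inverse is \<open>\<pi>'\<close>.\<close>

lemma cptp_swap_regs: "cptp (a * b) (b * a) (swap_regs a b)"
proof -
  define \<pi> where "\<pi> i = (i mod a) * b + i div a" for i
  define \<pi>' where "\<pi>' i = (i mod b) * a + i div b" for i
  have \<pi>: "\<pi> i < a * b" "\<pi>' (\<pi> i) = i" if "i < b * a" for i
    using that by (auto elim!: mult_index_cases simp: \<pi>_def \<pi>'_def)
  have \<pi>': "\<pi>' i < b * a" "\<pi> (\<pi>' i) = i" if "i < a * b" for i
    using that by (auto elim!: mult_index_cases simp: \<pi>_def \<pi>'_def)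
  define V :: "complex mat" where "V = mat (b * a) (a * b) (\<lambda>(i, j). if j = \<pi> i then 1 else 0)"
  have V: "V \<in> carrier_mat (b * a) (a * b)" by (simp add: V_def)
  have "adj V * V = 1\<^sub>m (a * b)"
  proof (rule eq_matI)
    fix i j assume "i < dim_row (1\<^sub>m (a * b) :: complex mat)" "j < dim_col (1\<^sub>m (a * b) :: complex mat)"
    hence ij: "i < a * b" "j < a * b" by auto
    have iff: "x = \<pi> k \<longleftrightarrow> k = \<pi>' x" if "k < b * a" "x < a * b" for x k
      using that \<pi>(2) \<pi>'(2) by metis
    have inj: "\<pi>' i = \<pi>' j \<longleftrightarrow> i = j"
      using ij \<pi>'(2) by metis
    have "(adj V * V) $$ (i, j) = (\<Sum>k<b * a. adj V $$ (i, k) * V $$ (k, j))"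
      using ij V by (subst index_mult_sum) auto
    also have "\<dots> = (\<Sum>k<b * a. if k = \<pi>' i then (if i = j then 1 else 0) else 0)"
      using ij by (intro sum.cong refl) (auto simp: V_def iff inj)
    also have "\<dots> = (if i = j then 1 else 0)" using \<pi>'(1)[OF ij(1)] by simp
    finally show "(adj V * V) $$ (i, j) = 1\<^sub>m (a * b) $$ (i, j)" using ij by simp
  qed (use V in auto)
  from cptp_isometry[OF V this] show ?thesis
  proof (rule cptp_cong)
    fix X :: "complex mat" assume X: "X \<in> carrier_mat (a * b) (a * b)"
    show "swap_regs a b X = V * X * adj V"
    proof (rule eq_matI)
      fix i j assume "i < dim_row (V * X * adj V)" "j < dim_col (V * X * adj V)"
      hence ij: "i < b * a" "j < b * a" using V by auto
      have "(V * X * adj V) $$ (i, j) = (\<Sum>x<a * b. \<Sum>y<a * b. V $$ (i, x) * X $$ (x, y) * cnj (V $$ (j, y)))"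
        using V X ij by (intro index_conj) auto
      also have "\<dots> = (\<Sum>x<a * b. \<Sum>y<a * b. if y = \<pi> j then (if x = \<pi> i then X $$ (x, y) else 0) else 0)"
        using ij by (intro sum.cong refl) (auto simp: V_def)
      also have "\<dots> = X $$ (\<pi> i, \<pi> j)" using \<pi>(1)[OF ij(1)] \<pi>(1)[OF ij(2)] by simp
      finally show "swap_regs a b X $$ (i, j) = (V * X * adj V) $$ (i, j)"
        using ij by (simp add: swap_regs_def \<pi>_def)
    qed (use V in \<open>auto simp: swap_regs_def\<close>)
  qed
qed

lemma sum_lessThan_plus1: "(\<Sum>k<(d :: nat) + 1. f k) = (\<Sum>k<d. f k) + (f d :: 'a :: comm_monoid_add)"
  using sum.lessThan_Suc[of f d] by (simp only: Suc_eq_plus1)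

lemma sum_lessThan_1: "(\<Sum>k<(1 :: nat). f k) = (f 0 :: 'a :: comm_monoid_add)"
  using sum_lessThan_plus1[of f 0] by simp

section \<open>The EPR test\<close>

text \<open>A measurement that on acceptance applies the Kraus operator \<open>A\<close>, and on rejection discards the system and outputs $\bot$.\<close>

definition bot_test :: "complex mat \<Rightarrow> complex mat \<Rightarrow> complex mat" where
  "bot_test A Z = (let d = dim_row A; B = A * Z * adj A in
     mat (d + 1) (d + 1) (\<lambda>(i, j). if i < d \<and> j < d then B $$ (i, j)
       else if i = d \<and> j = d then mtrace Z - mtrace B else 0))"

text \<open>\<open>A * adj A = 1\<close> makes \<open>P = adj A * A\<close> a projector. Rejection
  measures its complement \<open>Q\<close> and forgets the resulting state, which needs one Kraus
  operator for each basis vector of the input space.\<close>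

lemma cptp_bot_test:
  assumes A: "A \<in> carrier_mat d m" and AA: "A * adj A = 1\<^sub>m d"
  shows "cptp m (d + 1) (bot_test A)"
proof (rule kraus_imp_cptp)
  define P where "P = adj A * A"
  define Q where "Q = 1\<^sub>m m - P"
  have P: "P \<in> carrier_mat m m" using A by (auto simp: P_def)
  have Q: "Q \<in> carrier_mat m m" using P by (simp add: Q_def minus_carrier_mat)
  have "adj P = P" using A by (simp add: P_def adj_mult)
  hence aQ: "adj Q = Q" using P by (simp add: Q_def adj_minus[of _ m m])
  have "P * P = adj A * (A * adj A) * A" using A by (simp add: P_def mult_assoc_dim)
  hence PP: "P * P = P" unfolding AA using A by (simp add: P_def)
  have "Q * Q = Q - (P - P * P)"
    unfolding Q_def using P
    by (simp add: minus_mult_distrib_mat[of _ m m _ _ m] mult_minus_distrib_mat[of _ m m _ m] minus_carrier_mat)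
  also have "\<dots> = Q" unfolding PP using P Q by (intro eq_matI) auto
  finally have QQ: "adj Q * Q = Q" by (simp add: aQ)
  \<comment> \<open>Index \<open>m\<close> is acceptance: \<open>A\<close> into the first
    \<open>d\<close> rows. Each \<open>s < m\<close> places row \<open>s\<close> of \<open>Q\<close>
    in the last row, that is, it projects by \<open>Q\<close>, finds basis vector \<open>s\<close>
    and outputs bot.\<close>
  define K :: "nat \<Rightarrow> complex mat" where "K s = mat (d + 1) m (\<lambda>(i, a).
      if s = m then (if i < d then A $$ (i, a) else 0) else (if i = d then Q $$ (s, a) else 0))" for s
  have K: "K s \<in> carrier_mat (d + 1) m" for s by (simp add: K_def)
  show "kraus {..<m + 1} K m (d + 1) (bot_test A)"
    unfolding kraus_def
  proof (intro conjI allI ballI impI)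
    fix i j assume ij: "i < m" "j < m"
    have "(\<Sum>s<m. (adj (K s) * K s) $$ (i, j)) = (\<Sum>s<m. adj Q $$ (i, s) * Q $$ (s, j))"
    proof (rule sum.cong[OF refl])
      fix s assume "s \<in> {..<m}"
      moreover have "(adj (K s) * K s) $$ (i, j) = (\<Sum>k<d + 1. adj (K s) $$ (i, k) * K s $$ (k, j))"
        using ij K[of s] by (subst index_mult_sum) auto
      ultimately show "(adj (K s) * K s) $$ (i, j) = adj Q $$ (i, s) * Q $$ (s, j)"
        unfolding sum_lessThan_plus1 using ij K[of s] Q by (simp add: K_def)
    qed
    also have "\<dots> = (adj Q * Q) $$ (i, j)" using ij Q by (subst index_mult_sum) auto
    finally have 1: "(\<Sum>s<m. (adj (K s) * K s) $$ (i, j)) = Q $$ (i, j)" by (simp add: QQ)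
    have "(adj (K m) * K m) $$ (i, j) = (\<Sum>k<d + 1. adj (K m) $$ (i, k) * K m $$ (k, j))"
      using ij K[of m] by (subst index_mult_sum) auto
    also have "\<dots> = (\<Sum>k<d. adj A $$ (i, k) * A $$ (k, j))"
      unfolding sum_lessThan_plus1 using ij K[of m] A by (simp add: K_def)
    also have "\<dots> = P $$ (i, j)" unfolding P_def using ij A by (subst index_mult_sum) auto
    finally have 2: "(adj (K m) * K m) $$ (i, j) = P $$ (i, j)" .
    show "(\<Sum>s<m + 1. (adj (K s) * K s) $$ (i, j)) = (if i = j then 1 else 0)"
      using 1 2 ij P by (simp add: Q_def sum_lessThan_plus1 del: index_mult_mat(1))
  next
    fix Z :: "complex mat" and i j assume Z: "Z \<in> carrier_mat m m" and ij: "i < d + 1" "j < d + 1"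
    have "mtrace (Q * Z * adj Q) = mtrace (Z * (adj Q * Q))"
      using mtrace_mult_comm[of Q "Z * adj Q"] Q Z by (simp add: mult_assoc_dim)
    also have "\<dots> = mtrace Z - mtrace (Z * P)"
      unfolding QQ unfolding Q_def using Z P
      by (simp add: mult_minus_distrib_mat[of _ m m _ m] mtrace_minus[of _ m] mult_carrier_mat[of _ m m])
    also have "mtrace (Z * P) = mtrace (A * Z * adj A)"
      using mtrace_mult_comm[of A "Z * adj A"] A Z by (simp add: mult_assoc_dim P_def)
    finally have tr: "mtrace (Q * Z * adj Q) = mtrace Z - mtrace (A * Z * adj A)" .
    have "(\<Sum>s<m. (K s * Z * adj (K s)) $$ (i, j)) = (\<Sum>s<m. if i = d \<and> j = d then (Q * Z * adj Q) $$ (s, s) else 0)"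
    proof (rule sum.cong[OF refl])
      fix s assume s: "s \<in> {..<m}"
      have "(K s * Z * adj (K s)) $$ (i, j) = (\<Sum>a<m. \<Sum>b<m. K s $$ (i, a) * Z $$ (a, b) * cnj (K s $$ (j, b)))"
        using K[of s] Z ij by (intro index_conj) auto
      also have "\<dots> = (if i = d \<and> j = d then (\<Sum>a<m. \<Sum>b<m. Q $$ (s, a) * Z $$ (a, b) * cnj (Q $$ (s, b))) else 0)"
        using s ij by (auto simp: K_def)
      also have "(\<Sum>a<m. \<Sum>b<m. Q $$ (s, a) * Z $$ (a, b) * cnj (Q $$ (s, b))) = (Q * Z * adj Q) $$ (s, s)"
        using Q Z s by (intro index_conj[symmetric]) auto
      finally show "(K s * Z * adj (K s)) $$ (i, j) = (if i = d \<and> j = d then (Q * Z * adj Q) $$ (s, s) else 0)" .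
    qed
    also have "\<dots> = (if i = d \<and> j = d then mtrace (Q * Z * adj Q) else 0)"
      using Q by (auto simp: mtrace_def simp del: index_mult_mat(1))
    finally have 1: "(\<Sum>s<m. (K s * Z * adj (K s)) $$ (i, j))
        = (if i = d \<and> j = d then mtrace Z - mtrace (A * Z * adj A) else 0)" by (simp only: tr)
    have "(K m * Z * adj (K m)) $$ (i, j) = (\<Sum>a<m. \<Sum>b<m. K m $$ (i, a) * Z $$ (a, b) * cnj (K m $$ (j, b)))"
      using K[of m] Z ij by (intro index_conj) auto
    also have "\<dots> = (if i < d \<and> j < d then (\<Sum>a<m. \<Sum>b<m. A $$ (i, a) * Z $$ (a, b) * cnj (A $$ (j, b))) else 0)"
      using ij by (auto simp: K_def)
    also have "\<dots> = (if i < d \<and> j < d then (A * Z * adj A) $$ (i, j) else 0)"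
      using A Z by (auto simp: index_conj[of _ m] simp del: index_mult_mat(1))
    finally have 2: "(K m * Z * adj (K m)) $$ (i, j) = (if i < d \<and> j < d then (A * Z * adj A) $$ (i, j) else 0)" .
    show "bot_test A Z $$ (i, j) = (\<Sum>s<m + 1. (K s * Z * adj (K s)) $$ (i, j))"
      using 1 2 ij A by (simp add: bot_test_def Let_def sum_lessThan_plus1 del: index_mult_mat(1))
  qed (use K A in \<open>auto simp: bot_test_def Let_def\<close>)
qed

text \<open>The operator $I_M \otimes \langle\Phi|$ on $(M E \oplus \bot) \hat E$, which vanishes on $\bot$.\<close>

definition epr_bra :: "nat \<Rightarrow> nat \<Rightarrow> complex mat" where
  "epr_bra d D = mat d ((d * D + 1) * D) (\<lambda>(i, a).
     if a div D div D = i \<and> a div D mod D = a mod D then complex_of_real (1 / sqrt (real D)) else 0)"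

lemma epr_bra_carrier [simp]: "epr_bra d D \<in> carrier_mat d ((d * D + 1) * D)"
  by (simp add: epr_bra_def)

lemma dim_epr_bra [simp]: "dim_row (epr_bra d D) = d" "dim_col (epr_bra d D) = (d * D + 1) * D"
  by (simp_all add: epr_bra_def)

lemma index_epr_bra:
  assumes "i < d" "j < d" "e < D" "f < D"
  shows "epr_bra d D $$ (i, (j * D + e) * D + f)
    = (if i = j \<and> e = f then complex_of_real (1 / sqrt (real D)) else 0)"
proof -
  have "(j * D + e) * D + f < (d * D + 1) * D"
    using assms by (intro mult_index_less) (auto intro: less_SucI simp: trans_less_add1)
  thus ?thesis using assms by (auto simp: epr_bra_def)
qed

lemma index_epr_bra_bot:
  assumes "i < d" "f < D"
  shows "epr_bra d D $$ (i, d * D * D + f) = 0"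
  using assms mult_index_less[of "d * D" "d * D + 1" f D] by (auto simp: epr_bra_def)

text \<open>Row \<open>i\<close> is supported where the message index is \<open>i\<close> and the
  indices of E and Ehat coincide; the block of bot contributes nothing.\<close>

lemma sum_epr_bra:
  assumes "i < d"
  shows "(\<Sum>a<(d * D + 1) * D. epr_bra d D $$ (i, a) * g a)
    = complex_of_real (1 / sqrt (real D)) * (\<Sum>e<D. g ((i * D + e) * D + e))"
proof -
  have "(\<Sum>a<(d * D + 1) * D. epr_bra d D $$ (i, a) * g a)
      = (\<Sum>x<d * D + 1. \<Sum>f<D. epr_bra d D $$ (i, x * D + f) * g (x * D + f))"
    by (rule sum_mult_index)
  also have "\<dots> = (\<Sum>x<d * D. \<Sum>f<D. epr_bra d D $$ (i, x * D + f) * g (x * D + f))"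
    using assms by (simp add: index_epr_bra_bot sum_lessThan_plus1)
  also have "\<dots> = (\<Sum>j<d. \<Sum>e<D. \<Sum>f<D. epr_bra d D $$ (i, (j * D + e) * D + f) * g ((j * D + e) * D + f))"
    by (rule sum_mult_index)
  also have "\<dots> = (\<Sum>j<d. \<Sum>e<D. \<Sum>f<D. if f = e then (if j = i then
      complex_of_real (1 / sqrt (real D)) * g ((j * D + e) * D + f) else 0) else 0)"
    using assms by (intro sum.cong refl) (auto simp: index_epr_bra)
  also have "\<dots> = complex_of_real (1 / sqrt (real D)) * (\<Sum>e<D. g ((i * D + e) * D + e))"
    using assms by (simp add: sum_if_const sum_distrib_left)
  finally show ?thesis .
qed

lemma inv_sqrt_sq: "complex_of_real (1 / sqrt (real D)) * complex_of_real (1 / sqrt (real D)) = 1 / of_nat D"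
proof -
  have "1 / sqrt (real D) * (1 / sqrt (real D)) = 1 / real D" by simp
  thus ?thesis by (metis of_real_1 of_real_divide of_real_mult of_real_of_nat_eq)
qed

lemma epr_bra_conj_index:
  assumes "Z \<in> carrier_mat ((d * D + 1) * D) ((d * D + 1) * D)" "i < d" "j < d"
  shows "(epr_bra d D * Z * adj (epr_bra d D)) $$ (i, j)
    = 1 / of_nat D * (\<Sum>e<D. \<Sum>f<D. Z $$ ((i * D + e) * D + e, (j * D + f) * D + f))"
proof -
  let ?s = "complex_of_real (1 / sqrt (real D))"
  have "(epr_bra d D * Z * adj (epr_bra d D)) $$ (i, j)
      = (\<Sum>a<(d * D + 1) * D. \<Sum>b<(d * D + 1) * D. epr_bra d D $$ (i, a) * Z $$ (a, b) * cnj (epr_bra d D $$ (j, b)))"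
    using assms by (intro index_conj) auto
  also have "\<dots> = (\<Sum>a<(d * D + 1) * D. epr_bra d D $$ (i, a) *
      (\<Sum>b<(d * D + 1) * D. epr_bra d D $$ (j, b) * Z $$ (a, b)))"
  proof -
    have "cnj (epr_bra d D $$ (j, b)) = epr_bra d D $$ (j, b)" if "b < (d * D + 1) * D" for b
      using that assms by (simp add: epr_bra_def)
    thus ?thesis by (simp add: sum_distrib_left mult_ac)
  qed
  also have "\<dots> = ?s * ?s * (\<Sum>e<D. \<Sum>f<D. Z $$ ((i * D + e) * D + e, (j * D + f) * D + f))"
    unfolding sum_epr_bra[OF assms(3)] by (subst sum_epr_bra[OF assms(2)]) (simp only: sum_distrib_left mult.assoc)
  finally show ?thesis unfolding inv_sqrt_sq .
qed

lemma epr_bra_unit: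
  assumes "0 < D"
  shows "epr_bra d D * adj (epr_bra d D) = 1\<^sub>m d"
proof (rule eq_matI)
  let ?s = "complex_of_real (1 / sqrt (real D))"
  fix i j assume "i < dim_row (1\<^sub>m d :: complex mat)" "j < dim_col (1\<^sub>m d :: complex mat)"
  hence ij: "i < d" "j < d" by auto
  have "(epr_bra d D * adj (epr_bra d D)) $$ (i, j)
      = (\<Sum>a<(d * D + 1) * D. epr_bra d D $$ (i, a) * adj (epr_bra d D) $$ (a, j))"
    using ij by (subst index_mult_sum) auto
  also have "\<dots> = (\<Sum>a<(d * D + 1) * D. epr_bra d D $$ (i, a) * cnj (epr_bra d D $$ (j, a)))"
    using ij by (intro sum.cong refl) auto
  also have "\<dots> = ?s * (\<Sum>e<D. cnj (epr_bra d D $$ (j, (i * D + e) * D + e)))"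
    using sum_epr_bra[OF ij(1)] .
  also have "\<dots> = (if i = j then of_nat D * (?s * ?s) else 0)"
    using ij by (simp add: index_epr_bra)
  also have "\<dots> = (if i = j then 1 else 0)" using assms unfolding inv_sqrt_sq by simp
  finally show "(epr_bra d D * adj (epr_bra d D)) $$ (i, j) = 1\<^sub>m d $$ (i, j)" using ij by simp
qed auto

lemma epr_carrier [simp]: "epr l \<in> carrier_mat (2 ^ l * 2 ^ l) (2 ^ l * 2 ^ l)"
  by (simp add: epr_def Let_def)

lemma index_epr:
  assumes "e < 2 ^ l" "e' < 2 ^ l" "f < 2 ^ l" "f' < 2 ^ l"
  shows "epr l $$ (e * 2 ^ l + e', f * 2 ^ l + f') = (if e = e' \<and> f = f' then 1 / of_nat (2 ^ l) else 0)"
  using assms by (simp add: epr_def Let_def)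

text \<open>The left side is the accepting projector as it is spelled out in \<open>new_dec\<close>.
  The factorisation lets projecting and tracing out E and Ehat be replaced by one conjugation with
  \<open>epr_bra\<close>.\<close>

lemma epr_projector:
  fixes l d :: nat
  defines "D \<equiv> 2 ^ l"
  shows "mat ((d * D + 1) * D) ((d * D + 1) * D)
      (\<lambda>(a, b). if a < d * D * D \<and> b < d * D * D then kron (1\<^sub>m d) (epr l) $$ (a, b) else 0)
    = adj (epr_bra d D) * epr_bra d D" (is "?P = _")
proof (rule eq_mat_mult_index[of _ "d * D + 1" D "d * D + 1" D])
  let ?A = "epr_bra d D"
  let ?s = "complex_of_real (1 / sqrt (real D))"
  fix x e' y f' assume xy: "x < d * D + 1" "e' < D" "y < d * D + 1" "f' < D"
  have lt: "x * D + e' < (d * D + 1) * D" "y * D + f' < (d * D + 1) * D"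
    using xy by (auto simp del: mult_Suc_right add_Suc_right)
  have "(adj ?A * ?A) $$ (x * D + e', y * D + f') = (\<Sum>k<d. adj ?A $$ (x * D + e', k) * ?A $$ (k, y * D + f'))"
    using lt by (subst index_mult_sum) auto
  also have "\<dots> = (\<Sum>k<d. cnj (?A $$ (k, x * D + e')) * ?A $$ (k, y * D + f'))"
    using lt by (intro sum.cong refl) auto
  finally have eq: "(adj ?A * ?A) $$ (x * D + e', y * D + f')
    = (\<Sum>k<d. cnj (?A $$ (k, x * D + e')) * ?A $$ (k, y * D + f'))" .
  show "?P $$ (x * D + e', y * D + f') = (adj ?A * ?A) $$ (x * D + e', y * D + f')"
  proof (cases "x < d * D \<and> y < d * D")
    case False
    hence "x = d * D \<or> y = d * D" using xy by auto
    hence "(\<Sum>k<d. cnj (?A $$ (k, x * D + e')) * ?A $$ (k, y * D + f')) = 0"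
      using xy by (intro sum.neutral) (auto simp: index_epr_bra_bot)
    moreover have "\<not> (x * D + e' < d * D * D \<and> y * D + f' < d * D * D)"
      using \<open>x = d * D \<or> y = d * D\<close> by auto
    ultimately show ?thesis using lt eq by auto
  next
    case True
    hence "x < d * D" "y < d * D" by auto
    then obtain i e j f where x: "x = i * D + e" "i < d" "e < D" and y: "y = j * D + f" "j < d" "f < D"
      by (metis mult_index_cases)
    have "(\<Sum>k<d. cnj (?A $$ (k, x * D + e')) * ?A $$ (k, y * D + f'))
        = (\<Sum>k<d. if k = i then (if i = j \<and> e = e' \<and> f = f' then ?s * ?s else 0) else 0)"
      unfolding x(1) y(1) using x y xy by (intro sum.cong refl) (auto simp: index_epr_bra)
    also have "\<dots> = (if i = j \<and> e = e' \<and> f = f' then 1 / of_nat D else 0)"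
      using x(2) by (simp only: inv_sqrt_sq) simp
    moreover have "kron (1\<^sub>m d) (epr l) $$ (x * D + e', y * D + f') = (if i = j \<and> e = e' \<and> f = f' then 1 / of_nat D else 0)"
    proof -
      have "x * D + e' = i * (D * D) + (e * D + e')" "y * D + f' = j * (D * D) + (f * D + f')"
        by (simp_all add: x y algebra_simps)
      moreover have "epr l \<in> carrier_mat (D * D) (D * D)" by (simp add: D_def)
      ultimately have "kron (1\<^sub>m d) (epr l) $$ (x * D + e', y * D + f')
        = 1\<^sub>m d $$ (i, j) * epr l $$ (e * D + e', f * D + f')"
        using x y xy by (simp only:) (rule index_kron[of _ d d _ "D * D" "D * D"], auto)
      thus ?thesis using x y xy by (simp add: index_epr D_def)
    qed
    moreover have "x * D + e' < d * D * D" "y * D + f' < d * D * D" using True xy by auto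
    ultimately show ?thesis using lt eq by simp
  qed
qed auto

text \<open>With \<open>A\<close> the operator \<open>epr_bra\<close>, \<open>P * Z * P\<close> is
  \<open>adj A * B * A\<close> for \<open>B = A * Z * adj A\<close>. Tracing out the normalised EPR
  state leaves \<open>B\<close>, and the rejection probability is \<open>mtrace Z - mtrace B\<close>
  by cyclicity.\<close>

lemma new_dec_eq:
  assumes "l \<le> k"
  shows "new_dec k l n DecT Y
    = bot_test (epr_bra (2 ^ (k - l)) (2 ^ l)) (on_sub 1 (2 ^ n) (2 ^ k + 1) (2 ^ l) DecT Y)"
proof -
  define d D :: nat where "d = 2 ^ (k - l)" and "D = 2 ^ l"
  have K: "(2 :: nat) ^ k = d * D" using assms by (simp add: d_def D_def flip: power_add)
  have D0: "0 < D" by (simp add: D_def)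
  define Z where "Z = on_sub 1 (2 ^ n) (d * D + 1) D DecT Y"
  let ?m = "(d * D + 1) * D"
  let ?A = "epr_bra d D"
  let ?s = "complex_of_real (1 / sqrt (real D))"
  define P where "P = adj ?A * ?A"
  have P: "P \<in> carrier_mat ?m ?m" by (intro carrier_matI) (auto simp: P_def)
  have Z: "Z \<in> carrier_mat ?m ?m" by (intro carrier_matI) (simp_all add: Z_def)
  define B where "B = ?A * Z * adj ?A"
  have B: "B \<in> carrier_mat d d" by (intro carrier_matI) (auto simp: B_def)
  have "P * Z * P = adj ?A * B * adj (adj ?A)"
    using Z by (simp add: P_def B_def mult_assoc_dim)
  hence PZP: "(P * Z * P) $$ (a, b) = (\<Sum>x<d. \<Sum>y<d. cnj (?A $$ (x, a)) * B $$ (x, y) * ?A $$ (y, b))"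
    if "a < ?m" "b < ?m" for a b
    using that B by (simp only:, subst index_conj[of _ d]) auto
  have acc: "ptrace d (D * D) 1 (P * Z * P) $$ (i, j) = B $$ (i, j)" if ij: "i < d" "j < d" for i j
  proof -
    have "ptrace d (D * D) 1 (P * Z * P) $$ (i, j)
        = (\<Sum>e<D. \<Sum>f<D. (P * Z * P) $$ (i * (D * D) + (e * D + f), j * (D * D) + (e * D + f)))"
      using ij by (simp add: ptrace_def sum_mult_index del: index_mult_mat(1))
    \<comment> \<open>On the diagonal of E and Ehat the EPR state has weight only at
      \<open>e = f\<close>, namely \<open>D\<close> entries of size \<open>1 / D\<close>.\<close>
    also have "\<dots> = (\<Sum>e<D. \<Sum>f<D. if f = e then 1 / of_nat D * B $$ (i, j) else 0)"
    proof (intro sum.cong refl)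
      fix e f assume "e \<in> {..<D}" "f \<in> {..<D}"
      hence ef: "e < D" "f < D" by auto
      have idx: "i * (D * D) + (e * D + f) = (i * D + e) * D + f" for i by (simp add: algebra_simps)
      have lt: "(i * D + e) * D + f < ?m" if "i < d" for i
        using that ef by (intro mult_index_less) (auto intro: less_SucI simp: trans_less_add1)
      have "(P * Z * P) $$ ((i * D + e) * D + f, (j * D + e) * D + f)
          = (\<Sum>x<d. \<Sum>y<d. cnj (?A $$ (x, (i * D + e) * D + f)) * B $$ (x, y) * ?A $$ (y, (j * D + e) * D + f))"
        using lt ij by (intro PZP) auto
      also have "\<dots> = (\<Sum>x<d. \<Sum>y<d. if y = j then (if x = i then (if e = f then ?s * ?s * B $$ (x, y) else 0) else 0) else 0)"
        using ij ef by (intro sum.cong refl) (auto simp: index_epr_bra)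
      also have "\<dots> = (if f = e then 1 / of_nat D * B $$ (i, j) else 0)"
        using ij by (simp only: inv_sqrt_sq) (simp add: eq_commute)
      finally show "(P * Z * P) $$ (i * (D * D) + (e * D + f), j * (D * D) + (e * D + f))
          = (if f = e then 1 / of_nat D * B $$ (i, j) else 0)" unfolding idx .
    qed
    also have "\<dots> = B $$ (i, j)" using D0 by simp
    finally show ?thesis .
  qed
  have "mtrace ((1\<^sub>m ?m - P) * Z) = mtrace Z - mtrace (P * Z)"
    using P Z by (simp add: minus_mult_distrib_mat[of _ ?m ?m _ _ ?m] mtrace_minus[of _ ?m] mult_carrier_mat[of _ ?m ?m])
  also have "mtrace (P * Z) = mtrace B"
    using mtrace_mult_comm[of "adj ?A" "?A * Z"] Z by (simp add: P_def B_def mult_assoc_dim)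
  finally have rej: "mtrace ((1\<^sub>m ?m - P) * Z) = mtrace Z - mtrace B" .
  have Pe: "mat ?m ?m (\<lambda>(a, b). if a < d * D * D \<and> b < d * D * D then kron (1\<^sub>m d) (epr l) $$ (a, b) else 0) = P"
    unfolding P_def D_def by (rule epr_projector)
  have "new_dec k l n DecT Y = mat (d + 1) (d + 1)
           (\<lambda>(i, j). if i < d \<and> j < d then ptrace d (D * D) 1 (P * Z * P) $$ (i, j)
                    else if i = d \<and> j = d then mtrace ((1\<^sub>m ?m - P) * Z) else 0)"
    unfolding new_dec_def Let_def K d_def[symmetric] D_def[symmetric] Z_def[symmetric] Pe ..
  also have "\<dots> = bot_test ?A Z"
    unfolding bot_test_def Let_def B_def[symmetric] rej using acc by (intro eq_matI) auto
  finally show ?thesis by (simp only: Z_def K d_def[symmetric] D_def[symmetric])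
qed

text \<open>Appending a pure state is conjugation by the isometry \<open>kron 1 v\<close>, with
  \<open>v\<close> the EPR vector as a single column.\<close>

lemma cptp_kron_epr: "cptp d (d * 2 ^ l * 2 ^ l) (\<lambda>X. kron X (epr l))"
proof -
  define D :: nat where "D = 2 ^ l"
  let ?s = "complex_of_real (1 / sqrt (real D))"
  have D0: "0 < D" by (simp add: D_def)
  define v :: "complex mat" where "v = mat (D * D) 1 (\<lambda>(i, j). if i div D = i mod D then ?s else 0)"
  have v: "v \<in> carrier_mat (D * D) 1" by (simp add: v_def)
  have vv: "v * adj v = epr l"
  proof (rule eq_matI)
    fix i j assume "i < dim_row (epr l)" "j < dim_col (epr l)"
    hence ij: "i < D * D" "j < D * D" by (auto simp: D_def epr_def Let_def)
    have "(v * adj v) $$ (i, j) = v $$ (i, 0) * cnj (v $$ (j, 0))"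
      using ij v by (subst index_mult_sum) (auto simp: sum_lessThan_1)
    also have "\<dots> = (if i div D = i mod D \<and> j div D = j mod D then ?s * ?s else 0)"
      using ij by (auto simp: v_def)
    finally show "(v * adj v) $$ (i, j) = epr l $$ (i, j)"
      unfolding inv_sqrt_sq using ij by (simp add: epr_def Let_def D_def)
  qed (use v in \<open>auto simp: epr_def Let_def D_def\<close>)
  have v1: "adj v * v = 1\<^sub>m 1"
  proof (rule eq_matI)
    fix i j assume "i < dim_row (1\<^sub>m 1 :: complex mat)" "j < dim_col (1\<^sub>m 1 :: complex mat)"
    hence ij: "i = 0" "j = 0" by auto
    have "(adj v * v) $$ (0, 0) = (\<Sum>k<D * D. adj v $$ (0, k) * v $$ (k, 0))"
      using v by (subst index_mult_sum) auto
    also have "\<dots> = (\<Sum>k<D * D. cnj (v $$ (k, 0)) * v $$ (k, 0))"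
      using v by (intro sum.cong refl) auto
    also have "\<dots> = (\<Sum>e<D. \<Sum>f<D. if f = e then ?s * ?s else 0)"
      unfolding sum_mult_index by (intro sum.cong refl) (auto simp: v_def)
    also have "\<dots> = 1" using D0 unfolding inv_sqrt_sq by simp
    finally show "(adj v * v) $$ (i, j) = 1\<^sub>m 1 $$ (i, j)" using ij by simp
  qed (use v in auto)
  let ?V = "kron (1\<^sub>m d) v"
  have V: "?V \<in> carrier_mat (d * D * D) d" using kron_carrier[OF one_carrier_mat v, of d] by (simp add: mult.assoc)
  have aV: "adj ?V = kron (1\<^sub>m d) (adj v)" using adj_kron[OF one_carrier_mat v, of d] by simp
  have "adj ?V * ?V = kron (1\<^sub>m d * 1\<^sub>m d) (adj v * v)"
    unfolding aV using v by (intro kron_mult) auto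
  hence "adj ?V * ?V = 1\<^sub>m d" unfolding v1 by (simp add: kron_one)
  from cptp_isometry[OF V this] have "cptp d (d * D * D) (\<lambda>X. ?V * X * adj ?V)" .
  moreover have "kron X (epr l) = ?V * X * adj ?V" if X: "X \<in> carrier_mat d d" for X
  proof -
    \<comment> \<open>Viewing \<open>X\<close> as a product with a one-dimensional register makes
      \<open>kron_mult\<close> applicable.\<close>
    have "?V * X = ?V * kron X (1\<^sub>m 1)" using kron_one_1[OF X] by simp
    also have "\<dots> = kron X v" using X v by (subst kron_mult[of _ d d _ "D * D" 1 _ d _ 1]) auto
    also have "kron X v * adj ?V = kron X (epr l)"
      unfolding aV using X v by (subst kron_mult[of _ d d _ "D * D" 1 _ d _ "D * D"]) (auto simp: vv)
    finally show ?thesis by simp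
  qed
  ultimately show ?thesis unfolding D_def by (rule cptp_cong)
qed

lemma dim_embed_bot [simp]:
  "dim_row (embed_bot d c X) = (d + 1) * c" "dim_col (embed_bot d c X) = (d + 1) * c"
  by (simp_all add: embed_bot_def)

lemma embed_bot_carrier [simp]: "embed_bot d c X \<in> carrier_mat ((d + 1) * c) ((d + 1) * c)"
  by (simp add: embed_bot_def)

lemma index_embed_bot:
  assumes "s < d + 1" "q < c" "s' < d + 1" "q' < c"
  shows "embed_bot d c X $$ (s * c + q, s' * c + q') = (if s < d \<and> s' < d then X $$ (s * c + q, s' * c + q') else 0)"
proof -
  have iff: "s * c + q < d * c \<longleftrightarrow> s < d" if "q < c" for s q
    using that by (metis div_less_iff_less_mult gr_implies_not0 mult_index_div neq0_conv)
  show ?thesis using assms mult_index_less[OF assms(1,2)] mult_index_less[OF assms(3,4)]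
    by (simp add: embed_bot_def iff)
qed

lemma index_embed_bot_1:
  "s < d + 1 \<Longrightarrow> s' < d + 1 \<Longrightarrow> embed_bot d 1 X $$ (s, s') = (if s < d \<and> s' < d then X $$ (s, s') else 0)"
  by (simp add: embed_bot_def)

lemma cptp_embed_bot: "cptp d (d + 1) (embed_bot d 1)"
proof -
  define J :: "complex mat" where "J = mat (d + 1) d (\<lambda>(i, j). if i = j then 1 else 0)"
  have J: "J \<in> carrier_mat (d + 1) d" by (simp add: J_def)
  have "adj J * J = 1\<^sub>m d"
  proof (rule eq_matI)
    fix i j assume "i < dim_row (1\<^sub>m d :: complex mat)" "j < dim_col (1\<^sub>m d :: complex mat)"
    hence ij: "i < d" "j < d" by auto
    have "(adj J * J) $$ (i, j) = (\<Sum>k<d + 1. adj J $$ (i, k) * J $$ (k, j))"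
      using ij J by (subst index_mult_sum) auto
    also have "\<dots> = (\<Sum>k<d + 1. if k = i then (if i = j then 1 else 0) else 0)"
      using ij by (intro sum.cong refl) (auto simp: J_def)
    finally show "(adj J * J) $$ (i, j) = 1\<^sub>m d $$ (i, j)" using ij by (simp add: sum_lessThan_plus1)
  qed (use J in auto)
  from cptp_isometry[OF J this] show ?thesis
  proof (rule cptp_cong)
    fix X :: "complex mat" assume X: "X \<in> carrier_mat d d"
    show "embed_bot d 1 X = J * X * adj J"
    proof (rule eq_matI)
      fix i j assume "i < dim_row (J * X * adj J)" "j < dim_col (J * X * adj J)"
      hence ij: "i < d + 1" "j < d + 1" using J by auto
      have "(J * X * adj J) $$ (i, j) = (\<Sum>x<d. \<Sum>y<d. J $$ (i, x) * X $$ (x, y) * cnj (J $$ (j, y)))"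
        using J X ij by (intro index_conj) auto
      also have "\<dots> = (\<Sum>x<d. \<Sum>y<d. if y = j then (if x = i then X $$ (x, y) else 0) else 0)"
        using ij by (intro sum.cong refl) (auto simp: J_def)
      also have "\<dots> = (if i < d \<and> j < d then X $$ (i, j) else 0)" by (simp add: sum_if_const)
      finally show "embed_bot d 1 X $$ (i, j) = (J * X * adj J) $$ (i, j)"
        using ij by (simp add: embed_bot_def)
    qed (use J in auto)
  qed
qed

text \<open>Since bot is the last basis vector of the leading register, the index bound in
  \<open>embed_bot\<close> constrains only that register. The embedding is therefore a local channel
  and obeys the same nesting and commutation rules as a decoder.\<close>

lemma embed_bot_on_sub: "embed_bot d c X = on_sub 1 d (d + 1) c (embed_bot d 1) X"
proof (rule eq_mat_mult_index[of _ "d + 1" c "d + 1" c])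
  fix s q s' q' assume "s < d + 1" "q < c" "s' < d + 1" "q' < c"
  thus "embed_bot d c X $$ (s * c + q, s' * c + q') = on_sub 1 d (d + 1) c (embed_bot d 1) X $$ (s * c + q, s' * c + q')"
    by (simp add: index_embed_bot index_on_sub_fst index_embed_bot_1)
qed (simp_all add: on_sub_def)

lemma cptp_embed_bot_register: "cptp (d * c) ((d + 1) * c) (embed_bot d c)"
proof -
  have "embed_bot d c = on_sub 1 d (d + 1) c (embed_bot d 1)"
    by (rule ext) (rule embed_bot_on_sub)
  thus ?thesis using cptp_on_sub[OF cptp_embed_bot[of d], of 1 c] by simp
qed

lemma bot_state_carrier [simp]: "bot_state d \<in> carrier_mat (d + 1) (d + 1)"
  by (simp add: bot_state_def)

lemma density_bot_state: "density (d + 1) (bot_state d)"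
proof -
  define v :: "complex mat" where "v = mat 1 (d + 1) (\<lambda>(i, j). if j = d then 1 else 0)"
  have v: "v \<in> carrier_mat 1 (d + 1)" by (simp add: v_def)
  have "bot_state d = adj v * v"
  proof (rule eq_matI)
    fix i j assume "i < dim_row (adj v * v)" "j < dim_col (adj v * v)"
    hence ij: "i < d + 1" "j < d + 1" using v by auto
    have "(adj v * v) $$ (i, j) = adj v $$ (i, 0) * v $$ (0, j)"
      using ij v by (subst index_mult_sum) (auto simp: sum_lessThan_1)
    thus "bot_state d $$ (i, j) = (adj v * v) $$ (i, j)"
      using ij v by (simp add: bot_state_def v_def del: index_mult_mat(1))
  qed (use v in \<open>auto simp: bot_state_def\<close>)
  hence "psd (bot_state d)" by (simp add: psd_gram)
  moreover have "mtrace (bot_state d) = 1" by (simp add: mtrace_def bot_state_def)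
  ultimately show ?thesis by (simp add: density_def)
qed

section \<open>Purifications and tampering\<close>

lemma ptrace_carrier [simp]: "ptrace 1 a b X \<in> carrier_mat b b"
  by (simp add: ptrace_def)

lemma dim_ptrace [simp]: "dim_row (ptrace 1 a b X) = b" "dim_col (ptrace 1 a b X) = b"
  by (simp_all add: ptrace_def)

lemma index_ptrace:
  "q < b \<Longrightarrow> q' < b \<Longrightarrow> ptrace 1 a b X $$ (q, q') = (\<Sum>s<a. X $$ (s * b + q, s * b + q'))"
  by (simp add: ptrace_def)

lemma mtrace_ptrace:
  assumes "X \<in> carrier_mat (a * b) (a * b)"
  shows "mtrace (ptrace 1 a b X) = mtrace X"
proof -
  have "mtrace (ptrace 1 a b X) = (\<Sum>q<b. \<Sum>s<a. X $$ (s * b + q, s * b + q))"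
    by (simp add: mtrace_def index_ptrace)
  also have "\<dots> = (\<Sum>s<a. \<Sum>q<b. X $$ (s * b + q, s * b + q))" by (rule sum.swap)
  also have "\<dots> = mtrace X" using assms by (simp add: mtrace_def sum_mult_index)
  finally show ?thesis .
qed

lemma canon_pur_carrier: "\<sigma> \<in> carrier_mat d d \<Longrightarrow> canon_pur \<sigma> \<in> carrier_mat (d * d) (d * d)"
  by (auto simp: canon_pur_def Let_def)

lemma index_canon_pur:
  assumes "\<sigma> \<in> carrier_mat d d" "m < d" "m' < d" "n < d" "n' < d"
  shows "canon_pur \<sigma> $$ (m * d + m', n * d + n') = psd_sqrt \<sigma> $$ (m, m') * cnj (psd_sqrt \<sigma> $$ (n, n'))"
proof -
  have "dim_row \<sigma> = d" using assms by simp
  thus ?thesis using assms by (simp add: canon_pur_def Let_def)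
qed

lemma density_canon_pur:
  assumes "density d \<sigma>"
  shows "density (d * d) (canon_pur \<sigma>)"
proof -
  let ?R = "psd_sqrt \<sigma>"
  from assms have \<sigma>: "\<sigma> \<in> carrier_mat d d" "psd \<sigma>" "mtrace \<sigma> = 1" by (auto simp: density_def)
  note R = psd_sqrt[OF \<sigma>(1,2)]
  define v where "v = mat (d * d) 1 (\<lambda>(a, b). ?R $$ (a div d, a mod d))"
  have v: "v \<in> carrier_mat (d * d) 1" by (simp add: v_def)
  have d: "dim_row \<sigma> = d" using \<sigma> by simp
  have "canon_pur \<sigma> = adj (adj v) * adj v"
  proof (rule eq_matI)
    fix i j assume "i < dim_row (adj (adj v) * adj v)" "j < dim_col (adj (adj v) * adj v)"
    hence ij: "i < d * d" "j < d * d" using v by auto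
    have "(v * adj v) $$ (i, j) = v $$ (i, 0) * cnj (v $$ (j, 0))"
      using ij v by (subst index_mult_sum) (auto simp: sum_lessThan_1)
    thus "canon_pur \<sigma> $$ (i, j) = (adj (adj v) * adj v) $$ (i, j)"
      using ij by (simp add: canon_pur_def Let_def d v_def del: index_mult_mat(1))
  qed (use v d in \<open>auto simp: canon_pur_def Let_def\<close>)
  hence psd: "psd (canon_pur \<sigma>)" by (metis psd_gram)
  have "mtrace (canon_pur \<sigma>) = (\<Sum>m<d. \<Sum>n<d. ?R $$ (m, n) * cnj (?R $$ (m, n)))"
    using canon_pur_carrier[OF \<sigma>(1)] \<sigma>(1) by (simp add: mtrace_def sum_mult_index index_canon_pur)
  also have "\<dots> = mtrace (?R * adj ?R)"
    unfolding mtrace_def using R(1)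
    by (simp add: index_mult_sum del: index_mult_mat(1))
  also have "\<dots> = 1" using R psd_hermitian[OF R(2)] \<sigma>(3) by simp
  finally show ?thesis using psd canon_pur_carrier[OF \<sigma>(1)] by (simp add: density_def)
qed

text \<open>The reference marginal is the transpose of \<open>\<sigma>\<close>, written as the Gram
  matrix of the entrywise conjugate of the root.\<close>

lemma density_marginal:
  assumes "density d \<sigma>"
  shows "density d (ptrace 1 d d (canon_pur \<sigma>))"
proof -
  let ?R = "psd_sqrt \<sigma>"
  from assms have \<sigma>: "\<sigma> \<in> carrier_mat d d" by (auto simp: density_def)
  define Q where "Q = mat d d (\<lambda>(m, n). cnj (?R $$ (m, n)))"
  have Q: "Q \<in> carrier_mat d d" by (simp add: Q_def)
  have "ptrace 1 d d (canon_pur \<sigma>) = adj Q * Q"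
  proof (rule eq_matI)
    fix i j assume "i < dim_row (adj Q * Q)" "j < dim_col (adj Q * Q)"
    hence ij: "i < d" "j < d" using Q by auto
    have "(adj Q * Q) $$ (i, j) = (\<Sum>k<d. adj Q $$ (i, k) * Q $$ (k, j))"
      using ij Q by (subst index_mult_sum) auto
    thus "ptrace 1 d d (canon_pur \<sigma>) $$ (i, j) = (adj Q * Q) $$ (i, j)"
      using ij \<sigma> Q by (simp add: index_ptrace index_canon_pur Q_def del: index_mult_mat(1))
  qed (use Q in auto)
  hence "psd (ptrace 1 d d (canon_pur \<sigma>))" by (simp add: psd_gram)
  thus ?thesis using density_canon_pur[OF assms] by (simp add: density_def mtrace_ptrace)
qed

definition maxmix :: "nat \<Rightarrow> complex mat" where
  "maxmix D = complex_of_real (1 / real D) \<cdot>\<^sub>m 1\<^sub>m D"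

lemma maxmix_carrier [simp]: "maxmix D \<in> carrier_mat D D"
  by (simp add: maxmix_def)

lemma index_maxmix: "e < D \<Longrightarrow> f < D \<Longrightarrow> maxmix D $$ (e, f) = (if e = f then 1 / of_nat D else 0)"
  by (simp add: maxmix_def)

lemma density_maxmix: "0 < D \<Longrightarrow> density D (maxmix D)"
  unfolding density_def
proof (intro conjI)
  assume "0 < D"
  show "psd (maxmix D)" unfolding maxmix_def by (intro psd_smult psd_one) simp
  show "mtrace (maxmix D) = 1" using \<open>0 < D\<close> by (simp add: maxmix_def mtrace_def)
qed simp

text \<open>By uniqueness of psd roots the root of \<open>kron \<sigma> (maxmix D)\<close> is the
  root of \<open>\<sigma>\<close> tensored with the identity over the square root of
  \<open>D\<close>. The indices come in the order M, E, Mhat, Ehat.\<close>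

lemma index_canon_pur_maxmix:
  assumes \<sigma>: "density d \<sigma>" and lt: "m < d" "e < D" "m' < d" "e' < D" "n < d" "f < D" "n' < d" "f' < D"
  shows "canon_pur (kron \<sigma> (maxmix D)) $$ ((m * D + e) * (d * D) + (m' * D + e'), (n * D + f) * (d * D) + (n' * D + f'))
    = (if e = e' \<and> f = f' then 1 / of_nat D * canon_pur \<sigma> $$ (m * d + m', n * d + n') else 0)"
proof -
  let ?R = "psd_sqrt \<sigma>"
  define s where "s = complex_of_real (1 / sqrt (real D))"
  note ss = inv_sqrt_sq[of D, folded s_def]
  have cs: "cnj s = s" by (simp add: s_def)
  from \<sigma> have c: "\<sigma> \<in> carrier_mat d d" "psd \<sigma>" by (auto simp: density_def)
  note R = psd_sqrt[OF c]
  have "psd (s \<cdot>\<^sub>m 1\<^sub>m D)" unfolding s_def by (intro psd_smult psd_one) simp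
  hence "psd (kron ?R (s \<cdot>\<^sub>m 1\<^sub>m D))" using R by (intro psd_kron[of _ d _ D]) auto
  moreover have "kron ?R (s \<cdot>\<^sub>m 1\<^sub>m D) * kron ?R (s \<cdot>\<^sub>m 1\<^sub>m D) = kron \<sigma> (maxmix D)"
  proof -
    have "(s \<cdot>\<^sub>m 1\<^sub>m D) * (s \<cdot>\<^sub>m 1\<^sub>m D) = (s * s) \<cdot>\<^sub>m 1\<^sub>m D"
      by (simp add: mult_smult_assoc_mat[of _ D D _ D], intro eq_matI) auto
    also have "\<dots> = maxmix D" unfolding ss by (simp add: maxmix_def)
    finally show ?thesis using R by (subst kron_mult[of _ d d _ D D _ d _ D]) auto
  qed
  moreover have "kron ?R (s \<cdot>\<^sub>m 1\<^sub>m D) \<in> carrier_mat (d * D) (d * D)" using R by simp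
  ultimately have sq: "psd_sqrt (kron \<sigma> (maxmix D)) = kron ?R (s \<cdot>\<^sub>m 1\<^sub>m D)" by (metis psd_sqrt_eqI)
  have k: "kron ?R (s \<cdot>\<^sub>m 1\<^sub>m D) $$ (x * D + y, u * D + v) = (if y = v then s * ?R $$ (x, u) else 0)"
    if "x < d" "y < D" "u < d" "v < D" for x y u v
    using that R by (simp add: index_kron[of _ d d _ D D])
  have "canon_pur (kron \<sigma> (maxmix D)) $$ ((m * D + e) * (d * D) + (m' * D + e'), (n * D + f) * (d * D) + (n' * D + f'))
      = (if e = e' then s * ?R $$ (m, m') else 0) * cnj (if f = f' then s * ?R $$ (n, n') else 0)"
    using lt c(1) by (subst index_canon_pur[of _ "d * D"]) (auto simp: sq k)
  also have "\<dots> = (if e = e' \<and> f = f' then (s * s) * canon_pur \<sigma> $$ (m * d + m', n * d + n') else 0)"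
    using lt c(1) by (auto simp: index_canon_pur cs)
  finally show ?thesis unfolding ss .
qed

lemma index_kron_epr:
  assumes "Y \<in> carrier_mat d d" "m < d" "n < d" "e < 2 ^ l" "e' < 2 ^ l" "f < 2 ^ l" "f' < 2 ^ l"
  shows "kron Y (epr l) $$ ((m * 2 ^ l + e) * 2 ^ l + e', (n * 2 ^ l + f) * 2 ^ l + f')
    = (if e = e' \<and> f = f' then 1 / of_nat (2 ^ l) * Y $$ (m, n) else 0)"
proof -
  have "(m * 2 ^ l + e) * 2 ^ l + e' = m * (2 ^ l * 2 ^ l) + (e * 2 ^ l + e')" for m e e' :: nat
    by (simp add: algebra_simps)
  hence "kron Y (epr l) $$ ((m * 2 ^ l + e) * 2 ^ l + e', (n * 2 ^ l + f) * 2 ^ l + f')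
    = Y $$ (m, n) * epr l $$ (e * 2 ^ l + e', f * 2 ^ l + f')"
    using assms by (simp only:) (rule index_kron[of _ d d _ "2 ^ l * 2 ^ l" "2 ^ l * 2 ^ l"], auto)
  thus ?thesis using assms by (simp add: index_epr)
qed

text \<open>The inner code's reference is ordered Mhat, Ehat, whereas in the new code Ehat is a
  share and precedes the reference Mhat. Exchanging the two turns one input state into the
  other.\<close>

lemma swap_canon_pur_maxmix:
  fixes l d :: nat
  defines "D \<equiv> 2 ^ l"
  assumes \<sigma>: "density d \<sigma>"
  shows "on_sub (d * D) (d * D) (D * d) 1 (swap_regs d D) (canon_pur (kron \<sigma> (maxmix D)))
    = on_sub 1 d (d * D * D) d (\<lambda>X. kron X (epr l)) (canon_pur \<sigma>)"
proof (rule eq_mat_mult_index[of _ "d * D" "D * d" "d * D" "D * d"])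
  fix x i y j assume "x < d * D" "i < D * d" "y < d * D" "j < D * d"
  then obtain m e e' m' n f f' n' where x: "x = m * D + e" "m < d" "e < D" and i: "i = e' * d + m'" "e' < D" "m' < d"
    and y: "y = n * D + f" "n < d" "f < D" and j: "j = f' * d + n'" "f' < D" "n' < d"
    by (metis mult_index_cases)
  let ?X = "canon_pur \<sigma>" and ?X' = "canon_pur (kron \<sigma> (maxmix D))"
  have "on_sub (d * D) (d * D) (D * d) 1 (swap_regs d D) ?X' $$ (x * (D * d) + i, y * (D * d) + j)
      = ?X' $$ (x * (d * D) + (m' * D + e'), y * (d * D) + (n' * D + f'))"
    using x i y j by (simp add: index_on_sub_snd index_swap_regs)
  also have "\<dots> = (if e = e' \<and> f = f' then 1 / of_nat D * ?X $$ (m * d + m', n * d + n') else 0)"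
    unfolding x(1) y(1) using \<sigma> x i y j by (intro index_canon_pur_maxmix) auto
  also have "\<dots> = kron (mat d d (\<lambda>(u, v). ?X $$ (u * d + m', v * d + n'))) (epr l) $$ ((m * D + e) * D + e', (n * D + f) * D + f')"
    using x i y j unfolding D_def by (subst index_kron_epr[of _ d]) auto
  also have "\<dots> = on_sub 1 d (d * D * D) d (\<lambda>X. kron X (epr l)) ?X
      $$ (((m * D + e) * D + e') * d + m', ((n * D + f) * D + f') * d + n')"
    using x i y j by (subst index_on_sub_fst) auto
  also have "((m * D + e) * D + e') * d + m' = x * (D * d) + i" by (simp add: x i algebra_simps)
  also have "((n * D + f) * D + f') * d + n' = y * (D * d) + j" by (simp add: y j algebra_simps)
  finally show "on_sub (d * D) (d * D) (D * d) 1 (swap_regs d D) ?X' $$ (x * (D * d) + i, y * (D * d) + j)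
    = on_sub 1 d (d * D * D) d (\<lambda>X. kron X (epr l)) ?X $$ (x * (D * d) + i, y * (D * d) + j)" .
qed (simp_all add: on_sub_def mult_ac)

text \<open>The same exchange on the reference alone: Ehat, cut off from its partner E, is maximally
  mixed and independent of Mhat.\<close>

lemma swap_marginal_maxmix:
  assumes \<sigma>: "density d \<sigma>" and D: "0 < D"
  shows "swap_regs d D (ptrace 1 (d * D) (d * D) (canon_pur (kron \<sigma> (maxmix D))))
    = kron (maxmix D) (ptrace 1 d d (canon_pur \<sigma>))"
proof (rule eq_mat_mult_index[of _ D d D d])
  fix e' m' f' n' assume lt: "e' < D" "m' < d" "f' < D" "n' < d"
  let ?X = "canon_pur \<sigma>" and ?X' = "canon_pur (kron \<sigma> (maxmix D))"
  have "swap_regs d D (ptrace 1 (d * D) (d * D) ?X') $$ (e' * d + m', f' * d + n')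
      = (\<Sum>m<d. \<Sum>e<D. ?X' $$ ((m * D + e) * (d * D) + (m' * D + e'), (m * D + e) * (d * D) + (n' * D + f')))"
    using lt by (simp add: index_swap_regs index_ptrace sum_mult_index)
  also have "\<dots> = (\<Sum>m<d. \<Sum>e<D. if e = e' then (if e' = f' then 1 / of_nat D * ?X $$ (m * d + m', m * d + n') else 0) else 0)"
    using \<sigma> lt by (intro sum.cong refl) (auto simp: index_canon_pur_maxmix)
  also have "\<dots> = maxmix D $$ (e', f') * ptrace 1 d d ?X $$ (m', n')"
    using lt by (simp add: index_maxmix index_ptrace sum_if_const sum_distrib_left sum_divide_distrib)
  also have "\<dots> = kron (maxmix D) (ptrace 1 d d ?X) $$ (e' * d + m', f' * d + n')"
    using lt by (subst index_kron[of _ D D _ d d]) auto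
  finally show "swap_regs d D (ptrace 1 (d * D) (d * D) ?X') $$ (e' * d + m', f' * d + n')
    = kron (maxmix D) (ptrace 1 d d ?X) $$ (e' * d + m', f' * d + n')" .
qed (simp_all add: swap_regs_def)

text \<open>\<open>foldr\<close> applies the map of the last share first. From the point of view of
  the other shares that register belongs to the reference, whence the dimension
  \<open>2 ^ l * r\<close>.\<close>

lemma tamper_snoc:
  assumes "length Ls = length ns + 1"
  shows "tamper (ns @ [l]) Ls r X
    = tamper ns (butlast Ls) (2 ^ l * r) (on_sub (2 ^ sum_list ns) (2 ^ l) (2 ^ l) r (Ls ! length ns) X)"
proof -
  let ?Y = "on_sub (2 ^ sum_list ns) (2 ^ l) (2 ^ l) r (Ls ! length ns) X"
  have "tamper (ns @ [l]) Ls r X = foldr (\<lambda>i Y. on_sub (2 ^ sum_list (take i (ns @ [l]))) (2 ^ ((ns @ [l]) ! i)) (2 ^ ((ns @ [l]) ! i))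
       (2 ^ sum_list (drop (Suc i) (ns @ [l])) * r) (Ls ! i) Y) [0..<length ns] ?Y"
    by (simp add: tamper_def)
  also have "\<dots> = tamper ns (butlast Ls) (2 ^ l * r) ?Y"
    unfolding tamper_def
    by (intro foldr_cong refl) (auto simp: nth_append nth_butlast assms power_add mult.assoc)
  finally show ?thesis .
qed

text \<open>The definition of \<open>tamper\<close> carries the reference through every step. Here
  it is separated off, so that tampering becomes one channel on the shares, the same for every
  reference dimension.\<close>

lemma tamper_on_sub:
  assumes LO: "LO_adv ns Ls" and N: "N = 2 ^ sum_list ns"
  shows "cptp N N (tamper ns Ls 1)"
    and "X \<in> carrier_mat (N * c) (N * c) \<Longrightarrow> tamper ns Ls c X = on_sub 1 N N c (tamper ns Ls 1) X"
proof -
  \<comment> \<open>The fold over an arbitrary list of share positions, since induction on the full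
    list needs its tails.\<close>
  define F where "F r is X = foldr (\<lambda>i Y. on_sub (2 ^ sum_list (take i ns)) (2 ^ (ns ! i)) (2 ^ (ns ! i))
       (2 ^ sum_list (drop (Suc i) ns) * r) (Ls ! i) Y) is X" for r "is" X
  have main: "cptp N N (F 1 is) \<and> (\<forall>X \<in> carrier_mat (N * c) (N * c). F c is X = on_sub 1 N N c (F 1 is) X)"
    if "set is \<subseteq> {..<length ns}" for "is"
    using that
  proof (induction "is")
    case Nil
    thus ?case using cptp_id by (simp add: F_def on_sub_id)
  next
    case (Cons i "is")
    hence i: "i < length ns" and IH: "cptp N N (F 1 is)"
      "\<And>X. X \<in> carrier_mat (N * c) (N * c) \<Longrightarrow> F c is X = on_sub 1 N N c (F 1 is) X" by auto
    define pre d post where "pre = (2 :: nat) ^ sum_list (take i ns)" and "d = (2 :: nat) ^ (ns ! i)"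
      and "post = (2 :: nat) ^ sum_list (drop (Suc i) ns)"
    have "sum_list ns = sum_list (take i ns) + ns ! i + sum_list (drop (Suc i) ns)"
      using id_take_nth_drop[OF i] by (metis add.assoc sum_list.Cons sum_list.append)
    hence Nd: "N = pre * d * post" by (simp add: N pre_def d_def post_def power_add)
    have \<Lambda>: "cptp d d (Ls ! i)" using LO i by (simp add: LO_adv_def d_def)
    have step: "F r (i # is) X = on_sub pre d d (post * r) (Ls ! i) (F r is X)" for r X
      by (simp add: F_def pre_def d_def post_def)
    have "cptp N N (on_sub pre d d post (Ls ! i))" using cptp_on_sub[OF \<Lambda>] by (simp add: Nd)
    moreover have F1: "F 1 (i # is) = (\<lambda>X. on_sub pre d d post (Ls ! i) (F 1 is X))"
      by (rule ext) (simp add: step)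
    ultimately have "cptp N N (F 1 (i # is))" using cptp_comp[OF IH(1)] by simp
    moreover have "F c (i # is) X = on_sub 1 N N c (F 1 (i # is)) X" if "X \<in> carrier_mat (N * c) (N * c)" for X
    proof -
      have "F c (i # is) X = on_sub (1 * pre) d d (post * c) (Ls ! i) (on_sub 1 N N c (F 1 is) X)"
        by (simp add: step IH(2)[OF that])
      also have "\<dots> = on_sub 1 N N c (on_sub pre d d post (Ls ! i)) (on_sub 1 N N c (F 1 is) X)"
        unfolding on_sub_nest[symmetric] Nd ..
      also have "\<dots> = on_sub 1 N N c (\<lambda>Y. on_sub pre d d post (Ls ! i) (F 1 is Y)) X"
        using cptp_carrier[OF IH(1)] by (rule on_sub_comp)
      finally show ?thesis unfolding F1 .
    qed
    ultimately show ?case by blast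
  qed
  have eq: "tamper ns Ls r = F r [0..<length ns]" for r by (rule ext) (simp add: tamper_def F_def)
  have sub: "set [0..<length ns] \<subseteq> {..<length ns}" by auto
  from main[OF sub] show "cptp N N (tamper ns Ls 1)"
    "X \<in> carrier_mat (N * c) (N * c) \<Longrightarrow> tamper ns Ls c X = on_sub 1 N N c (tamper ns Ls 1) X"
    by (simp_all add: eq)
qed

section \<open>Entrywise bounds for positive semidefinite matrices\<close>

lemma psd_minor:
  assumes "psd A" "i < dim_row A" "j < dim_row A"
  shows "(cmod (A $$ (i, j)))\<^sup>2 \<le> Re (A $$ (i, i)) * Re (A $$ (j, j))"
proof (cases "i = j")
  case True
  have "A $$ (i, i) = complex_of_real (Re (A $$ (i, i)))"
    using psd_diag[OF assms(1,2)] by (simp add: complex_eq_iff less_eq_complex_def)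
  hence "cmod (A $$ (i, i)) = \<bar>Re (A $$ (i, i))\<bar>" by (metis norm_of_real)
  thus ?thesis using True by (simp add: power2_eq_square)
next
  case False
  let ?a = "A $$ (i, j)"
  define p where "p = Re (A $$ (i, i))"
  define r where "r = Re (A $$ (j, j))"
  define b where "b = (cmod ?a)\<^sup>2"
  have b: "b = (Re ?a)\<^sup>2 + (Im ?a)\<^sup>2" by (simp add: b_def cmod_power2)
  have pr: "0 \<le> p" "0 \<le> r" and im: "Im (A $$ (i, i)) = 0" "Im (A $$ (j, j)) = 0"
    using psd_diag[OF assms(1,2)] psd_diag[OF assms(1,3)] by (auto simp: p_def r_def less_eq_complex_def)
  have ji: "A $$ (j, i) = cnj ?a"
    using index_adj[of j A i] assms psd_hermitian[OF assms(1)] by (simp add: psd_def)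
  have quad: "0 \<le> s\<^sup>2 * p - 2 * s * t * b + t\<^sup>2 * b * r" for s t :: real
  proof -
    have "0 \<le> Re (qform A (\<lambda>k. if k = i then complex_of_real s else if k = j then - complex_of_real t * cnj ?a else 0))"
      using assms(1) by (simp add: psd_iff_qform less_eq_complex_def)
    also have "\<dots> = s\<^sup>2 * p - 2 * s * t * b + t\<^sup>2 * b * r"
      unfolding qform_two[OF assms(2,3) False] ji
      by (simp add: im p_def[symmetric] r_def[symmetric] b power2_eq_square algebra_simps)
    finally show ?thesis .
  qed
  have "b \<le> p * r"
  proof (cases "r = 0")
    case True
    have "b = 0"
    proof (rule ccontr)
      assume "b \<noteq> 0"
      \<comment> \<open>For \<open>r = 0\<close> the form is linear in \<open>t\<close>, and this
        \<open>t\<close> gives it the value -1.\<close>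
      with quad[of 1 "(p + 1) / (2 * b)"] True show False by (simp add: field_simps)
    qed
    thus ?thesis using pr by simp
  next
    case False
    \<comment> \<open>For given \<open>s\<close> the form is least at \<open>t = s / r\<close>;
      \<open>s = r\<close>, \<open>t = 1\<close> is that point without a division.\<close>
    have "0 \<le> r * (p * r - b)" using quad[of r 1] by (simp add: power2_eq_square algebra_simps)
    thus ?thesis using False pr by (simp add: zero_le_mult_iff)
  qed
  thus ?thesis by (simp add: b_def p_def r_def)
qed

text \<open>The minor inequality for both matrices, then the arithmetic-geometric mean. The factors
  are paired crosswise so that, summed over all \<open>e\<close> and \<open>f\<close>, each half
  becomes a product of two independent sums, hence of traces; pairing equal indices would cost a
  factor of the dimension.\<close>

lemma psd_entry_product:
  assumes A: "psd A" "i < dim_row A" "j < dim_row A" and B: "psd B" "e < dim_row B" "f < dim_row B"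
  shows "cmod (A $$ (i, j) * B $$ (e, f))
    \<le> (Re (A $$ (i, i)) * Re (B $$ (f, f)) + Re (A $$ (j, j)) * Re (B $$ (e, e))) / 2"
proof -
  have nn: "0 \<le> Re (A $$ (i, i))" "0 \<le> Re (A $$ (j, j))" "0 \<le> Re (B $$ (e, e))" "0 \<le> Re (B $$ (f, f))"
    using psd_diag[OF A(1,2)] psd_diag[OF A(1,3)] psd_diag[OF B(1,2)] psd_diag[OF B(1,3)]
    by (auto simp: less_eq_complex_def)
  let ?x = "Re (A $$ (i, i)) * Re (B $$ (f, f))" and ?y = "Re (A $$ (j, j)) * Re (B $$ (e, e))"
  have "(cmod (A $$ (i, j) * B $$ (e, f)))\<^sup>2 = (cmod (A $$ (i, j)))\<^sup>2 * (cmod (B $$ (e, f)))\<^sup>2"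
    by (simp add: norm_mult power_mult_distrib)
  also have "\<dots> \<le> (Re (A $$ (i, i)) * Re (A $$ (j, j))) * (Re (B $$ (e, e)) * Re (B $$ (f, f)))"
    using psd_minor[OF A] psd_minor[OF B] nn by (intro mult_mono) auto
  also have "\<dots> = ?x * ?y" by (simp add: mult_ac)
  also have "\<dots> \<le> ((?x + ?y) / 2)\<^sup>2"
  proof -
    have "((x + y) / 2)\<^sup>2 - x * y = ((x - y) / 2)\<^sup>2" for x y :: real
      by (simp add: power2_eq_square field_simps)
    thus ?thesis by (metis diff_ge_0_iff_ge zero_le_power2)
  qed
  finally have "(cmod (A $$ (i, j) * B $$ (e, f)))\<^sup>2 \<le> ((?x + ?y) / 2)\<^sup>2" .
  moreover have "0 \<le> (?x + ?y) / 2" using nn by simp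
  ultimately show ?thesis by (rule power2_le_imp_le)
qed

section \<open>The tampered code\<close>

text \<open>The map on Ehat moves in front of the encoder and the EPR test is split off from the
  decoder. In between, encoding, tampering and decoding of the first shares merge into one channel,
  with Ehat and the reference as its spectators.\<close>

lemma run_new_code:
  fixes l d N r :: nat and EncT DecT F \<Lambda> :: "complex mat \<Rightarrow> complex mat"
  defines "D \<equiv> 2 ^ l"
  assumes Enc: "cptp (d * D) N EncT" and Dec: "cptp N (d * D + 1) DecT"
    and F: "cptp N N F" and \<Lambda>: "cptp D D \<Lambda>"
  shows "on_sub 1 (N * D) (d + 1) r (\<lambda>Y. bot_test (epr_bra d D) (on_sub 1 N (d * D + 1) D DecT Y))
      (on_sub 1 N N (D * r) F (on_sub N D D r \<Lambda>
        (on_sub 1 d (N * D) r (\<lambda>X. on_sub 1 (d * D) N D EncT (kron X (epr l))) X)))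
    = on_sub 1 ((d * D + 1) * D) (d + 1) r (bot_test (epr_bra d D))
        (on_sub 1 (d * D) (d * D + 1) (D * r) (\<lambda>Y. DecT (F (EncT Y)))
          (on_sub (d * D) (D * r) (D * r) 1 (on_sub 1 D D r \<Lambda>)
            (on_sub 1 d (d * D * D) r (\<lambda>X. kron X (epr l)) X)))"
proof -
  let ?K = "d * D"
  define X1 where "X1 = on_sub 1 d (?K * D) r (\<lambda>X. kron X (epr l)) X"
  define \<Lambda>' where "\<Lambda>' = on_sub 1 D D r \<Lambda>"
  have \<Lambda>': "cptp (D * r) (D * r) \<Lambda>'"
    using cptp_on_sub[OF \<Lambda>, of 1 r] by (simp add: \<Lambda>'_def)
  have "on_sub 1 d (N * D) r (\<lambda>X. on_sub 1 ?K N D EncT (kron X (epr l))) X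
      = on_sub 1 (?K * D) (N * D) r (on_sub 1 ?K N D EncT) X1"
    unfolding X1_def using cptp_carrier[OF cptp_kron_epr[of d l]]
    by (intro on_sub_comp[symmetric]) (simp add: D_def)
  also have "\<dots> = on_sub 1 ?K N (D * r) EncT X1" by (rule on_sub_fst_nest)
  finally have enc: "on_sub 1 d (N * D) r (\<lambda>X. on_sub 1 ?K N D EncT (kron X (epr l))) X = on_sub 1 ?K N (D * r) EncT X1" .
  have dec: "on_sub 1 (N * D) (d + 1) r (\<lambda>Y. bot_test (epr_bra d D) (on_sub 1 N (?K + 1) D DecT Y)) Y
      = on_sub 1 ((?K + 1) * D) (d + 1) r (bot_test (epr_bra d D)) (on_sub 1 N (?K + 1) (D * r) DecT Y)" for Y
  proof -
    have "on_sub 1 N (?K + 1) (D * r) DecT Y = on_sub 1 (N * D) ((?K + 1) * D) r (on_sub 1 N (?K + 1) D DecT) Y"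
      by (rule on_sub_fst_nest[symmetric])
    thus ?thesis by (simp only:) (rule on_sub_comp[symmetric], simp add: on_sub_def)
  qed
  have "on_sub 1 N (?K + 1) (D * r) DecT (on_sub 1 N N (D * r) F (on_sub N D D r \<Lambda> (on_sub 1 ?K N (D * r) EncT X1)))
      = on_sub 1 N (?K + 1) (D * r) (\<lambda>Y. DecT (F Y)) (on_sub N (D * r) (D * r) 1 \<Lambda>' (on_sub 1 ?K N (D * r) EncT X1))"
    unfolding \<Lambda>'_def on_sub_snd_nest using cptp_carrier[OF F] by (rule on_sub_comp)
  also have "\<dots> = on_sub 1 N (?K + 1) (D * r) (\<lambda>Y. DecT (F Y)) (on_sub 1 ?K N (D * r) EncT (on_sub ?K (D * r) (D * r) 1 \<Lambda>' X1))"
    unfolding on_sub_commute[OF Enc \<Lambda>'] ..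
  also have "\<dots> = on_sub 1 ?K (?K + 1) (D * r) (\<lambda>Y. DecT (F (EncT Y))) (on_sub ?K (D * r) (D * r) 1 \<Lambda>' X1)"
    using cptp_carrier[OF Enc] by (rule on_sub_comp)
  finally show ?thesis unfolding enc dec X1_def \<Lambda>'_def by (rule arg_cong)
qed

text \<open>The entanglement fidelity $\langle\Phi| (\Lambda \otimes \mathrm{id})(\Phi) |\Phi\rangle$ of a channel.\<close>

definition epr_fidelity :: "nat \<Rightarrow> (complex mat \<Rightarrow> complex mat) \<Rightarrow> complex" where
  "epr_fidelity D \<Lambda> = 1 / of_nat D * (1 / of_nat D) * (\<Sum>e<D. \<Sum>f<D.
     \<Lambda> (mat D D (\<lambda>(x, y). if x = e \<and> y = f then 1 else 0)) $$ (e, f))"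

lemma epr_fidelity_id: "0 < D \<Longrightarrow> epr_fidelity D (\<lambda>X. X) = 1"
  by (simp add: epr_fidelity_def)

text \<open>One factor \<open>1 / D\<close> of the fidelity comes from the EPR state and one from
  the test. The statement covers arbitrary \<open>X\<close>, not only states, because
  \<open>run_embed\<close> applies it to off-diagonal blocks as well.\<close>

lemma bot_test_epr_channel:
  fixes l d :: nat
  defines "D \<equiv> 2 ^ l"
  assumes \<Lambda>: "cptp D D \<Lambda>" and X: "X \<in> carrier_mat d d"
  shows "bot_test (epr_bra d D) (embed_bot (d * D) D (on_sub (d * D) D D 1 \<Lambda> (kron X (epr l))))
    = mat (d + 1) (d + 1) (\<lambda>(i, j). if i < d \<and> j < d then epr_fidelity D \<Lambda> * X $$ (i, j)
        else if i = d \<and> j = d then (1 - epr_fidelity D \<Lambda>) * mtrace X else 0)"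
proof -
  let ?q = "epr_fidelity D \<Lambda>"
  define Z where "Z = on_sub (d * D) D D 1 \<Lambda> (kron X (epr l))"
  define Y where "Y = embed_bot (d * D) D Z"
  have kX: "kron X (epr l) \<in> carrier_mat (d * D * D) (d * D * D)"
    using cptp_carrier[OF cptp_kron_epr X] by (simp add: D_def)
  have Zc: "Z \<in> carrier_mat (d * D * D) (d * D * D)" by (simp add: Z_def on_sub_def)
  have Yc: "Y \<in> carrier_mat ((d * D + 1) * D) ((d * D + 1) * D)" by (simp add: Y_def embed_bot_def)
  define B where "B = epr_bra d D * Y * adj (epr_bra d D)"
  have Bc: "B \<in> carrier_mat d d" by (intro carrier_matI) (simp_all add: B_def)
  have Bij: "B $$ (i, j) = ?q * X $$ (i, j)" if ij: "i < d" "j < d" for i j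
  proof -
    have "Y $$ ((i * D + e) * D + e, (j * D + f) * D + f)
        = 1 / of_nat D * X $$ (i, j) * \<Lambda> (mat D D (\<lambda>(x, y). if x = e \<and> y = f then 1 else 0)) $$ (e, f)"
      if ef: "e < D" "f < D" for e f
    proof -
      let ?E = "mat D D (\<lambda>(x, y). if x = e \<and> y = f then 1 else (0 :: complex))"
      have lt: "i * D + e < d * D" "j * D + f < d * D" using ij ef by auto
      \<comment> \<open>Between fixed M and E indices the Ehat block is a multiple of a matrix unit,
        so \<open>\<Lambda>\<close> enters only through its values on matrix units.\<close>
      have "mat D D (\<lambda>(x, y). kron X (epr l) $$ ((i * D + e) * D + x, (j * D + f) * D + y))
          = (1 / of_nat D * X $$ (i, j)) \<cdot>\<^sub>m ?E"
        using ij ef X unfolding D_def by (intro eq_matI) (auto simp: index_kron_epr)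
      hence "Z $$ ((i * D + e) * D + e, (j * D + f) * D + f) = \<Lambda> ((1 / of_nat D * X $$ (i, j)) \<cdot>\<^sub>m ?E) $$ (e, f)"
        unfolding Z_def using lt ef by (subst index_on_sub_snd) auto
      also have "\<dots> = 1 / of_nat D * X $$ (i, j) * \<Lambda> ?E $$ (e, f)"
        using ef cptp_carrier[OF \<Lambda>, of ?E] by (subst cptp_smult[OF \<Lambda>]) auto
      finally show ?thesis
        unfolding Y_def using lt ef by (subst index_embed_bot) auto
    qed
    hence "B $$ (i, j) = 1 / of_nat D * (\<Sum>e<D. \<Sum>f<D.
        1 / of_nat D * X $$ (i, j) * \<Lambda> (mat D D (\<lambda>(x, y). if x = e \<and> y = f then 1 else 0)) $$ (e, f))"
      unfolding B_def epr_bra_conj_index[OF Yc ij] by simp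
    also have "\<dots> = ?q * X $$ (i, j)"
      by (simp only: epr_fidelity_def sum_distrib_left[symmetric]) simp
    finally show ?thesis .
  qed
  have "mtrace Y = mtrace Z"
    unfolding Y_def using cptp_mtrace[OF cptp_embed_bot_register Zc] .
  also have "\<dots> = mtrace (kron X (epr l))"
    unfolding Z_def using cptp_mtrace[OF cptp_on_sub[OF \<Lambda>, of "d * D" 1]] kX by simp
  also have "\<dots> = mtrace X"
    using cptp_mtrace[OF cptp_kron_epr X] .
  finally have trY: "mtrace Y = mtrace X" .
  have trB: "mtrace B = ?q * mtrace X"
    using Bc X by (simp add: mtrace_def Bij sum_distrib_left)
  show ?thesis
    unfolding Z_def[symmetric] Y_def[symmetric] bot_test_def Let_def B_def[symmetric] trY trB
    by (intro eq_matI) (auto simp: Bij algebra_simps)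
qed

text \<open>Both bounds are positivity of the diagonal of the output state of the test on a one-dimensional message.\<close>

lemma epr_fidelity_range:
  fixes l :: nat
  defines "D \<equiv> 2 ^ l"
  assumes \<Lambda>: "cptp D D \<Lambda>"
  shows "0 \<le> epr_fidelity D \<Lambda>" "epr_fidelity D \<Lambda> \<le> 1"
proof -
  let ?q = "epr_fidelity D \<Lambda>"
  let ?Z = "on_sub (1 * D) D D 1 \<Lambda> (kron (1\<^sub>m 1) (epr l))"
  let ?T = "bot_test (epr_bra 1 D) (embed_bot (1 * D) D ?Z)"
  have D0: "0 < D" by (simp add: D_def)
  have "psd (kron (1\<^sub>m 1) (epr l))" "kron (1\<^sub>m 1) (epr l) \<in> carrier_mat (1 * D * D) (1 * D * D)"
    using cptp_psd[OF cptp_kron_epr[of 1 l] one_carrier_mat psd_one] cptp_carrier[OF cptp_kron_epr[of 1 l] one_carrier_mat]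
    by (simp_all add: D_def)
  hence "psd ?Z" "?Z \<in> carrier_mat (1 * D * D) (1 * D * D)"
    using cptp_psd[OF cptp_on_sub[OF \<Lambda>, of "1 * D" 1]] by (simp_all add: on_sub_def)
  from this(2,1) have "psd (embed_bot (1 * D) D ?Z)"
    by (intro cptp_psd[OF cptp_embed_bot_register])
  hence psd: "psd ?T"
    using cptp_psd[OF cptp_bot_test[OF epr_bra_carrier epr_bra_unit[OF D0]], of "embed_bot (1 * D) D ?Z" 1]
    by simp
  have T: "?T = mat (1 + 1) (1 + 1) (\<lambda>(i, j). if i < 1 \<and> j < 1 then ?q * 1\<^sub>m 1 $$ (i, j)
        else if i = 1 \<and> j = 1 then (1 - ?q) * mtrace (1\<^sub>m 1) else 0)"
    unfolding D_def using \<Lambda> by (intro bot_test_epr_channel) (simp_all add: D_def)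
  have "0 \<le> ?T $$ (0, 0)" "0 \<le> ?T $$ (1, 1)"
    by (rule psd_diag[OF psd], simp add: bot_test_def Let_def)+
  thus "0 \<le> ?q" "?q \<le> 1" unfolding T by (simp_all add: mtrace_def sum_lessThan_1)
qed

text \<open>Every step is local to M, E and Ehat, so the whole run is one map
  \<open>\<Omega>\<close> applied to the blocks of \<open>X\<close> between reference indices.
  \<open>bot_test_epr_channel\<close> evaluates it on each block.\<close>

lemma run_embed:
  fixes l d r :: nat
  defines "D \<equiv> 2 ^ l"
  assumes \<Lambda>: "cptp D D \<Lambda>" and X: "X \<in> carrier_mat (d * r) (d * r)"
  shows "on_sub 1 ((d * D + 1) * D) (d + 1) r (bot_test (epr_bra d D)) (embed_bot (d * D) (D * r)
      (on_sub (d * D) (D * r) (D * r) 1 (on_sub 1 D D r \<Lambda>) (on_sub 1 d (d * D * D) r (\<lambda>X. kron X (epr l)) X)))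
    = epr_fidelity D \<Lambda> \<cdot>\<^sub>m embed_bot d r X + (1 - epr_fidelity D \<Lambda>) \<cdot>\<^sub>m kron (bot_state d) (ptrace 1 d r X)"
    (is "?L = ?R")
proof -
  let ?K = "d * D" and ?q = "epr_fidelity D \<Lambda>"
  define \<Omega> where "\<Omega> Y = bot_test (epr_bra d D) (embed_bot ?K D (on_sub ?K D D 1 \<Lambda> (kron Y (epr l))))" for Y
  have emb: "embed_bot ?K (D * r) Z = on_sub 1 (?K * D) ((?K + 1) * D) r (embed_bot ?K D) Z" for Z
  proof -
    have "embed_bot ?K (D * r) Z = on_sub 1 ?K (?K + 1) (D * r) (embed_bot ?K 1) Z" by (rule embed_bot_on_sub)
    also have "\<dots> = on_sub 1 (?K * D) ((?K + 1) * D) r (on_sub 1 ?K (?K + 1) D (embed_bot ?K 1)) Z"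
      by (rule on_sub_fst_nest[symmetric])
    also have "on_sub 1 ?K (?K + 1) D (embed_bot ?K 1) = embed_bot ?K D"
      by (rule ext) (rule embed_bot_on_sub[symmetric])
    finally show ?thesis .
  qed
  have lam: "on_sub ?K (D * r) (D * r) 1 (on_sub 1 D D r \<Lambda>) Z = on_sub 1 (?K * D) (?K * D) r (on_sub ?K D D 1 \<Lambda>) Z" for Z
    unfolding on_sub_snd_nest on_sub_mid_nest ..
  have k: "kron Y (epr l) \<in> carrier_mat (?K * D) (?K * D)" if "Y \<in> carrier_mat d d" for Y
    using cptp_carrier[OF cptp_kron_epr that] by (simp add: D_def)
  have L: "?L = on_sub 1 d (d + 1) r \<Omega> X"
    unfolding emb lam \<Omega>_def
    by (subst on_sub_comp, erule k, subst on_sub_comp, simp add: on_sub_def, subst on_sub_comp) simp_all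
  show ?thesis unfolding L
  proof (rule eq_mat_mult_index[of _ "d + 1" r "d + 1" r])
    fix s q s' q' assume sq: "s < d + 1" "q < r" "s' < d + 1" "q' < r"
    define Y where "Y = mat d d (\<lambda>(x, y). X $$ (x * r + q, y * r + q'))"
    have Y: "Y \<in> carrier_mat d d" by (simp add: Y_def)
    have "on_sub 1 d (d + 1) r \<Omega> X $$ (s * r + q, s' * r + q') = \<Omega> Y $$ (s, s')"
      using sq by (simp add: index_on_sub_fst Y_def)
    also have "\<dots> = (if s < d \<and> s' < d then ?q * Y $$ (s, s') else if s = d \<and> s' = d then (1 - ?q) * mtrace Y else 0)"
      unfolding \<Omega>_def D_def using sq bot_test_epr_channel[OF \<Lambda>[unfolded D_def] Y] by simp
    \<comment> \<open>The trace of the block between \<open>q\<close> and \<open>q'\<close> is an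
      entry of the reference marginal: rejection leaves the reference in that marginal.\<close>
    also have "mtrace Y = ptrace 1 d r X $$ (q, q')"
      using sq by (simp add: mtrace_def Y_def index_ptrace)
    also have "(if s < d \<and> s' < d then ?q * Y $$ (s, s') else if s = d \<and> s' = d then (1 - ?q) * ptrace 1 d r X $$ (q, q') else 0)
        = ?q * embed_bot d r X $$ (s * r + q, s' * r + q')
          + (1 - ?q) * kron (bot_state d) (ptrace 1 d r X) $$ (s * r + q, s' * r + q')"
      using sq by (simp add: index_embed_bot index_kron[of "bot_state d" "d + 1" "d + 1" _ r r] Y_def, simp add: bot_state_def)
    also have "\<dots> = ?R $$ (s * r + q, s' * r + q')"
    proof -
      have "s * r + q < (d + 1) * r" "s' * r + q' < (d + 1) * r" using sq by (blast intro: mult_index_less)+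
      moreover have "dim_row (bot_state d) = d + 1" "dim_col (bot_state d) = d + 1" by (simp_all add: bot_state_def)
      ultimately show ?thesis by simp
    qed
    finally show "on_sub 1 d (d + 1) r \<Omega> X $$ (s * r + q, s' * r + q') = ?R $$ (s * r + q, s' * r + q')" .
  qed (auto simp: on_sub_def bot_state_def)
qed

text \<open>A product state passes the test with probability
  $\mathrm{tr}(\gamma_E \omega^T) / D \le \mathrm{tr}(\gamma_E)\,\mathrm{tr}(\omega) / D$.\<close>

lemma epr_pass_product_le:
  assumes \<gamma>: "density (d * D + 1) \<gamma>" and \<omega>: "density D \<omega>"
  shows "Re (mtrace (epr_bra d D * kron \<gamma> \<omega> * adj (epr_bra d D))) \<le> 1 / real D"
proof -
  let ?A = "epr_bra d D"
  from \<gamma> have g: "\<gamma> \<in> carrier_mat (d * D + 1) (d * D + 1)" "psd \<gamma>" "mtrace \<gamma> = 1" by (auto simp: density_def)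
  from \<omega> have w: "\<omega> \<in> carrier_mat D D" "psd \<omega>" "mtrace \<omega> = 1" by (auto simp: density_def)
  have k: "kron \<gamma> \<omega> \<in> carrier_mat ((d * D + 1) * D) ((d * D + 1) * D)" using g w by simp
  have lt: "i * D + e < d * D + 1" if "i < d" "e < D" for i e
    using mult_index_less[OF that] by simp
  define S where "S = (\<Sum>i<d. \<Sum>e<D. \<Sum>f<D. \<gamma> $$ (i * D + e, i * D + f) * \<omega> $$ (e, f))"
  have "mtrace (?A * kron \<gamma> \<omega> * adj ?A) = (\<Sum>i<d. (?A * kron \<gamma> \<omega> * adj ?A) $$ (i, i))"
    by (simp add: mtrace_def del: index_mult_mat(1))
  also have "\<dots> = (\<Sum>i<d. 1 / of_nat D * (\<Sum>e<D. \<Sum>f<D. kron \<gamma> \<omega> $$ ((i * D + e) * D + e, (i * D + f) * D + f)))"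
    by (intro sum.cong refl epr_bra_conj_index[OF k]) auto
  also have "\<dots> = 1 / of_nat D * S"
    unfolding S_def sum_distrib_left using g w lt
    by (intro sum.cong refl) (simp add: index_kron[of _ "d * D + 1" "d * D + 1" _ D D])
  finally have eq: "mtrace (?A * kron \<gamma> \<omega> * adj ?A) = 1 / of_nat D * S" .
  let ?g = "\<lambda>i e. Re (\<gamma> $$ (i * D + e, i * D + e))" and ?w = "\<lambda>e. Re (\<omega> $$ (e, e))"
  have "Re S \<le> cmod S" by (rule complex_Re_le_cmod)
  also have "\<dots> \<le> (\<Sum>i<d. \<Sum>e<D. \<Sum>f<D. cmod (\<gamma> $$ (i * D + e, i * D + f) * \<omega> $$ (e, f)))"
    unfolding S_def by (intro order_trans[OF norm_sum] sum_mono order_refl)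
  also have "\<dots> \<le> (\<Sum>i<d. \<Sum>e<D. \<Sum>f<D. (?g i e * ?w f + ?g i f * ?w e) / 2)"
    using g w lt by (intro sum_mono psd_entry_product) auto
  also have "\<dots> = (\<Sum>i<d. \<Sum>e<D. \<Sum>f<D. ?g i e * ?w f)"
  proof (rule sum.cong[OF refl])
    fix i
    have "(\<Sum>e<D. \<Sum>f<D. ?g i f * ?w e) = (\<Sum>e<D. \<Sum>f<D. ?g i e * ?w f)" by (rule sum.swap)
    thus "(\<Sum>e<D. \<Sum>f<D. (?g i e * ?w f + ?g i f * ?w e) / 2) = (\<Sum>e<D. \<Sum>f<D. ?g i e * ?w f)"
      by (simp add: sum.distrib sum_divide_distrib[symmetric])
  qed
  also have "\<dots> = (\<Sum>x<d * D. Re (\<gamma> $$ (x, x))) * Re (mtrace \<omega>)"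
  proof -
    have "Re (mtrace \<omega>) = (\<Sum>f<D. ?w f)" using w(1) by (simp add: mtrace_def)
    thus ?thesis by (simp add: sum_mult_index sum_distrib_left[symmetric] sum_distrib_right[symmetric])
  qed
  also have "\<dots> = (\<Sum>x<d * D. Re (\<gamma> $$ (x, x)))" by (simp add: w(3))
  \<comment> \<open>The sum misses only the bot entry of \<open>\<gamma>\<close>, which is
    nonnegative.\<close>
  also have "\<dots> \<le> Re (mtrace \<gamma>)"
    using psd_diag[OF g(2), of "d * D"] g(1) by (simp add: mtrace_def sum_lessThan_plus1 less_eq_complex_def)
  finally have "Re S \<le> 1" by (simp add: g(3))
  thus ?thesis unfolding eq by (simp add: divide_right_mono)
qed

text \<open>Splits the output into the accepted part \<open>G\<close>, whose weight \<open>c\<close>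
  is the passing probability, and the rejecting state with the remaining weight.\<close>

lemma bot_test_product:
  assumes \<gamma>: "density (d * D + 1) \<gamma>" and \<omega>: "density D \<omega>"
  obtains G c where "G \<in> carrier_mat (d + 1) (d + 1)" "psd G" "mtrace G = complex_of_real c" "0 \<le> c" "c \<le> 1 / real D"
    "bot_test (epr_bra d D) (kron \<gamma> \<omega>) = G + complex_of_real (1 - c) \<cdot>\<^sub>m bot_state d"
proof -
  define B where "B = epr_bra d D * kron \<gamma> \<omega> * adj (epr_bra d D)"
  have k: "density ((d * D + 1) * D) (kron \<gamma> \<omega>)" using density_kron[OF \<gamma> \<omega>] .
  have B: "B \<in> carrier_mat d d" by (intro carrier_matI) (simp_all add: B_def)
  have pB: "psd B" unfolding B_def using k by (intro psd_conj) (auto simp: density_def)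
  define c where "c = Re (mtrace B)"
  have trB: "mtrace B = complex_of_real c" and c0: "0 \<le> c"
    using mtrace_psd[OF pB] by (auto simp: c_def complex_eq_iff less_eq_complex_def)
  show ?thesis
  proof (rule that[of "embed_bot d 1 B" c])
    show "embed_bot d 1 B \<in> carrier_mat (d + 1) (d + 1)" by (simp add: embed_bot_def)
    show "psd (embed_bot d 1 B)" by (rule cptp_psd[OF cptp_embed_bot B pB])
    show "mtrace (embed_bot d 1 B) = complex_of_real c" using cptp_mtrace[OF cptp_embed_bot B] trB by simp
    show "0 \<le> c" by (rule c0)
    show "c \<le> 1 / real D" unfolding c_def B_def by (rule epr_pass_product_le[OF \<gamma> \<omega>])
    have "mtrace (kron \<gamma> \<omega>) = 1" using k by (simp add: density_def)
    thus "bot_test (epr_bra d D) (kron \<gamma> \<omega>) = embed_bot d 1 B + complex_of_real (1 - c) \<cdot>\<^sub>m bot_state d"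
      unfolding bot_test_def Let_def B_def[symmetric] trB
      by (intro eq_matI) (auto simp: embed_bot_def bot_state_def)
  qed
qed

lemma cptp_new_enc:
  assumes "cptp (d * 2 ^ l) N EncT"
  shows "cptp d (N * 2 ^ l) (\<lambda>X. on_sub 1 (d * 2 ^ l) N (2 ^ l) EncT (kron X (epr l)))"
  using cptp_comp[OF cptp_kron_epr] cptp_on_sub[OF assms, of 1 "2 ^ l"] by simp

lemma cptp_test:
  "0 < D \<Longrightarrow> cptp ((d * D + 1) * D) (d + 1) (bot_test (epr_bra d D))"
  by (rule cptp_bot_test[OF epr_bra_carrier epr_bra_unit])

lemma cptp_new_dec:
  assumes "cptp N (d * D + 1) DecT" "0 < D"
  shows "cptp (N * D) (d + 1) (\<lambda>Y. bot_test (epr_bra d D) (on_sub 1 N (d * D + 1) D DecT Y))"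
  using cptp_comp[OF _ cptp_test[OF assms(2)]] cptp_on_sub[OF assms(1), of 1 D] by simp

text \<open>The untampered run is \<open>run_new_code\<close> with identity maps. Inner correctness
  is used with Ehat counted into the reference, and an identity on Ehat has fidelity 1, so the test
  always passes.\<close>

lemma new_code_correct:
  fixes l d N r :: nat
  defines "D \<equiv> 2 ^ l"
  assumes Enc: "cptp (d * D) N EncT" and Dec: "cptp N (d * D + 1) DecT"
    and correct: "\<And>r \<sigma>. density (d * D * r) \<sigma> \<Longrightarrow>
        on_sub 1 N (d * D + 1) r DecT (on_sub 1 (d * D) N r EncT \<sigma>) = embed_bot (d * D) r \<sigma>"
    and \<sigma>: "density (d * r) \<sigma>"
  shows "on_sub 1 (N * D) (d + 1) r (\<lambda>Y. bot_test (epr_bra d D) (on_sub 1 N (d * D + 1) D DecT Y))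
      (on_sub 1 d (N * D) r (\<lambda>X. on_sub 1 (d * D) N D EncT (kron X (epr l))) \<sigma>) = embed_bot d r \<sigma>"
proof -
  define X1 where "X1 = on_sub 1 d (d * D * D) r (\<lambda>X. kron X (epr l)) \<sigma>"
  define Y where "Y = on_sub 1 d (N * D) r (\<lambda>X. on_sub 1 (d * D) N D EncT (kron X (epr l))) \<sigma>"
  have \<sigma>c: "\<sigma> \<in> carrier_mat (d * r) (d * r)" using \<sigma> by (simp add: density_def)
  have D0: "0 < D" by (simp add: D_def)
  have X1: "density (d * D * (D * r)) X1"
    using cptp_density[OF cptp_on_sub[OF cptp_kron_epr[of d l], of 1 r], of \<sigma>] \<sigma>
    by (simp add: X1_def D_def mult_ac)
  hence X1c: "X1 \<in> carrier_mat (d * D * D * r) (d * D * D * r)" by (simp add: density_def mult_ac)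
  have id1: "on_sub (d * D) (D * r) (D * r) 1 (on_sub 1 D D r (\<lambda>X. X)) X1 = X1"
    unfolding on_sub_snd_nest using X1c by (rule on_sub_id)
  have id2: "on_sub N D D r (\<lambda>X. X) Y = Y"
    by (rule on_sub_id) (simp add: Y_def on_sub_def)
  have id3: "on_sub 1 N N (D * r) (\<lambda>X. X) Y = Y"
    by (rule on_sub_id) (simp add: Y_def on_sub_def mult_ac)
  have c: "cptp a a (\<lambda>X. X)" for a by (rule cptp_id)
  have "on_sub 1 (N * D) (d + 1) r (\<lambda>Y. bot_test (epr_bra d D) (on_sub 1 N (d * D + 1) D DecT Y)) Y
      = on_sub 1 ((d * D + 1) * D) (d + 1) r (bot_test (epr_bra d D))
          (on_sub 1 (d * D) (d * D + 1) (D * r) (\<lambda>Y. DecT (EncT Y)) X1)"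
    using run_new_code[OF Enc[unfolded D_def] Dec[unfolded D_def] c c, of r \<sigma>, folded D_def]
    unfolding Y_def[symmetric] X1_def[symmetric] id1 id2 id3 .
  also have "on_sub 1 (d * D) (d * D + 1) (D * r) (\<lambda>Y. DecT (EncT Y)) X1
      = on_sub 1 N (d * D + 1) (D * r) DecT (on_sub 1 (d * D) N (D * r) EncT X1)"
    using cptp_carrier[OF Enc] by (rule on_sub_comp[symmetric])
  also have "\<dots> = embed_bot (d * D) (D * r) X1" by (rule correct[OF X1])
  also have "on_sub 1 ((d * D + 1) * D) (d + 1) r (bot_test (epr_bra d D)) (embed_bot (d * D) (D * r) X1)
      = 1 \<cdot>\<^sub>m embed_bot d r \<sigma> + (1 - 1) \<cdot>\<^sub>m kron (bot_state d) (ptrace 1 d r \<sigma>)"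
    using run_embed[OF c \<sigma>c, of l, folded D_def] unfolding X1_def[symmetric] id1 epr_fidelity_id[OF D0] .
  also have "\<dots> = embed_bot d r \<sigma>"
    by (rule eq_matI) (auto simp: bot_state_def)
  finally show ?thesis unfolding Y_def .
qed

text \<open>\<open>\<Psi>\<close> is the inner experiment reduced to a channel on messages. The
  proof writes the new experiment as a channel \<open>\<N>\<close> applied to the inner one and
  computes \<open>\<N>\<close> on both parts of the inner ideal state.\<close>

lemma new_code_secure:
  fixes l d N :: nat and p \<epsilon> :: real
  defines "D \<equiv> 2 ^ l"
  assumes \<Psi>: "cptp (d * D) (d * D + 1) \<Psi>" and \<Lambda>: "cptp D D \<Lambda>" and p: "0 \<le> p" "p \<le> 1"
    and \<gamma>: "density (d * D + 1) \<gamma>" and \<sigma>: "density d \<sigma>"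
  defines "X' \<equiv> canon_pur (kron \<sigma> (maxmix D))" and "X0 \<equiv> canon_pur \<sigma>"
  defines "q \<equiv> Re (epr_fidelity D \<Lambda>)"
  assumes bound: "trace_norm (on_sub 1 (d * D) (d * D + 1) (d * D) \<Psi> X'
      - (complex_of_real p \<cdot>\<^sub>m embed_bot (d * D) (d * D) X'
         + complex_of_real (1 - p) \<cdot>\<^sub>m kron \<gamma> (ptrace 1 (d * D) (d * D) X'))) \<le> \<epsilon>"
  shows "trace_norm (on_sub 1 ((d * D + 1) * D) (d + 1) d (bot_test (epr_bra d D))
        (on_sub 1 (d * D) (d * D + 1) (D * d) \<Psi>
          (on_sub (d * D) (D * d) (D * d) 1 (on_sub 1 D D d \<Lambda>)
            (on_sub 1 d (d * D * D) d (\<lambda>X. kron X (epr l)) X0)))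
      - (complex_of_real (p * q) \<cdot>\<^sub>m embed_bot d d X0
         + complex_of_real (1 - p * q) \<cdot>\<^sub>m kron (bot_state d) (ptrace 1 d d X0))) \<le> \<epsilon> + 2 / real D"
proof -
  let ?K = "d * D"
  define \<Lambda>' where "\<Lambda>' = on_sub 1 D D d \<Lambda>"
  define X1 where "X1 = on_sub 1 d (?K * D) d (\<lambda>X. kron X (epr l)) X0"
  define \<Theta> where "\<Theta> Y = \<Lambda>' (swap_regs d D Y)" for Y
  define M where "M = on_sub 1 ((?K + 1) * D) (d + 1) d (bot_test (epr_bra d D))"
  \<comment> \<open>Reorders the reference of the inner experiment, tampers with Ehat, then performs
    the EPR test.\<close>
  define \<N> where "\<N> X = M (on_sub (?K + 1) ?K (D * d) 1 \<Theta> X)" for X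
  define T' where "T' = on_sub 1 ?K (?K + 1) ?K \<Psi> X'"
  define T where "T = M (on_sub 1 ?K (?K + 1) (D * d) \<Psi> (on_sub ?K (D * d) (D * d) 1 \<Lambda>' X1))"
  define \<tau> where "\<tau> = ptrace 1 ?K ?K X'"
  define \<sigma>h where "\<sigma>h = ptrace 1 d d X0"
  define E where "E = embed_bot ?K ?K X'"
  define I' where "I' = complex_of_real p \<cdot>\<^sub>m E + complex_of_real (1 - p) \<cdot>\<^sub>m kron \<gamma> \<tau>"
  have D0: "0 < D" by (simp add: D_def)
  have \<Lambda>': "cptp (D * d) (D * d) \<Lambda>'" using cptp_on_sub[OF \<Lambda>, of 1 d] by (simp add: \<Lambda>'_def)
  have \<Theta>: "cptp ?K (D * d) \<Theta>" unfolding \<Theta>_def by (rule cptp_comp[OF cptp_swap_regs \<Lambda>'])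
  have M: "cptp ((?K + 1) * D * d) ((d + 1) * d) M"
    using cptp_on_sub[OF cptp_test[OF D0], of 1 d d] by (simp add: M_def)
  have \<N>: "cptp ((?K + 1) * ?K) ((d + 1) * d) \<N>"
    unfolding \<N>_def using cptp_comp[of _ _ _ _ M] cptp_on_sub[OF \<Theta>, of "?K + 1" 1] M by (simp add: mult.assoc)

  from \<sigma> have \<sigma>c: "\<sigma> \<in> carrier_mat d d" by (simp add: density_def)
  have \<sigma>': "density ?K (kron \<sigma> (maxmix D))" by (rule density_kron[OF \<sigma> density_maxmix[OF D0]])
  have X': "density (?K * ?K) X'" unfolding X'_def by (rule density_canon_pur[OF \<sigma>'])
  have X0: "density (d * d) X0" unfolding X0_def by (rule density_canon_pur[OF \<sigma>])
  have \<tau>: "density ?K \<tau>" unfolding \<tau>_def X'_def by (rule density_marginal[OF \<sigma>'])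
  have \<sigma>h: "density d \<sigma>h" unfolding \<sigma>h_def X0_def by (rule density_marginal[OF \<sigma>])
  have carr: "X' \<in> carrier_mat (?K * ?K) (?K * ?K)" "X0 \<in> carrier_mat (d * d) (d * d)"
    "\<tau> \<in> carrier_mat ?K ?K" "\<sigma>h \<in> carrier_mat d d" "\<gamma> \<in> carrier_mat (?K + 1) (?K + 1)"
    using X' X0 \<tau> \<sigma>h \<gamma> by (auto simp: density_def)
  have T'd: "density ((?K + 1) * ?K) T'"
    using cptp_density[OF cptp_on_sub[OF \<Psi>, of 1 ?K]] X' by (simp add: T'_def)
  have Ed: "density ((?K + 1) * ?K) E"
    unfolding E_def by (rule cptp_density[OF cptp_embed_bot_register X'])
  have kd: "density ((?K + 1) * ?K) (kron \<gamma> \<tau>)" by (rule density_kron[OF \<gamma> \<tau>])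
  note carr' = T'd[unfolded density_def, THEN conjunct1] Ed[unfolded density_def, THEN conjunct1]
    kd[unfolded density_def, THEN conjunct1]
  have I'c: "I' \<in> carrier_mat ((?K + 1) * ?K) ((?K + 1) * ?K)" using carr' by (simp add: I'_def add_carrier_mat)
  \<comment> \<open>The contraction lemma is for Hermitian arguments, so the difference of real and
    ideal state must be shown Hermitian.\<close>
  have "psd I'"
    unfolding I'_def using Ed kd p carr' by (intro psd_add[of _ _ "(?K + 1) * ?K"] psd_smult) (auto simp: density_def)
  hence herm: "adj (T' - I') = T' - I'"
    using T'd adj_minus[OF carr'(1) I'c] by (simp add: density_def psd_hermitian)

  have swap: "on_sub ?K ?K (D * d) 1 \<Theta> X' = on_sub ?K (D * d) (D * d) 1 \<Lambda>' X1"
  proof -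
    have "on_sub ?K ?K (D * d) 1 \<Theta> X' = on_sub ?K (D * d) (D * d) 1 \<Lambda>' (on_sub ?K ?K (D * d) 1 (swap_regs d D) X')"
      unfolding \<Theta>_def using cptp_carrier[OF cptp_swap_regs] by (rule on_sub_comp[symmetric])
    also have "on_sub ?K ?K (D * d) 1 (swap_regs d D) X' = X1"
      unfolding X'_def X1_def X0_def D_def by (rule swap_canon_pur_maxmix[OF \<sigma>])
    finally show ?thesis .
  qed
  \<comment> \<open>\<open>\<Psi>\<close> acts on the message and \<open>\<Theta>\<close> on the
    reference, so \<open>\<Theta>\<close> may act first, where it produces the input of the new
    code.\<close>
  have T: "T = \<N> T'"
    unfolding \<N>_def T'_def on_sub_commute[OF \<Psi> \<Theta>] swap T_def ..
  have qc: "epr_fidelity D \<Lambda> = complex_of_real q" and q01: "0 \<le> q" "q \<le> 1"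
    using epr_fidelity_range[OF \<Lambda>[unfolded D_def], folded D_def]
    by (auto simp: q_def complex_eq_iff less_eq_complex_def)
  define E2 where "E2 = embed_bot d d X0"
  define B where "B = kron (bot_state d) \<sigma>h"
  have \<N>E: "\<N> E = complex_of_real q \<cdot>\<^sub>m E2 + complex_of_real (1 - q) \<cdot>\<^sub>m B"
  proof -
    \<comment> \<open>The embedding acts locally on the message register, so it commutes with
      \<open>\<Theta>\<close> just as \<open>\<Psi>\<close> does.\<close>
    have "\<N> E = M (embed_bot ?K (D * d) (on_sub ?K (D * d) (D * d) 1 \<Lambda>' X1))"
      unfolding \<N>_def E_def embed_bot_on_sub[of ?K ?K] embed_bot_on_sub[of ?K "D * d"]
        on_sub_commute[OF cptp_embed_bot \<Theta>] swap ..
    also have "\<dots> = epr_fidelity D \<Lambda> \<cdot>\<^sub>m E2 + (1 - epr_fidelity D \<Lambda>) \<cdot>\<^sub>m B"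
      unfolding M_def \<Lambda>'_def X1_def E2_def B_def \<sigma>h_def D_def
      by (rule run_embed[OF \<Lambda>[unfolded D_def] carr(2)])
    finally show ?thesis by (simp add: qc)
  qed
  define \<omega> where "\<omega> = \<Lambda> (maxmix D)"
  have \<omega>: "density D \<omega>" unfolding \<omega>_def by (rule cptp_density[OF \<Lambda> density_maxmix[OF D0]])
  hence \<omega>c: "\<omega> \<in> carrier_mat D D" by (simp add: density_def)
  obtain G c where G: "G \<in> carrier_mat (d + 1) (d + 1)" "psd G" "mtrace G = complex_of_real c"
    and c: "0 \<le> c" "c \<le> 1 / real D"
    and test: "bot_test (epr_bra d D) (kron \<gamma> \<omega>) = G + complex_of_real (1 - c) \<cdot>\<^sub>m bot_state d"
    by (rule bot_test_product[OF \<gamma> \<omega>])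
  define H where "H = kron G \<sigma>h"
  have \<N>k: "\<N> (kron \<gamma> \<tau>) = H + complex_of_real (1 - c) \<cdot>\<^sub>m B"
  proof -
    have "\<Theta> \<tau> = on_sub 1 D D d \<Lambda> (kron (maxmix D) \<sigma>h)"
      unfolding \<Theta>_def \<Lambda>'_def \<tau>_def X'_def \<sigma>h_def X0_def swap_marginal_maxmix[OF \<sigma> D0] ..
    also have "\<dots> = kron \<omega> \<sigma>h"
      unfolding \<omega>_def by (rule on_sub_fst_kron[OF \<Lambda> maxmix_carrier carr(4)])
    finally have \<Theta>\<tau>: "\<Theta> \<tau> = kron \<omega> \<sigma>h" .
    have "\<N> (kron \<gamma> \<tau>) = M (kron (kron \<gamma> \<omega>) \<sigma>h)"
      unfolding \<N>_def on_sub_snd_kron[OF \<Theta> carr(5,3)] \<Theta>\<tau> kron_assoc[OF carr(5) \<omega>c carr(4)] ..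
    also have "\<dots> = kron (G + complex_of_real (1 - c) \<cdot>\<^sub>m bot_state d) \<sigma>h"
      unfolding M_def test[symmetric] using carr \<omega>c by (intro on_sub_fst_kron cptp_test D0) auto
    also have "\<dots> = H + complex_of_real (1 - c) \<cdot>\<^sub>m B"
      unfolding H_def B_def using G carr(4)
      by (simp add: kron_add_left[of _ "d + 1" _ _ d] kron_smult_left[of _ "d + 1" _ d])
    finally show ?thesis .
  qed
  have HB: "H \<in> carrier_mat ((d + 1) * d) ((d + 1) * d)" "psd H" "mtrace H = complex_of_real c"
    "B \<in> carrier_mat ((d + 1) * d) ((d + 1) * d)" "psd B" "mtrace B = 1"
    using G \<sigma>h density_bot_state[of d]
    by (auto simp: H_def B_def density_def psd_kron[of _ "d + 1" _ d] mtrace_kron[of _ "d + 1" _ d])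
  have E2c: "E2 \<in> carrier_mat ((d + 1) * d) ((d + 1) * d)" by (simp add: E2_def)
  have Tc: "T \<in> carrier_mat ((d + 1) * d) ((d + 1) * d)" unfolding T by (rule cptp_carrier[OF \<N> carr'(1)])
  \<comment> \<open>In \<open>\<N> I'\<close> the state \<open>B\<close> has weight
    \<open>p (1 - q) + (1 - p) (1 - c)\<close>, which falls short of the target
    \<open>1 - p q\<close> by \<open>(1 - p) c\<close>. \<open>S\<close> is this missing part and
    \<open>R\<close> is what \<open>\<N> I'\<close> contains instead.\<close>
  define R where "R = complex_of_real (1 - p) \<cdot>\<^sub>m H"
  define S where "S = complex_of_real ((1 - p) * c) \<cdot>\<^sub>m B"
  have R: "R \<in> carrier_mat ((d + 1) * d) ((d + 1) * d)" "psd R" "mtrace R = complex_of_real ((1 - p) * c)"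
    using HB p psd_smult[OF HB(2), of "1 - p"] by (auto simp: R_def mtrace_smult[of _ "(d + 1) * d"])
  have S: "S \<in> carrier_mat ((d + 1) * d) ((d + 1) * d)" "psd S" "mtrace S = complex_of_real ((1 - p) * c)"
    using HB p c psd_smult[OF HB(5), of "(1 - p) * c"] by (auto simp: S_def mtrace_smult[of _ "(d + 1) * d"])
  have RSh: "adj (R - S) = R - S" using R S by (simp add: adj_minus psd_hermitian)
  have "\<N> I' = complex_of_real p \<cdot>\<^sub>m \<N> E + complex_of_real (1 - p) \<cdot>\<^sub>m \<N> (kron \<gamma> \<tau>)"
    unfolding I'_def using carr' by (simp add: cptp_add[OF \<N>] cptp_smult[OF \<N>])
  hence \<N>I': "\<N> I' = complex_of_real p \<cdot>\<^sub>m (complex_of_real q \<cdot>\<^sub>m E2 + complex_of_real (1 - q) \<cdot>\<^sub>m B)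
      + complex_of_real (1 - p) \<cdot>\<^sub>m (H + complex_of_real (1 - c) \<cdot>\<^sub>m B)"
    unfolding \<N>E \<N>k .
  have "\<N> (T' - I') = T - \<N> I'" unfolding T by (rule cptp_minus[OF \<N> carr'(1) I'c])
  hence split: "T - (complex_of_real (p * q) \<cdot>\<^sub>m E2 + complex_of_real (1 - p * q) \<cdot>\<^sub>m B) = \<N> (T' - I') + (R - S)"
    unfolding \<N>I' R_def S_def using Tc E2c HB
    by (intro eq_matI) (auto simp: algebra_simps)
  have TIc: "T' - I' \<in> carrier_mat ((?K + 1) * ?K) ((?K + 1) * ?K)" using I'c by (rule minus_carrier_mat)
  have "trace_norm (\<N> (T' - I') + (R - S)) \<le> trace_norm (\<N> (T' - I')) + trace_norm (R - S)"
    using cptp_carrier[OF \<N> TIc] cptp_trace_norm(1)[OF \<N> TIc herm] minus_carrier_mat[OF S(1)] RSh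
    by (rule trace_norm_triangle)
  also have "trace_norm (\<N> (T' - I')) \<le> trace_norm (T' - I')"
    by (rule cptp_trace_norm(2)[OF \<N> TIc herm])
  also have "trace_norm (T' - I') \<le> \<epsilon>"
    using bound unfolding T'_def I'_def E_def \<tau>_def .
  also have "trace_norm (R - S) \<le> Re (mtrace R) + Re (mtrace S)"
    by (rule trace_norm_diff_psd_le[OF R(1,2) S(1,2)])
  also have "\<dots> = 2 * ((1 - p) * c)" using R(3) S(3) by simp
  also have "(1 - p) * c \<le> 1 * (1 / real D)" using p c by (intro mult_mono) auto
  finally show ?thesis
    unfolding split[symmetric] T_def M_def \<Lambda>'_def X1_def E2_def B_def \<sigma>h_def by simp
qed

theorem theorem3p1:
  fixes t k n l :: nat and ns :: "nat list" and \<epsilon> :: real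
    and EncT DecT :: "complex mat \<Rightarrow> complex mat"
  assumes "t \<ge> 1"
    and "length ns = t"
    and "sum_list ns = n"
    and "qnm_code_LO k ns EncT DecT \<epsilon>"
    and "0 < l" and "l < k"
  shows "qtd_code_LO (k - l) (ns @ [l]) (new_enc k l n EncT) (new_dec k l n DecT)
           (\<epsilon> + 2 powr (1 - real l))
         \<and> sum_list (ns @ [l]) = n + l"
proof
  define d D N :: nat where "d = 2 ^ (k - l)" and "D = 2 ^ l" and "N = 2 ^ n"
  have K: "(2 :: nat) ^ k = d * D" using assms(6) by (simp add: d_def D_def flip: power_add)
  have N: "(2 :: nat) ^ sum_list ns = N" by (simp add: N_def assms(3))
  have ND: "(2 :: nat) ^ sum_list (ns @ [l]) = N * D" by (simp add: N_def D_def assms(3) power_add)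
  have D0: "0 < D" by (simp add: D_def)
  have err: "2 powr (1 - real l) = 2 / real D" by (simp add: powr_diff powr_realpow D_def)
  from assms(4) have qc: "qcode k ns EncT DecT" by (simp add: qnm_code_LO_def)
  hence Enc: "cptp (d * D) N EncT" and Dec: "cptp N (d * D + 1) DecT"
    and correct: "\<And>r \<sigma>. density (d * D * r) \<sigma> \<Longrightarrow>
        on_sub 1 N (d * D + 1) r DecT (on_sub 1 (d * D) N r EncT \<sigma>) = embed_bot (d * D) r \<sigma>"
    unfolding qcode_def K N by auto
  have enc: "new_enc k l n EncT = (\<lambda>X. on_sub 1 (d * D) N D EncT (kron X (epr l)))"
    by (rule ext) (simp only: new_enc_def K N_def D_def)
  have dec: "new_dec k l n DecT = (\<lambda>Y. bot_test (epr_bra d D) (on_sub 1 N (d * D + 1) D DecT Y))"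
    by (rule ext) (simp only: new_dec_eq[OF less_imp_le[OF assms(6)]] K, simp only: N_def D_def d_def)
  show "qtd_code_LO (k - l) (ns @ [l]) (new_enc k l n EncT) (new_dec k l n DecT) (\<epsilon> + 2 powr (1 - real l))"
    unfolding qtd_code_LO_def
  proof (intro conjI allI impI)
    show "qcode (k - l) (ns @ [l]) (new_enc k l n EncT) (new_dec k l n DecT)"
      unfolding qcode_def ND d_def[symmetric] enc dec
    proof (intro conjI allI impI)
      show "cptp d (N * D) (\<lambda>X. on_sub 1 (d * D) N D EncT (kron X (epr l)))"
        using cptp_new_enc[of d l N EncT] Enc by (simp add: D_def)
      show "cptp (N * D) (d + 1) (\<lambda>Y. bot_test (epr_bra d D) (on_sub 1 N (d * D + 1) D DecT Y))"
        by (rule cptp_new_dec[OF Dec D0])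
      fix r \<sigma> assume "density (d * r) \<sigma>"
      from new_code_correct[OF Enc[unfolded D_def] Dec[unfolded D_def] correct[unfolded D_def] this, folded D_def]
      show "on_sub 1 (N * D) (d + 1) r (\<lambda>Y. bot_test (epr_bra d D) (on_sub 1 N (d * D + 1) D DecT Y))
        (on_sub 1 d (N * D) r (\<lambda>X. on_sub 1 (d * D) N D EncT (kron X (epr l))) \<sigma>) = embed_bot d r \<sigma>" .
    qed
    fix Ls assume LO: "LO_adv (ns @ [l]) Ls"
    \<comment> \<open>Position \<open>length ns\<close> is the last share, Ehat; the other maps form
      an adversary against the inner code.\<close>
    define \<Lambda> where "\<Lambda> = Ls ! length ns"
    define F where "F = tamper ns (butlast Ls) 1"
    have len: "length Ls = length ns + 1" using LO by (simp add: LO_adv_def)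
    have LO': "LO_adv ns (butlast Ls)"
      unfolding LO_adv_def
    proof (intro conjI allI impI)
      fix i assume i: "i < length ns"
      hence "cptp (2 ^ ((ns @ [l]) ! i)) (2 ^ ((ns @ [l]) ! i)) (Ls ! i)" using LO by (simp add: LO_adv_def)
      thus "cptp (2 ^ (ns ! i)) (2 ^ (ns ! i)) (butlast Ls ! i)" using i len by (simp add: nth_append nth_butlast)
    qed (simp add: len)
    have \<Lambda>: "cptp D D \<Lambda>"
      using LO by (auto simp: LO_adv_def \<Lambda>_def D_def nth_append)
    note F = tamper_on_sub[OF LO' N[symmetric], folded F_def]
    define \<Psi> where "\<Psi> Y = DecT (F (EncT Y))" for Y
    have \<Psi>: "cptp (d * D) (d * D + 1) \<Psi>"
      unfolding \<Psi>_def by (rule cptp_comp[OF cptp_comp[OF Enc F(1)] Dec])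
    \<comment> \<open>\<open>p\<close> and \<open>\<gamma>\<close> are obtained from the first maps
      alone, before any message is fixed, and \<open>q\<close> depends only on
      \<open>\<Lambda>\<close>; so \<open>p * q\<close> depends only on the adversary.\<close>
    from assms(4) LO' obtain p \<gamma> where p: "0 \<le> p" "p \<le> 1" and \<gamma>: "density (d * D + 1) \<gamma>"
      and sb: "security_bound k ns EncT DecT (butlast Ls) p \<gamma> \<epsilon>"
      unfolding qnm_code_LO_def K by blast
    define q where "q = Re (epr_fidelity D \<Lambda>)"
    have q: "0 \<le> q" "q \<le> 1"
      using epr_fidelity_range[OF \<Lambda>[unfolded D_def], folded D_def] by (auto simp: q_def less_eq_complex_def)
    have "security_bound (k - l) (ns @ [l]) (new_enc k l n EncT) (new_dec k l n DecT) Ls (p * q)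
        (bot_state (2 ^ (k - l))) (\<epsilon> + 2 powr (1 - real l))"
      unfolding security_bound_def tampered_out_def ND d_def[symmetric] enc dec err
    proof (intro allI impI)
      fix \<sigma> assume \<sigma>: "density d \<sigma>"
      let ?X' = "canon_pur (kron \<sigma> (maxmix D))"
      \<comment> \<open>The inner bound is instantiated at the message \<open>\<sigma>\<close>
        together with a maximally mixed E, whose reference again has dimension
        \<open>d * D\<close>.\<close>
      have "density (d * D) (kron \<sigma> (maxmix D))" by (rule density_kron[OF \<sigma> density_maxmix[OF D0]])
      with sb have "trace_norm (on_sub 1 N (d * D + 1) (d * D) DecT
            (tamper ns (butlast Ls) (d * D) (on_sub 1 (d * D) N (d * D) EncT ?X'))
          - (complex_of_real p \<cdot>\<^sub>m embed_bot (d * D) (d * D) ?X'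
            + complex_of_real (1 - p) \<cdot>\<^sub>m kron \<gamma> (ptrace 1 (d * D) (d * D) ?X'))) \<le> \<epsilon>"
        unfolding security_bound_def tampered_out_def K N by blast
      also have "on_sub 1 N (d * D + 1) (d * D) DecT
            (tamper ns (butlast Ls) (d * D) (on_sub 1 (d * D) N (d * D) EncT ?X'))
          = on_sub 1 (d * D) (d * D + 1) (d * D) \<Psi> ?X'"
        unfolding \<Psi>_def
        by (subst F(2), simp add: on_sub_def, subst on_sub_comp[OF cptp_carrier[OF Enc]], assumption,
            rule on_sub_comp[OF cptp_carrier[OF cptp_comp[OF Enc F(1)]]])
      finally have bound: "trace_norm (on_sub 1 (d * D) (d * D + 1) (d * D) \<Psi> ?X'
          - (complex_of_real p \<cdot>\<^sub>m embed_bot (d * D) (d * D) ?X'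
            + complex_of_real (1 - p) \<cdot>\<^sub>m kron \<gamma> (ptrace 1 (d * D) (d * D) ?X'))) \<le> \<epsilon>" .
      have tam: "tamper (ns @ [l]) Ls d Y = on_sub 1 N N (D * d) F (on_sub N D D d \<Lambda> Y)" for Y
        unfolding tamper_snoc[OF len] N D_def[symmetric] \<Lambda>_def[symmetric]
        by (rule F(2)) (simp add: on_sub_def mult.assoc)
      show "trace_norm (on_sub 1 (N * D) (d + 1) d (\<lambda>Y. bot_test (epr_bra d D) (on_sub 1 N (d * D + 1) D DecT Y))
            (tamper (ns @ [l]) Ls d (on_sub 1 d (N * D) d (\<lambda>X. on_sub 1 (d * D) N D EncT (kron X (epr l))) (canon_pur \<sigma>)))
          - (complex_of_real (p * q) \<cdot>\<^sub>m embed_bot d d (canon_pur \<sigma>)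
            + complex_of_real (1 - p * q) \<cdot>\<^sub>m kron (bot_state d) (ptrace 1 d d (canon_pur \<sigma>)))) \<le> \<epsilon> + 2 / real D"
        unfolding tam run_new_code[OF Enc[unfolded D_def] Dec[unfolded D_def] F(1) \<Lambda>[unfolded D_def], folded D_def]
          \<Psi>_def[symmetric] q_def
        by (rule new_code_secure[OF \<Psi>[unfolded D_def] \<Lambda>[unfolded D_def] p \<gamma>[unfolded D_def] \<sigma>
              bound[unfolded D_def], folded D_def])
    qed
    thus "\<exists>p. 0 \<le> p \<and> p \<le> 1 \<and> security_bound (k - l) (ns @ [l]) (new_enc k l n EncT) (new_dec k l n DecT) Ls p
        (bot_state (2 ^ (k - l))) (\<epsilon> + 2 powr (1 - real l))"
      using p q by (intro exI[of _ "p * q"]) (auto intro: mult_le_one)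
  qed
  show "sum_list (ns @ [l]) = n + l" by (simp add: assms(3))
qed

end
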